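(* There are absolute constants $c_1,c_2,c_3>0$ such that the following holds. Let $\chi$ be a real Dirichlet character with conductor $q$, and suppose that $L(1-\delta,\chi)=0$ for some $0<\delta<1$. Then there exists $u$ with $c_1\log q\le \log u\le c_2\log q$ such that \[ G(e^{2u})\ \ge\ c_3\,\frac{u}{\delta\log u}. \]
   Context: $L(s,\chi)$ is the Dirichlet $L$-function of $\chi$. For real $X$, $G(X)$ denotes the largest gap between consecutive primes less than (or equal to) $X$. The paper states the conclusion as $G(e^{2u})\gg \frac{u}{\delta\log u}$ for some $u$ with $\log u\asymp\log q$, with absolute implied constants. *)

theory Defs
  imports
    "HOL-Complex_Analysis.Complex_Analysis"
    "HOL-Number_Theory.Number_Theory"
begin

definition dirichlet_character :: "nat \<Rightarrow> (int \<Rightarrow> complex) \<Rightarrow> bool" where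
  "dirichlet_character m chi \<longleftrightarrow>
     m > 0 \<and>
     (\<forall>a b. chi (a * b) = chi a * chi b) \<and>
     (\<forall>a. chi (a + int m) = chi a) \<and>
     (\<forall>a. chi a \<noteq> 0 \<longleftrightarrow> coprime a (int m))"

definition real_character :: "(int \<Rightarrow> complex) \<Rightarrow> bool" where
  "real_character chi \<longleftrightarrow> (\<forall>a. chi a \<in> \<real>)"

definition conductor :: "nat \<Rightarrow> (int \<Rightarrow> complex) \<Rightarrow> nat" where
  "conductor m chi =
     (LEAST d. d > 0 \<and> d dvd m \<and>
        (\<forall>a. coprime a (int m) \<and> [a = 1] (mod int d) \<longrightarrow> chi a = 1))"

text \<open>
  The meromorphic continuation to the whole plane of \<open>\<Sum>\<^sub>n chi(n) n\<^sup>-\<^sup>s\<close>, \<open>Re s > 1\<close>.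
  Asking for a \<^const>\<open>nicely_meromorphic_on\<close> function (removable singularities are
  removed and poles are sent to \<open>0\<close>) makes the continuation unique as a total function;
  the value \<open>0\<close> at a pole only concerns \<open>s = 1\<close> for principal \<open>chi\<close>.
\<close>
definition Dirichlet_L :: "(int \<Rightarrow> complex) \<Rightarrow> complex \<Rightarrow> complex" where
  "Dirichlet_L chi =
     (THE f. f nicely_meromorphic_on UNIV \<and>
        (\<forall>s. Re s > 1 \<longrightarrow> (\<lambda>n. chi (int (Suc n)) / of_nat (Suc n) powr s) sums f s))"

definition consecutive_primes :: "nat \<Rightarrow> nat \<Rightarrow> bool" where
  "consecutive_primes p p' \<longleftrightarrow>
     prime p \<and> prime p' \<and> p < p' \<and> (\<forall>r. p < r \<and> r < p' \<longrightarrow> \<not> prime r)"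

text \<open>Both primes are at most \<open>X\<close>; the set is nonempty exactly when \<open>X \<ge> 3\<close>.\<close>
definition max_prime_gap :: "real \<Rightarrow> nat" where
  "max_prime_gap X = Max {p' - p | p p'. consecutive_primes p p' \<and> real p' \<le> X}"

end

theory Submission
  imports Defs
begin

text \<open>
  After passing to the character modulo \<open>q\<close> inducing \<open>\<chi>\<close>, put \<open>r = 1 * \<chi> \<ge> 0\<close>. The hyperbola method
  for \<open>\<Sum> r(n) n\<^sup>\<delta>\<^sup>-\<^sup>1\<close> together with \<open>L(1 - \<delta>, \<chi>) = 0\<close> gives \<open>L(1, \<chi>) \<lless> \<delta> \<Sum>\<^sub>n\<^sub>\<le>\<^sub>Y r(n)/n\<close>, while a
  Lambert series argument gives \<open>\<Sum> r(n)/n \<lless> L(1, \<chi>) log Y\<close> over \<open>Y < n \<le> Y\<^sup>3\<close>, for \<open>Y\<close> a large power of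
  \<open>q\<close>. Multiplying \<open>n \<le> Y\<close> by a prime \<open>p\<close> in \<open>(Y, Y\<^sup>2]\<close> with \<open>\<chi>(p) = 1\<close> therefore shows that
  \<open>\<Sum> 1/p \<lless> \<delta> log Y\<close> over such \<open>p\<close>, so some dyadic block \<open>(Z, 2Z]\<close> and some class \<open>a mod q\<close> contain
  only \<open>O(\<delta> Z/\<phi>(q))\<close> primes. Sieving \<open>n \<sim> Z/q\<close> by the primes \<open>p \<le> x\<close>, so that \<open>p\<close> divides \<open>q n + a\<close> when
  \<open>p \<le> \<surd>(2Z)\<close> is coprime to \<open>q\<close>, leaves so few \<open>n\<close> that the remaining primes can remove them one by
  one; here \<open>x / log x\<close> has order \<open>\<delta> Z/q\<close>. The Chinese remainder theorem turns this covering into a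
  prime gap of length about \<open>Z/q\<close> below \<open>exp (2x)\<close>, and \<open>u = x\<close> works.
\<close>

section \<open>Continuation of Dirichlet series with periodic coefficients\<close>

text \<open>What the zero buys is cancellation. In the hyperbola sum the constant zeta(1 -
  \<delta>), which may be as large as 1/\<delta>, multiplies a partial sum of L(1 - \<delta>); with
  the zero this becomes an error term and L(1)/\<delta> stands alone. L(1) then cancels between the
  two ranges of n. Only the crude bound L(1) >> 1/q is used, to absorb errors and, with r(n) \<le>
  n, to get \<delta> >> q^(-5). The latter lets Y exceed (q/\<delta>)^2 and yet stay below a fixed
  power of q, which is why log u has the order of log q. Pigeonholing over classes mod q leaves
  phi(q) where the final bound needs q. The primes dividing q repair this: they never divide q n +
  a, so they are free to be spent on the prime values, where they save exactly phi(q)/q. The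
  L-function is given only through its continuation, and the character may be imprimitive. Complex
  analysis serves to turn the hypothesis into the vanishing of a real series grouped by periods; all
  later estimates are elementary, so every constant is explicit.\<close>

lemma holomorphic_series_half_plane:
  fixes h :: "nat \<Rightarrow> complex \<Rightarrow> complex" and c :: real
  assumes hol: "\<And>n. h n holomorphic_on {s. Re s > c}"
    and M: "continuous_on UNIV M"
    and bd: "\<And>n s. n \<ge> 1 \<Longrightarrow> Re s > c \<Longrightarrow> norm (h n s) \<le> M s * real n powr (-(Re s - c) - 1)"
  obtains g where "g holomorphic_on {s. Re s > c}" "\<And>s. Re s > c \<Longrightarrow> (\<lambda>n. h n s) sums g s"
proof -
  let ?S = "{s. Re s > c}"
  have op: "open ?S" by (rule open_halfspace_Re_gt)
  obtain g where g: "\<forall>x \<in> ?S. ((\<lambda>n. h n x) sums g x) \<and> g field_differentiable (at x)"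
  proof (rule series_differentiable_comparison_complex[OF op])
    show "h n field_differentiable at x" if "x \<in> ?S" for n x
      using hol op that by (meson holomorphic_on_imp_differentiable_at)
    fix x assume "x \<in> ?S"
    hence x: "Re x > c" by simp
    \<comment> \<open>Half the distance to the boundary: on this ball the exponent stays at most - d
      - 1 and \<open>M\<close> is bounded by compactness, so one convergent majorant serves all of
      it.\<close>
    define d where "d = (Re x - c) / 2"
    have d: "d > 0" using x by (simp add: d_def)
    have "compact (M ` cball x d)"
      by (intro compact_continuous_image continuous_on_subset[OF M]) auto
    hence "bounded (M ` cball x d)" by (rule compact_imp_bounded)
    then obtain B where B: "\<And>y. y \<in> cball x d \<Longrightarrow> norm (M y) \<le> B"
      unfolding bounded_iff by (metis image_eqI)
    define H where "H = (\<lambda>n. complex_of_real (B * real n powr (- d - 1)))"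
    have B0: "B \<ge> 0" using B[of x] d by (smt (verit) centre_in_cball norm_ge_zero)
    have "summable (\<lambda>n. B * real n powr (- d - 1))"
      using d by (intro summable_mult) (simp add: summable_real_powr_iff)
    hence "summable H" unfolding H_def by (rule summable_of_real)
    moreover have "range H \<subseteq> \<real>\<^sub>\<ge>\<^sub>0"
      using B0 by (auto simp: H_def)
    moreover have "\<forall>\<^sub>F n in sequentially. \<forall>y\<in>ball x d \<inter> ?S. norm (h n y) \<le> norm (H n)"
      using eventually_ge_at_top[of 1]
    proof eventually_elim
      case (elim n)
      show ?case
      proof
        fix y assume y: "y \<in> ball x d \<inter> ?S"
        have "\<bar>Re (x - y)\<bar> \<le> norm (x - y)" by (rule abs_Re_le_cmod)
        also have "\<dots> < d" using y by (simp add: dist_norm)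
        finally have "Re y - c \<ge> d" unfolding d_def by (simp add: abs_if field_simps split: if_splits)
        hence "real n powr (-(Re y - c) - 1) \<le> real n powr (- d - 1)"
          using elim by (intro powr_mono) auto
        moreover have "M y \<le> B" using B[of y] y by auto
        ultimately have "M y * real n powr (-(Re y - c) - 1) \<le> B * real n powr (- d - 1)"
          using B0 by (intro mult_mono) auto
        moreover have "norm (h n y) \<le> M y * real n powr (-(Re y - c) - 1)"
          using bd[of n y] y elim by auto
        moreover have "norm (H n) = B * real n powr (- d - 1)"
          using B0 by (simp only: H_def norm_of_real) simp
        ultimately show "norm (h n y) \<le> norm (H n)" by linarith
      qed
    qed
    ultimately show "\<exists>d h'. 0 < d \<and> summable h' \<and> range h' \<subseteq> \<real>\<^sub>\<ge>\<^sub>0 \<and>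
       (\<forall>\<^sub>F n in sequentially. \<forall>y\<in>ball x d \<inter> ?S. cmod (h n y) \<le> cmod (h' n))"
      using d by blast
  qed blast
  show ?thesis
  proof (rule that[of g])
    show "g holomorphic_on ?S"
      using g op by (simp add: holomorphic_on_open field_differentiable_def)
    show "\<And>s. Re s > c \<Longrightarrow> (\<lambda>n. h n s) sums g s" using g by auto
  qed
qed

text \<open>Taylor's formula along the segment from \<open>x\<close> to \<open>x + 1\<close>. For
  \<open>Re s \<ge> - real K\<close> the derivative of order K + 1 does not grow in modulus along
  it, so its size at \<open>x\<close> controls the remainder. The exponent \<open>1 - s\<close> is
  chosen because differences of these powers telescope.\<close>

lemma powr_Taylor_bound:
  fixes s :: complex and x :: real
  assumes x: "x > 0" and s: "Re s \<ge> - real K"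
  shows "norm (of_real (x + 1) powr (1 - s) - (\<Sum>i\<le>K. ((1 - s) gchoose i) * of_real x powr (1 - s - of_nat i)))
    \<le> norm (\<Prod>j\<le>K. 1 - s - of_nat j) * x powr (- Re s - real K)"
proof -
  define f where "f = (\<lambda>i z. (\<Prod>j<i. 1 - s - of_nat j) * z powr (1 - s - of_nat i))"
  define S where "S = closed_segment (complex_of_real x) (complex_of_real (x + 1))"
  have S: "S = complex_of_real ` {x..x+1}"
    unfolding S_def by (subst closed_segment_of_real) (auto simp: closed_segment_eq_real_ivl)
  have "norm (f 0 (of_real (x+1)) - (\<Sum>i\<le>K. f i (of_real x) * (of_real (x+1) - of_real x) ^ i / fact i))
     \<le> (norm (\<Prod>j\<le>K. 1 - s - of_nat j) * x powr (- Re s - real K)) * norm (complex_of_real (x+1) - of_real x) ^ Suc K / fact K"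
  proof (rule complex_Taylor)
    show "convex S" by (simp add: S_def)
    show "of_real x \<in> S" "of_real (x+1) \<in> S" by (auto simp: S_def)
    fix i :: nat and z assume z: "z \<in> S" 
    then obtain t where t: "z = of_real t" "t \<ge> x" by (auto simp: S)
    have "((\<lambda>z. z powr (1 - s - of_nat i)) has_field_derivative
        (1 - s - of_nat i) * z powr (1 - s - of_nat i - 1)) (at z within S)"
      using t x by (intro has_field_derivative_at_within[OF has_field_derivative_powr]) auto
    from DERIV_cmult[OF this, of "\<Prod>j<i. 1 - s - of_nat j"]
    show "(f i has_field_derivative f (Suc i) z) (at z within S)"
      unfolding f_def by (simp add: algebra_simps)
  next
    fix z assume z: "z \<in> S"
    then obtain t where t: "z = of_real t" "t \<ge> x" by (auto simp: S)
    have "norm (z powr (1 - s - of_nat (Suc K))) = t powr (- Re s - real K)"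
      using t x by (simp add: norm_powr_real_powr)
    also have "\<dots> \<le> x powr (- Re s - real K)"
      using t x s by (intro powr_mono2') auto
    finally show "norm (f (Suc K) z) \<le> norm (\<Prod>j\<le>K. 1 - s - of_nat j) * x powr (- Re s - real K)"
      unfolding f_def norm_mult lessThan_Suc_atMost by (intro mult_left_mono) auto
  qed
  also have "\<dots> \<le> norm (\<Prod>j\<le>K. 1 - s - of_nat j) * x powr (- Re s - real K)"
  proof -
    have "norm (complex_of_real (x+1) - of_real x) = 1" by simp
    moreover have "A / fact K \<le> A" if "A \<ge> 0" for A :: real
      using that fact_ge_1[of K, where ?'a=real] by (simp add: divide_le_eq mult_left_le  mult_le_cancel_left1)
    ultimately show ?thesis by (simp only: power_one mult_1_right) simp
  qed
  finally show ?thesis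
    unfolding f_def
    by (simp add: gbinomial_prod_rev atLeast0LessThan mult_ac)
qed


text \<open>Here \<open>g\<close> stands for (s - 1) zeta(s, a), free of the pole at 1. Summing the
  Taylor expansion of (a + n + 1)^(1 - s) over n telescopes and expresses \<open>g\<close> through
  zeta(s + i - 1, a) with i \<ge> 2, whose arguments lie at least one unit further right, plus a
  series convergent in the larger half-plane. Each induction step gains a strip of width 1.\<close>

lemma hurwitz_series_continuation:
  fixes a :: real
  assumes a: "a > 0"
  shows "\<exists>g. g holomorphic_on {s. Re s > 1 - real N} \<and>
     (\<forall>s. Re s > 1 \<longrightarrow> (\<lambda>n. complex_of_real (a + real n) powr (-s)) sums (g s / (s - 1)))"
proof (induction N)
  case 0
  obtain g where g: "g holomorphic_on {s. Re s > 1}"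
     "\<And>s. Re s > 1 \<Longrightarrow> (\<lambda>n. complex_of_real (a + real n) powr (-s)) sums g s"
  proof (rule holomorphic_series_half_plane[of "\<lambda>n s. complex_of_real (a + real n) powr (-s)" 1 "\<lambda>_. 1"])
    fix n :: nat
    show "(\<lambda>s. complex_of_real (a + real n) powr - s) holomorphic_on {s. 1 < Re s}"
      using a by (intro holomorphic_intros) (auto simp del: of_real_add)
    fix s assume "n \<ge> 1" "1 < Re s"
    thus "cmod (complex_of_real (a + real n) powr - s) \<le> 1 * real n powr (- (Re s - 1) - 1)"
      using a by (subst norm_powr_real_powr) (auto intro!: powr_mono2' simp del: of_real_add)
  qed auto
  show ?case
    by (rule exI[of _ "\<lambda>s. (s - 1) * g s"]) (use g in \<open>auto intro!: holomorphic_intros\<close>)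
next
  case (Suc N)
  then obtain g where g: "g holomorphic_on {s. Re s > 1 - real N}"
     "\<And>s. Re s > 1 \<Longrightarrow> (\<lambda>n. complex_of_real (a + real n) powr (-s)) sums (g s / (s - 1))"
    by blast
  \<comment> \<open>With this order the remainders decay like n to the power - Re s - N - 1,
    summable when Re s exceeds -N, which is \<open>c\<close>.\<close>
  define K where "K = Suc N"
  define c where "c = 1 - real (Suc N)"
  define x where "x = (\<lambda>n. complex_of_real (a + real n))"
  define R where "R = (\<lambda>n s. x (Suc n) powr (1 - s) - (\<Sum>i\<le>K. ((1 - s) gchoose i) * x n powr (1 - s - of_nat i)))"
  have x0: "x n \<noteq> 0" for n using a unfolding x_def by (metis of_real_eq_0_iff add_pos_nonneg of_nat_0_le_iff less_irrefl)
  have Rbd: "norm (R n s) \<le> norm (\<Prod>j\<le>K. 1 - s - of_nat j) * real n powr (-(Re s - c) - 1)"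
    if "n \<ge> 1" "Re s > c" for n s
  proof -
    have "norm (R n s) \<le> norm (\<Prod>j\<le>K. 1 - s - of_nat j) * (a + real n) powr (- Re s - real K)"
      using powr_Taylor_bound[of "a + real n" K s] a that
      unfolding R_def x_def by (simp add: K_def c_def add_ac)
    also have "(a + real n) powr (- Re s - real K) \<le> real n powr (- Re s - real K)"
      using a that by (intro powr_mono2') (auto simp: K_def c_def)
    also have "- Re s - real K = -(Re s - c) - 1" by (simp add: K_def c_def)
    finally show ?thesis by (simp add: mult_left_mono)
  qed
  obtain G where G: "G holomorphic_on {s. Re s > c}" "\<And>s. Re s > c \<Longrightarrow> (\<lambda>n. R n s) sums G s"
  proof (rule holomorphic_series_half_plane[of R c "\<lambda>s. norm (\<Prod>j\<le>K. 1 - s - of_nat j)"])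
    fix n
    show "R n holomorphic_on {s. c < Re s}"
      unfolding R_def gbinomial_prod_rev using x0 by (intro holomorphic_intros) auto
  qed (use Rbd in \<open>auto intro!: continuous_intros\<close>)
  define g' where "g' = (\<lambda>s. x 0 powr (1 - s) - (\<Sum>i=2..K. ((1 - s) gchoose (i - 1)) / of_nat i * g (s + of_nat (i - 1))) + G s)"
  have "g' holomorphic_on {s. Re s > c}"
  proof -
    have "(\<lambda>s. g (s + of_nat (i - 1))) holomorphic_on {s. Re s > c}" if "i \<ge> 2" for i
    proof -
      have "(g \<circ> (\<lambda>s. s + of_nat (i - 1))) holomorphic_on {s. Re s > c}"
        using that by (intro holomorphic_on_compose_gen[OF _ g(1)] holomorphic_intros)
           (auto simp: c_def of_nat_diff)
      thus ?thesis by (simp add: o_def)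
    qed
    thus ?thesis
      unfolding g'_def gbinomial_prod_rev using x0 G(1) by (intro holomorphic_intros) auto
  qed
  moreover have "(\<lambda>n. x n powr (-s)) sums (g' s / (s - 1))" if s: "Re s > 1" for s
  proof -
    have lim0: "(\<lambda>n. x n powr (1 - s)) \<longlonglongrightarrow> 0"
    proof (rule tendsto_norm_zero_cancel)
      have "(\<lambda>n. (a + real n) powr (1 - Re s)) \<longlonglongrightarrow> 0"
        using s by (intro tendsto_neg_powr filterlim_tendsto_add_at_top[OF tendsto_const] filterlim_real_sequentially) auto
      moreover have "norm (x n powr (1 - s)) = (a + real n) powr (1 - Re s)" for n
        using a by (simp add: x_def norm_powr_real_powr del: of_real_add)
      ultimately show "(\<lambda>n. norm (x n powr (1 - s))) \<longlonglongrightarrow> 0" by simp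
    qed
    have tele: "(\<lambda>n. x (Suc n) powr (1 - s) - x n powr (1 - s)) sums (0 - x 0 powr (1 - s))"
      by (rule telescope_sums[OF lim0])
    have split: "x (Suc n) powr (1 - s) - x n powr (1 - s) = 
       R n s + (1 - s) * x n powr (-s) + (\<Sum>i=2..K. ((1 - s) gchoose i) * x n powr (1 - s - of_nat i))" for n
    proof -
      have "{..K} = insert 0 (insert 1 {2..K})" by (auto simp: K_def)
      thus ?thesis unfolding R_def by simp
    qed
    \<comment> \<open>The continued zeta(s + i - 1, a) has the denominator s + i - 2, and the same
      factor sits in the binomial coefficient of order \<open>i\<close>; cancelling it keeps
      \<open>g'\<close> free of poles.\<close>
    have part: "((1 - s) gchoose i) * (g (s + of_nat (i - 1)) / (s + of_nat (i - 1) - 1)) =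
        - (((1 - s) gchoose (i - 1)) / of_nat i * g (s + of_nat (i - 1)))" if i: "i \<ge> 2" for i
    proof -
      obtain k where k: "i = Suc k" "k \<ge> 1" using i by (cases i) auto
      have nz: "s + of_nat k - 1 \<noteq> 0"
      proof
        assume "s + of_nat k - 1 = 0"
        hence "Re (s + of_nat k - 1) = 0" by simp
        thus False using s k by simp
      qed
      have "((1 - s) gchoose Suc k) * of_nat (Suc k) = ((1 - s) gchoose k) * (1 - s - of_nat k)"
        using gbinomial_absorb_comp gbinomial_mult_1[of "1 - s" k] by (simp add: algebra_simps)
      hence "((1 - s) gchoose Suc k) = - (((1 - s) gchoose k) * (s + of_nat k - 1)) / of_nat (Suc k)"
        by (simp add: field_simps del: of_nat_Suc)
      thus ?thesis using nz k by (simp del: of_nat_Suc)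
    qed
    have sg: "(\<lambda>n. ((1 - s) gchoose i) * x n powr (1 - s - of_nat i)) sums
         - (((1 - s) gchoose (i - 1)) / of_nat i * g (s + of_nat (i - 1)))" if i: "i \<ge> 2" for i
    proof -
      have "Re (s + of_nat (i - 1)) > 1" using s i by simp
      from sums_mult[OF g(2)[OF this], of "(1 - s) gchoose i"]
      have "(\<lambda>n. ((1 - s) gchoose i) * x n powr (- (s + of_nat (i - 1)))) sums
         - (((1 - s) gchoose (i - 1)) / of_nat i * g (s + of_nat (i - 1)))"
        unfolding part[OF i] x_def .
      moreover have "- (s + of_nat (i - 1)) = 1 - s - of_nat i" using i by (simp add: of_nat_diff)
      ultimately show ?thesis by (simp only:)
    qed
    have "(\<lambda>n. (x (Suc n) powr (1 - s) - x n powr (1 - s)) - R n s - (\<Sum>i=2..K. ((1 - s) gchoose i) * x n powr (1 - s - of_nat i)))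
       sums ((0 - x 0 powr (1 - s)) - G s - (\<Sum>i=2..K. - (((1 - s) gchoose (i - 1)) / of_nat i * g (s + of_nat (i - 1)))))"
      using s by (intro sums_diff tele G(2) sums_sum sg) (auto simp: c_def)
    also have "(\<lambda>n. (x (Suc n) powr (1 - s) - x n powr (1 - s)) - R n s - (\<Sum>i=2..K. ((1 - s) gchoose i) * x n powr (1 - s - of_nat i)))
       = (\<lambda>n. (1 - s) * x n powr (-s))"
      by (simp add: split)
    also have "((0 - x 0 powr (1 - s)) - G s - (\<Sum>i=2..K. - (((1 - s) gchoose (i - 1)) / of_nat i * g (s + of_nat (i - 1))))) = - g' s"
      unfolding g'_def by (simp add: sum_negf)
    finally have "(\<lambda>n. (1 - s) * x n powr (-s)) sums - g' s" .
    from sums_mult[OF this, of "1 / (1 - s)"]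
    have "(\<lambda>n. 1 / (1 - s) * ((1 - s) * x n powr (-s))) sums (1 / (1 - s) * (- g' s))" .
    moreover have s1: "1 - s \<noteq> 0" using s by auto
    hence "1 / (1 - s) * ((1 - s) * y) = y" for y by simp
    moreover have "1 / (1 - s) * (- g' s) = g' s / (s - 1)"
      by (metis minus_diff_eq minus_divide_divide mult.commute times_divide_eq_right mult_1_right)
    ultimately show ?thesis by (simp only:)
  qed
  ultimately show ?case unfolding c_def x_def by blast
qed


text \<open>The half-planes exhaust the plane, and by the identity theorem, started from Re s > 1,
  the continuations agree wherever two of them are defined; so they glue.\<close>

lemma hurwitz_entire_continuation:
  fixes a :: real
  assumes a: "a > 0"
  obtains G where "G holomorphic_on UNIV"
     "\<And>s. Re s > 1 \<Longrightarrow> (\<lambda>n. complex_of_real (a + real n) powr (-s)) sums (G s / (s - 1))"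
proof -
  have "\<exists>g. \<forall>N. g N holomorphic_on {s. Re s > 1 - real N} \<and>
     (\<forall>s. Re s > 1 \<longrightarrow> (\<lambda>n. complex_of_real (a + real n) powr (-s)) sums (g N s / (s - 1)))"
    using hurwitz_series_continuation[OF a] by (intro choice) blast
  then obtain g where hol: "\<And>N. g N holomorphic_on {s. Re s > 1 - real N}"
    and sm: "\<And>N s. Re s > 1 \<Longrightarrow> (\<lambda>n. complex_of_real (a + real n) powr (-s)) sums (g N s / (s - 1))"
    by blast
  have agree: "g M s = g N s" if "M \<le> N" "Re s > 1 - real M" for M N s
  proof (rule analytic_continuation_open[of "{s. Re s > 1}" "{s. Re s > 1 - real M}" "g M" "g N" s])
    show "open {s. 1 < Re s}" "open {s. 1 - real M < Re s}" by (rule open_halfspace_Re_gt)+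
    show "connected {s. 1 - real M < Re s}" by (intro convex_connected convex_halfspace_Re_gt)
    show "{s. 1 < Re s} \<noteq> {}" by (auto intro: exI[of _ 2])
    show "g N holomorphic_on {s. 1 - real M < Re s}"
      by (rule holomorphic_on_subset[OF hol]) (use that in auto)
    fix z assume "z \<in> {s. 1 < Re s}"
    hence "g M z / (z - 1) = g N z / (z - 1)" "z \<noteq> 1" using sums_unique2[OF sm sm] by auto
    thus "g M z = g N z" by simp
  qed (use that hol in auto)
  define G where "G = (\<lambda>s. g (nat \<lceil>2 - Re s\<rceil>) s)"
  have G: "G s = g N s" if "Re s > 1 - real N" for s N
  proof -
    have "Re s > 1 - real (nat \<lceil>2 - Re s\<rceil>)" by linarith
    thus ?thesis using agree[of N "nat \<lceil>2 - Re s\<rceil>" s] agree[of "nat \<lceil>2 - Re s\<rceil>" N s] that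
      unfolding G_def by (metis nle_le)
  qed
  show ?thesis
  proof (rule that[of G])
    have "G field_differentiable at s" for s
    proof -
      define N where "N = nat \<lceil>2 - Re s\<rceil>"
      have N: "Re s > 1 - real N" unfolding N_def by linarith
      have op: "open {s. Re s > 1 - real N}" by (rule open_halfspace_Re_gt)
      have "G holomorphic_on {s. Re s > 1 - real N}"
        using hol[of N] by (rule holomorphic_transform) (use G in auto)
      thus ?thesis using N op by (meson holomorphic_on_imp_differentiable_at mem_Collect_eq)
    qed
    thus "G holomorphic_on UNIV" by (simp add: holomorphic_on_def)
    show "(\<lambda>n. complex_of_real (a + real n) powr (-s)) sums (G s / (s - 1))" if "Re s > 1" for s
      using sm[of s 0] G[of 0 s] that by simp
  qed
qed

text \<open>This gives meaning to the definite description in \<open>Dirichlet_L\<close>. The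
  meromorphic difference vanishes on a half-plane, so it cannot avoid 0 off a sparse set and must
  vanish off one. Point by point, a pole is shared and both values are 0 by convention; elsewhere
  both values are the common limit.\<close>

lemma nicely_meromorphic_on_UNIV_unique:
  assumes F: "F nicely_meromorphic_on UNIV" and G: "G nicely_meromorphic_on UNIV"
    and eq: "\<And>s. Re s > c \<Longrightarrow> F s = G s"
  shows "F = G"
proof
  fix z
  have FG: "F meromorphic_on UNIV" "G meromorphic_on UNIV"
    using F G by (auto simp: nicely_meromorphic_on_def)
  hence "(\<lambda>s. F s - G s) meromorphic_on UNIV" by (intro meromorphic_intros)
  hence "(\<forall>\<^sub>\<approx>s. F s - G s = 0) \<or> (\<forall>\<^sub>\<approx>s. F s - G s \<noteq> 0)"
    by (rule meromorphic_imp_constant_or_avoid) auto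
  moreover have "\<not> (\<forall>\<^sub>\<approx>s. F s - G s \<noteq> 0)"
  proof
    assume "\<forall>\<^sub>\<approx>s. F s - G s \<noteq> 0"
    hence "eventually (\<lambda>s. F s - G s \<noteq> 0) (at (of_real (c + 1)))"
      by (simp add: eventually_cosparse_open_eq)
    moreover have "eventually (\<lambda>s. s \<in> {s. Re s > c}) (at (of_real (c + 1)))"
      by (rule eventually_at_in_open') (auto simp: open_halfspace_Re_gt)
    ultimately have "eventually (\<lambda>s. False) (at (of_real (c + 1) :: complex))"
      by eventually_elim (use eq in auto)
    thus False by simp
  qed
  ultimately have "\<forall>\<^sub>\<approx>s. F s - G s = 0" by blast
  hence ev: "eventually (\<lambda>s. F s = G s) (at z)"
    by (simp add: eventually_cosparse_open_eq)
  have pole: "is_pole F z \<longleftrightarrow> is_pole G z" by (rule is_pole_cong[OF ev]) auto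
  show "F z = G z"
  proof (cases "is_pole F z")
    case True
    hence "\<not> F \<midarrow>z\<rightarrow> F z" "\<not> G \<midarrow>z\<rightarrow> G z" using pole is_pole_def not_tendsto_and_filterlim_at_infinity
      by (metis at_neq_bot)+
    thus ?thesis using F G unfolding nicely_meromorphic_on_def by (metis UNIV_I)
  next
    case False
    hence "F \<midarrow>z\<rightarrow> F z" "G \<midarrow>z\<rightarrow> G z" using F G pole unfolding nicely_meromorphic_on_def by blast+
    moreover from this(1) have "G \<midarrow>z\<rightarrow> F z" using tendsto_cong[OF ev] by blast
    ultimately show ?thesis using LIM_unique by blast
  qed
qed

section \<open>Periodic coefficients: from Hurwitz series to the L-function\<close>

lemma periodic_int_mult:
  fixes f :: "int \<Rightarrow> 'a"
  assumes "\<And>a. f (a + int m) = f a"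
  shows "f (a + int j * int m) = f a"
proof (induction j)
  case (Suc j)
  have "f (a + int (Suc j) * int m) = f ((a + int j * int m) + int m)"
    by (simp add: algebra_simps)
  thus ?case using assms Suc by simp
qed simp

lemma periodic_int_bounded:
  fixes f :: "int \<Rightarrow> complex"
  assumes m: "m > 0" and per: "\<And>a. f (a + int m) = f a"
  obtains B where "\<And>n. norm (f (int n)) \<le> B"
proof
  fix n
  have "f (int n) = f (int (n mod m) + int (n div m) * int m)"
    by (metis mod_mult_div_eq of_nat_add of_nat_mult mult.commute mod_div_mult_eq)
  hence "f (int n) = f (int (n mod m))" using periodic_int_mult[of f m, OF per] by simp
  moreover have "norm (f (int (n mod m))) \<le> (\<Sum>b<m. norm (f (int b)))"
    using m by (intro member_le_sum) auto
  ultimately show "norm (f (int n)) \<le> (\<Sum>b<m. norm (f (int b)))" by simp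
qed

text \<open>Splitting the integers into residue classes writes the series as a combination of
  Hurwitz series with parameters (b + 1)/m, scaled by m^(-s). Convergence for Re s > 1 permits the
  grouping into blocks of \<open>m\<close> terms.\<close>

lemma periodic_Dirichlet_series_continuation:
  fixes f :: "int \<Rightarrow> complex"
  assumes m: "m > 0" and per: "\<And>a. f (a + int m) = f a"
  obtains E where "E holomorphic_on UNIV"
     "\<And>s. Re s > 1 \<Longrightarrow> (\<lambda>n. f (int (Suc n)) / of_nat (Suc n) powr s) sums (E s / (s - 1))"
proof -
  have "\<exists>G. \<forall>b. G b holomorphic_on UNIV \<and> (\<forall>s. Re s > 1 \<longrightarrow>
     (\<lambda>n. complex_of_real (real (Suc b) / real m + real n) powr (-s)) sums (G b s / (s - 1)))"
  proof (intro choice allI)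
    fix b
    have "real (Suc b) / real m > 0" using m by simp
    from hurwitz_entire_continuation[OF this]
    show "\<exists>G. G holomorphic_on UNIV \<and> (\<forall>s. Re s > 1 \<longrightarrow>
     (\<lambda>n. complex_of_real (real (Suc b) / real m + real n) powr (-s)) sums (G s / (s - 1)))" by metis
  qed
  then obtain G where hol: "\<And>b. G b holomorphic_on UNIV"
    and sm: "\<And>b s. Re s > 1 \<Longrightarrow> (\<lambda>n. complex_of_real (real (Suc b) / real m + real n) powr (-s)) sums (G b s / (s - 1))"
    by blast
  define E where "E = (\<lambda>s. \<Sum>b<m. f (int (Suc b)) * of_nat m powr (-s) * G b s)"
  show ?thesis
  proof (rule that[of E])
    show "E holomorphic_on UNIV" unfolding E_def using m hol
      by (intro holomorphic_intros) auto
    fix s :: complex assume s: "Re s > 1"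
    define F where "F = (\<lambda>n. f (int (Suc n)) / of_nat (Suc n) powr s)"
    obtain B where B: "\<And>n. norm (f (int n)) \<le> B" using periodic_int_bounded[of m f] m per by blast
    have "summable (\<lambda>n. B * real (Suc n) powr (- Re s))"
      using s by (intro summable_mult) (subst summable_Suc_iff, simp add: summable_real_powr_iff)
    hence "summable (\<lambda>n. norm (F n))"
    proof (rule summable_comparison_test')
      fix n :: nat
      have "norm (F n) = norm (f (int (Suc n))) * real (Suc n) powr (- Re s)"
        unfolding F_def by (simp add: norm_divide norm_powr_real_powr powr_minus_divide del: of_nat_Suc)
      also have "\<dots> \<le> B * real (Suc n) powr (- Re s)" by (intro mult_right_mono B) auto
      finally show "norm (norm (F n)) \<le> B * real (Suc n) powr (- Re s)" by simp
    qed
    hence "F sums suminf F" by (rule summable_sums[OF summable_norm_cancel])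
    hence g1: "(\<lambda>j. sum F {j*m..<j*m+m}) sums suminf F" using m by (rule sums_group)
    have blk: "sum F {j*m..<j*m+m} = (\<Sum>b<m. f (int (Suc b)) * of_nat m powr (-s) *
        complex_of_real (real (Suc b) / real m + real j) powr (-s))" for j
    proof -
      have "sum F {j*m..<j*m+m} = (\<Sum>b<m. F (b + j * m))"
        using sum.shift_bounds_nat_ivl[of F 0 "j*m" m] by (simp add: add.commute atLeast0LessThan)
      also have "\<dots> = (\<Sum>b<m. f (int (Suc b)) * of_nat m powr (-s) *
        complex_of_real (real (Suc b) / real m + real j) powr (-s))"
      proof (rule sum.cong[OF refl])
        fix b
        have e1: "f (int (Suc (b + j * m))) = f (int (Suc b))"
          using periodic_int_mult[of f m "int (Suc b)" j, OF per] by (simp add: algebra_simps)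
        have "real (Suc (b + j * m)) = real m * (real (Suc b) / real m + real j)"
          using m by (simp add: field_simps)
        hence "complex_of_real (real (Suc (b + j * m))) = complex_of_real (real m) * complex_of_real (real (Suc b) / real m + real j)"
          by (simp only: of_real_mult)
        hence "complex_of_real (real (Suc (b + j * m))) powr s = complex_of_real (real m) powr s * complex_of_real (real (Suc b) / real m + real j) powr s"
          using powr_times_real[of "complex_of_real (real m)" "complex_of_real (real (Suc b) / real m + real j)" s]
          by (simp del: of_nat_Suc of_real_add of_real_divide of_real_of_nat_eq)
        thus "F (b + j * m) = f (int (Suc b)) * of_nat m powr (-s) * complex_of_real (real (Suc b) / real m + real j) powr (-s)"
          unfolding F_def e1 powr_minus of_real_of_nat_eq by (simp only: divide_inverse inverse_mult_distrib mult.assoc)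
      qed
      finally show ?thesis .
    qed
    have "(\<lambda>j. sum F {j*m..<j*m+m}) sums (\<Sum>b<m. f (int (Suc b)) * of_nat m powr (-s) * (G b s / (s - 1)))"
      unfolding blk by (intro sums_sum sums_mult sm s)
    also have "(\<Sum>b<m. f (int (Suc b)) * of_nat m powr (-s) * (G b s / (s - 1))) = E s / (s - 1)"
      by (simp add: E_def sum_divide_distrib)
    finally have "suminf F = E s / (s - 1)" using g1 sums_unique2 by blast
    with \<open>F sums suminf F\<close> show "(\<lambda>n. f (int (Suc n)) / of_nat (Suc n) powr s) sums (E s / (s - 1))"
      unfolding F_def by simp
  qed
qed

text \<open>The definite description is unfolded here and nowhere else. From now on the L-function
  is known through the entire function \<open>E\<close>, which is (s - 1) L(s), and through its
  series for Re s > 1. \<open>E\<close> fixes the values off s = 1, hence the exclusion of that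
  point in later statements.\<close>

lemma Dirichlet_L_continuation:
  fixes f :: "int \<Rightarrow> complex"
  assumes m: "m > 0" and per: "\<And>a. f (a + int m) = f a"
  obtains E where "E holomorphic_on UNIV" "\<And>s. s \<noteq> 1 \<Longrightarrow> Dirichlet_L f s = E s / (s - 1)"
     "\<And>s. Re s > 1 \<Longrightarrow> (\<lambda>n. f (int (Suc n)) / of_nat (Suc n) powr s) sums Dirichlet_L f s"
proof -
  obtain E where E: "E holomorphic_on UNIV"
     "\<And>s. Re s > 1 \<Longrightarrow> (\<lambda>n. f (int (Suc n)) / of_nat (Suc n) powr s) sums (E s / (s - 1))"
    using periodic_Dirichlet_series_continuation[of m f] m per by blast
  define H where "H = (\<lambda>s. E s / (s - 1))"
  have Ean: "E analytic_on UNIV" using E(1) by (simp add: analytic_on_open)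
  have "H meromorphic_on UNIV" unfolding H_def
    by (intro meromorphic_intros analytic_on_imp_meromorphic_on Ean)
  hence nm: "remove_sings H nicely_meromorphic_on UNIV" by (rule remove_sings_nicely_meromorphic)
  have Hs: "remove_sings H s = H s" if "s \<noteq> 1" for s
    using that unfolding H_def
    by (intro remove_sings_at_analytic analytic_intros analytic_on_subset[OF Ean]) auto
  let ?P = "\<lambda>F. F nicely_meromorphic_on UNIV \<and>
        (\<forall>s. Re s > 1 \<longrightarrow> (\<lambda>n. f (int (Suc n)) / of_nat (Suc n) powr s) sums F s)"
  have P: "?P (remove_sings H)"
  proof (intro conjI nm allI impI)
    fix s :: complex assume "Re s > 1"
    moreover from this have "s \<noteq> 1" by auto
    ultimately show "(\<lambda>n. f (int (Suc n)) / of_nat (Suc n) powr s) sums remove_sings H s"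
      using E(2)[of s] Hs[of s] by (simp add: H_def)
  qed
  have eq: "Dirichlet_L f = remove_sings H"
    unfolding Dirichlet_L_def
  proof (rule the_equality)
    show "F = remove_sings H" if "?P F" for F
      using that P sums_unique2 by (intro nicely_meromorphic_on_UNIV_unique[of F "remove_sings H" 1]) blast+
  qed (use P in blast)
  show ?thesis
  proof (rule that[OF E(1)])
    show "Dirichlet_L f s = E s / (s - 1)" if "s \<noteq> 1" for s
      using Hs[OF that] unfolding eq H_def .
  qed (use P eq in auto)
qed

section \<open>The L-function as a sum over whole periods for Re s > 0\<close>

lemma powr_diff_bound:
  fixes s :: complex and x y :: real
  assumes x: "0 < x" "x \<le> y" and s: "Re s \<ge> 0"
  shows "norm (of_real y powr (-s) - of_real x powr (-s)) \<le> norm s * x powr (- Re s - 1) * (y - x)"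
proof -
  define S where "S = closed_segment (complex_of_real x) (complex_of_real y)"
  have S: "S = complex_of_real ` {x..y}"
    unfolding S_def using x by (subst closed_segment_of_real) (auto simp: closed_segment_eq_real_ivl)
  have "norm (of_real y powr (-s) - of_real x powr (-s)) \<le> norm s * x powr (- Re s - 1) * norm (complex_of_real y - of_real x)"
  proof (rule field_differentiable_bound[of S "\<lambda>z. z powr (-s)" "\<lambda>z. -s * z powr (-s - 1)"])
    show "convex S" by (simp add: S_def)
    show "of_real x \<in> S" "of_real y \<in> S" by (auto simp: S_def)
    fix z assume z: "z \<in> S" 
    then obtain t where t: "z = of_real t" "t \<ge> x" by (auto simp: S)
    show "((\<lambda>z. z powr - s) has_field_derivative - s * z powr (- s - 1)) (at z within S)"
      using t x by (intro has_field_derivative_at_within[OF has_field_derivative_powr]) auto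
    have "t powr (- Re s - 1) \<le> x powr (- Re s - 1)" using t x s by (intro powr_mono2') auto
    thus "norm (- s * z powr (- s - 1)) \<le> norm s * x powr (- Re s - 1)"
      using t x by (simp add: norm_mult norm_powr_real_powr mult_left_mono)
  qed
  also have "norm (complex_of_real y - of_real x) = y - x"
    using x by (simp flip: of_real_diff)
  finally show ?thesis .
qed

lemma sum_periodic_block:
  fixes f :: "int \<Rightarrow> 'a :: comm_monoid_add"
  assumes per: "\<And>a. f (a + int m) = f a"
  shows "(\<Sum>n\<in>{j*m..<j*m+m}. f (int (Suc n))) = (\<Sum>b<m. f (int (Suc b)))"
proof -
  have "(\<Sum>n\<in>{j*m..<j*m+m}. f (int (Suc n))) = (\<Sum>b<m. f (int (Suc (b + j * m))))"
    using sum.shift_bounds_nat_ivl[of "\<lambda>n. f (int (Suc n))" 0 "j*m" m] by (simp add: add.commute atLeast0LessThan)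
  also have "\<dots> = (\<Sum>b<m. f (int (Suc b)))"
    using periodic_int_mult[of f m "int (Suc b)" j for b, OF per] by (intro sum.cong) (simp_all add: algebra_simps)
  finally show ?thesis .
qed

text \<open>The coefficients of a full period sum to 0, so a constant may be subtracted from n^(-s)
  within a block; what remains makes the j-th block O(j^(-Re s - 1)). Grouping by periods thus
  replaces conditional convergence by a locally uniformly convergent series of holomorphic functions
  on Re s > 0, to which the identity theorem applies.\<close>

lemma Dirichlet_L_eq_block_series:
  fixes f :: "int \<Rightarrow> complex" and \<sigma> :: real
  assumes m: "m > 0" and per: "\<And>a. f (a + int m) = f a"
    and zero: "(\<Sum>b<m. f (int (Suc b))) = 0" and \<sigma>: "0 < \<sigma>" "\<sigma> \<noteq> 1"
  shows "(\<lambda>j. \<Sum>n\<in>{j*m..<j*m+m}. f (int (Suc n)) / of_nat (Suc n) powr of_real \<sigma>) sums Dirichlet_L f (of_real \<sigma>)"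
proof -
  define h where "h = (\<lambda>j s. \<Sum>n\<in>{j*m..<j*m+m}. f (int (Suc n)) / of_nat (Suc n) powr s)"
  obtain B where B: "\<And>n. norm (f (int n)) \<le> B" using periodic_int_bounded[of m f] m per by blast
  have B0: "B \<ge> 0" using B[of 0] norm_ge_zero order_trans by blast
  obtain E where E: "E holomorphic_on UNIV" "\<And>s. s \<noteq> 1 \<Longrightarrow> Dirichlet_L f s = E s / (s - 1)"
     "\<And>s. Re s > 1 \<Longrightarrow> (\<lambda>n. f (int (Suc n)) / of_nat (Suc n) powr s) sums Dirichlet_L f s"
    using Dirichlet_L_continuation[of m f] m per by blast
  obtain g where g: "g holomorphic_on {s. Re s > 0}" "\<And>s. Re s > 0 \<Longrightarrow> (\<lambda>n. h n s) sums g s"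
  proof (rule holomorphic_series_half_plane[of h 0 "\<lambda>s. real m * (B * (norm s * real m))"])
    show "h n holomorphic_on {s. 0 < Re s}" for n
      unfolding h_def by (intro holomorphic_intros) (auto simp del: of_nat_Suc)
    fix j :: nat and s :: complex assume j: "j \<ge> 1" and s: "Re s > 0"
    define x where "x = real (Suc (j * m))"
    have "h j s = (\<Sum>n\<in>{j*m..<j*m+m}. f (int (Suc n)) * of_real (real (Suc n)) powr (-s))
       - (\<Sum>n\<in>{j*m..<j*m+m}. f (int (Suc n))) * of_real x powr (-s)"
      using zero unfolding sum_periodic_block[of f, OF per] 
      by (simp add: h_def powr_minus divide_inverse)
    also have "\<dots> = (\<Sum>n\<in>{j*m..<j*m+m}. f (int (Suc n)) * (of_real (real (Suc n)) powr (-s) - of_real x powr (-s)))"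
      by (simp only: right_diff_distrib sum_subtractf sum_distrib_right)
    finally have "norm (h j s) \<le> (\<Sum>n\<in>{j*m..<j*m+m}. norm (f (int (Suc n)) * (of_real (real (Suc n)) powr (-s) - of_real x powr (-s))))"
      by (simp only: norm_sum)
    also have "\<dots> \<le> (\<Sum>n\<in>{j*m..<j*m+m}. B * (norm s * real m) * real j powr (- Re s - 1))"
    proof (rule sum_mono)
      fix n assume n: "n \<in> {j*m..<j*m+m}"
      have "norm (of_real (real (Suc n)) powr (-s) - of_real x powr (-s)) \<le> norm s * x powr (- Re s - 1) * (real (Suc n) - x)"
        using n s by (intro powr_diff_bound) (auto simp: x_def simp flip: of_nat_add of_nat_mult)
      also have "\<dots> \<le> norm s * real j powr (- Re s - 1) * real m"
      proof (intro mult_mono mult_left_mono powr_mono2')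
        have "j * 1 \<le> j * m" using m by (intro mult_left_mono) auto
        hence "j \<le> j * m" by (simp only: mult_1_right)
        hence "j \<le> Suc (j * m)" by (rule le_SucI)
        thus "real j \<le> x" unfolding x_def of_nat_le_iff .
        show "real (Suc n) - x \<le> real m" using n unfolding x_def
          by (simp flip: of_nat_add of_nat_mult)
        show "0 \<le> real (Suc n) - x" using n unfolding x_def
          by (simp flip: of_nat_add of_nat_mult)
      qed (use j s in auto)
      finally have "norm (f (int (Suc n))) * norm (of_real (real (Suc n)) powr (-s) - of_real x powr (-s))
         \<le> B * (norm s * real j powr (- Re s - 1) * real m)"
        by (intro mult_mono B B0) auto
      thus "norm (f (int (Suc n)) * (of_real (real (Suc n)) powr (-s) - of_real x powr (-s))) \<le> B * (norm s * real m) * real j powr (- Re s - 1)"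
        by (simp only: norm_mult mult_ac)
    qed
    also have "\<dots> = real m * (B * (norm s * real m)) * real j powr (-(Re s - 0) - 1)"
      by simp
    finally show "norm (h j s) \<le> real m * (B * (norm s * real m)) * real j powr (-(Re s - 0) - 1)" .
  qed (auto intro!: continuous_intros)
  have "(of_real \<sigma> - 1) * g (of_real \<sigma>) = E (of_real \<sigma>)"
  proof (rule analytic_continuation_open[of "{s. Re s > 1}" "{s. Re s > 0}" "\<lambda>s. (s - 1) * g s" E])
    show "open {s. 1 < Re s}" "open {s. 0 < Re s}" by (rule open_halfspace_Re_gt)+
    show "connected {s. 0 < Re s}" by (intro convex_connected convex_halfspace_Re_gt)
    show "{s. 1 < Re s} \<noteq> {}" by (auto intro: exI[of _ 2])
    show "E holomorphic_on {s. 0 < Re s}"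
      by (rule holomorphic_on_subset[OF E(1)]) auto
    show "(\<lambda>s. (s - 1) * g s) holomorphic_on {s. 0 < Re s}" by (intro holomorphic_intros g)
    fix s assume "s \<in> {s. 1 < Re s}"
    hence s: "Re s > 1" by simp
    have "(\<lambda>j. h j s) sums Dirichlet_L f s" 
      unfolding h_def using E(3)[OF s] m by (rule sums_group)
    moreover have "(\<lambda>j. h j s) sums g s" using s by (intro g) auto
    ultimately have "g s = Dirichlet_L f s" using sums_unique2 by blast
    moreover have "s \<noteq> 1" using s by auto
    ultimately show "(s - 1) * g s = E s" using E(2)[of s] by simp
  qed (use \<sigma> in auto)
  hence "g (of_real \<sigma>) = Dirichlet_L f (of_real \<sigma>)"
    using E(2)[of "of_real \<sigma>"] \<sigma>(2)
    by (metis nonzero_mult_div_cancel_left right_minus_eq of_real_eq_1_iff)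
  thus ?thesis using g(2)[of "of_real \<sigma>"] \<sigma> unfolding h_def by simp
qed

section \<open>Euler factors and real zeros\<close>

lemma Dirichlet_L_factor:
  fixes f f' :: "int \<Rightarrow> complex" and c :: "complex \<Rightarrow> complex"
  assumes m: "m > 0" and per: "\<And>a. f (a + int m) = f a"
    and m': "m' > 0" and per': "\<And>a. f' (a + int m') = f' a"
    and c: "c holomorphic_on UNIV"
    and eq: "\<And>s y. Re s > 1 \<Longrightarrow> (\<lambda>n. f (int (Suc n)) / of_nat (Suc n) powr s) sums y \<Longrightarrow>
       (\<lambda>n. f' (int (Suc n)) / of_nat (Suc n) powr s) sums (c s * y)"
    and s: "s \<noteq> 1"
  shows "Dirichlet_L f' s = c s * Dirichlet_L f s"
proof -
  obtain E where E: "E holomorphic_on UNIV" "\<And>s. s \<noteq> 1 \<Longrightarrow> Dirichlet_L f s = E s / (s - 1)"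
     "\<And>s. Re s > 1 \<Longrightarrow> (\<lambda>n. f (int (Suc n)) / of_nat (Suc n) powr s) sums Dirichlet_L f s"
    using Dirichlet_L_continuation[of m f] m per by blast
  obtain E' where E': "E' holomorphic_on UNIV" "\<And>s. s \<noteq> 1 \<Longrightarrow> Dirichlet_L f' s = E' s / (s - 1)"
     "\<And>s. Re s > 1 \<Longrightarrow> (\<lambda>n. f' (int (Suc n)) / of_nat (Suc n) powr s) sums Dirichlet_L f' s"
    using Dirichlet_L_continuation[of m' f'] m' per' by blast
  \<comment> \<open>Comparing (s - 1) L(s) on both sides keeps all functions entire, whether or not
    there is a pole at 1.\<close>
  have "E' s = c s * E s"
  proof (rule analytic_continuation_open[of "{s. Re s > 1}" UNIV E' "\<lambda>s. c s * E s"])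
    show "open {s. 1 < Re s}" by (rule open_halfspace_Re_gt)
    show "{s. 1 < Re s} \<noteq> {}" by (auto intro: exI[of _ 2])
    show "(\<lambda>s. c s * E s) holomorphic_on UNIV" by (intro holomorphic_intros c E)
    fix s assume "s \<in> {s. 1 < Re s}"
    hence s: "Re s > 1" by simp
    hence "s \<noteq> 1" by auto
    moreover have "Dirichlet_L f' s = c s * Dirichlet_L f s"
      using eq[OF s E(3)[OF s]] E'(3)[OF s] sums_unique2 by blast
    ultimately show "E' s = c s * E s" using E(2) E'(2) by auto
  qed (use E' in auto)
  thus ?thesis using E(2) E'(2) s by simp
qed

lemma Dirichlet_series_multiples_sums:
  fixes f :: "int \<Rightarrow> complex"
  assumes p: "p > 0" and mult: "\<And>a b. f (a * b) = f a * f b"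
    and y: "(\<lambda>n. f (int (Suc n)) / of_nat (Suc n) powr s) sums y"
  shows "(\<lambda>n. if p dvd Suc n then f (int (Suc n)) / of_nat (Suc n) powr s else 0) sums (f (int p) / of_nat p powr s * y)"
proof -
  \<comment> \<open>Index \<open>n\<close> of the series stands for the integer n + 1, so the
    multiples of \<open>p\<close> sit at the indices \<open>p * Suc k - 1\<close>.\<close>
  define g where "g = (\<lambda>k. p * Suc k - 1)"
  have g: "Suc (g k) = p * Suc k" for k using p by (simp add: g_def)
  have sm: "strict_mono g"
  proof (rule strict_monoI)
    fix i j :: nat assume "i < j"
    hence "p * Suc i < p * Suc j" using p by simp
    thus "g i < g j" using g[of i] g[of j] by linarith
  qed
  let ?F = "\<lambda>n. if p dvd Suc n then f (int (Suc n)) / of_nat (Suc n) powr s else 0"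
  have "?F n = 0" if "n \<notin> range g" for n
  proof -
    have "\<not> p dvd Suc n"
    proof
      assume "p dvd Suc n"
      then obtain k where k: "Suc n = p * k" by (auto elim: dvdE)
      hence "k > 0" using gr0I by fastforce
      hence "Suc n = Suc (g (k - 1))" using g[of "k - 1"] k by simp
      hence "n = g (k - 1)" by simp
      thus False using that by blast
    qed
    thus ?thesis by simp
  qed
  from sums_mono_reindex[of g ?F, OF sm this]
  have "(\<lambda>k. ?F (g k)) sums (f (int p) / of_nat p powr s * y) \<longleftrightarrow> ?F sums (f (int p) / of_nat p powr s * y)"
    by blast
  moreover have "?F (g k) = f (int p) / of_nat p powr s * (f (int (Suc k)) / of_nat (Suc k) powr s)" for k
  proof -
    have "of_nat (p * Suc k) powr s = of_nat p powr s * (of_nat (Suc k) powr s :: complex)"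
      unfolding of_nat_mult by (rule powr_times_real) auto
    moreover have "f (int (p * Suc k)) = f (int p) * f (int (Suc k))"
      using mult[of "int p" "int (Suc k)"] by (simp only: of_nat_mult)
    ultimately show ?thesis unfolding g by simp
  qed
  ultimately show ?thesis using sums_mult[OF y, of "f (int p) / of_nat p powr s"] by simp
qed

lemma Dirichlet_L_remove_prime:
  fixes f :: "int \<Rightarrow> complex"
  assumes m: "m > 0" and per: "\<And>a. f (a + int m) = f a"
    and mult: "\<And>a b. f (a * b) = f a * f b" and p: "p > 0" and s: "s \<noteq> 1"
  shows "Dirichlet_L (\<lambda>a. if int p dvd a then 0 else f a) s = (1 - f (int p) / of_nat p powr s) * Dirichlet_L f s"
proof (rule Dirichlet_L_factor[of m f "m * p" _ "\<lambda>s. 1 - f (int p) / of_nat p powr s"])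
  show "(\<lambda>s. 1 - f (int p) / of_nat p powr s) holomorphic_on UNIV"
    using p by (intro holomorphic_intros) auto
  show "(if int p dvd a + int (m * p) then 0 else f (a + int (m * p))) = (if int p dvd a then 0 else f a)" for a
    using periodic_int_mult[of f m a p, OF per] by (simp add: mult.commute dvd_add_left_iff)
  fix s y assume y: "(\<lambda>n. f (int (Suc n)) / of_nat (Suc n) powr s) sums y"
  have "(\<lambda>n. (if int p dvd int (Suc n) then 0 else f (int (Suc n))) / of_nat (Suc n) powr s) =
     (\<lambda>n. f (int (Suc n)) / of_nat (Suc n) powr s - (if p dvd Suc n then f (int (Suc n)) / of_nat (Suc n) powr s else 0))"
    unfolding int_dvd_int_iff by auto
  also have "\<dots> sums (y - f (int p) / of_nat p powr s * y)"
    by (intro sums_diff y Dirichlet_series_multiples_sums p mult)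
  finally show "(\<lambda>n. (if int p dvd int (Suc n) then 0 else f (int (Suc n))) / of_nat (Suc n) powr s) sums
      ((1 - f (int p) / of_nat p powr s) * y)" by (simp only: left_diff_distrib mult_1_left)
qed (use m p per s in auto)

text \<open>Removing a prime multiplies the L-function by 1 - f(p) p^(-\<sigma>), which cannot
  vanish because |f(p)| \<le> 1 < p^\<sigma>. So a positive real zero of an imprimitive character is
  inherited by the character that induces it.\<close>

lemma Dirichlet_L_zero_remove_primes:
  fixes f :: "int \<Rightarrow> complex" and \<sigma> :: real
  assumes P: "finite P" "\<And>p. p \<in> P \<Longrightarrow> p \<ge> 2"
    and m: "m > 0" and per: "\<And>a. f (a + int m) = f a"
    and mult: "\<And>a b. f (a * b) = f a * f b" and bd: "\<And>a. norm (f a) \<le> 1"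
    and prm: "\<And>p. p \<in> P \<Longrightarrow> prime p"
    and \<sigma>: "0 < \<sigma>" "\<sigma> \<noteq> 1"
    and zero: "Dirichlet_L (\<lambda>a. if \<exists>p\<in>P. int p dvd a then 0 else f a) (of_real \<sigma>) = 0"
  shows "Dirichlet_L f (of_real \<sigma>) = 0"
  using P m per mult bd prm zero
proof (induction P arbitrary: f m rule: finite_induct)
  case empty
  thus ?case by simp
next
  case (insert p P f m)
  define f' where "f' = (\<lambda>a. if int p dvd a then 0 else f a)"
  have p: "p \<ge> 2" "prime p" using insert.prems by auto
  have "Dirichlet_L f' (of_real \<sigma>) = 0"
  proof (rule insert.IH)
    show "f' (a + int (m * p)) = f' a" for a
      using periodic_int_mult[of f m a p, OF insert.prems(3)] by (simp add: f'_def mult.commute dvd_add_left_iff)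
    show "f' (a * b) = f' a * f' b" for a b
      using p insert.prems(4) by (auto simp: f'_def prime_dvd_mult_iff)
    have "(\<lambda>a. if \<exists>p\<in>P. int p dvd a then 0 else f' a) = (\<lambda>a. if \<exists>p\<in>insert p P. int p dvd a then 0 else f a)"
      by (auto simp: f'_def)
    thus "Dirichlet_L (\<lambda>a. if \<exists>p\<in>P. int p dvd a then 0 else f' a) (of_real \<sigma>) = 0"
      using insert.prems by simp
    show "m * p > 0" using insert.prems(2) p by simp
  qed (use insert.prems in \<open>auto simp: f'_def\<close>)
  moreover have "Dirichlet_L f' (of_real \<sigma>) = (1 - f (int p) / of_nat p powr of_real \<sigma>) * Dirichlet_L f (of_real \<sigma>)"
    unfolding f'_def
  proof (rule Dirichlet_L_remove_prime[of m])
    show "p > 0" using p(1) by linarith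
  qed (use insert.prems \<sigma> in auto)
  moreover have "f (int p) / of_nat p powr of_real \<sigma> \<noteq> 1"
  proof
    assume "f (int p) / of_nat p powr of_real \<sigma> = 1"
    hence "norm (f (int p) / of_nat p powr of_real \<sigma>) = 1" by simp
    hence "norm (f (int p)) = real p powr \<sigma>"
      using p by (simp add: norm_divide norm_powr_real_powr field_simps split: if_splits)
    moreover have "real p powr \<sigma> > 1" using p \<sigma> by (intro gr_one_powr) auto
    ultimately show False using insert.prems(5)[of "int p"] by linarith
  qed
  ultimately show ?case by auto
qed

text \<open>The alternating series \<open>(1 - 2\<^sup>1\<^sup>-\<^sup>s) \<zeta>(s)\<close> is positive on the real axis, so \<open>\<zeta>\<close> has no zero there.\<close>
lemma Dirichlet_L_one_nonzero:
  fixes \<sigma> :: real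
  assumes \<sigma>: "0 < \<sigma>" "\<sigma> \<noteq> 1"
  shows "Dirichlet_L (\<lambda>_. 1) (of_real \<sigma>) \<noteq> 0"
proof
  assume zero: "Dirichlet_L (\<lambda>_. 1) (of_real \<sigma>) = 0"
  define e :: "int \<Rightarrow> complex" where "e = (\<lambda>a. if even a then -1 else 1)"
  have "Dirichlet_L e (of_real \<sigma>) = (1 - 2 / of_nat 2 powr of_real \<sigma>) * Dirichlet_L (\<lambda>_. 1) (of_real \<sigma>)"
  proof (rule Dirichlet_L_factor[of 1 _ 2 _ "\<lambda>s. 1 - 2 / of_nat 2 powr s"])
    show "(\<lambda>s::complex. 1 - 2 / of_nat 2 powr s) holomorphic_on UNIV"
      by (intro holomorphic_intros) auto
    fix s y :: complex assume y: "(\<lambda>n. 1 / of_nat (Suc n) powr s) sums y"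
    have "(\<lambda>n. e (int (Suc n)) / of_nat (Suc n) powr s) =
       (\<lambda>n. 1 / of_nat (Suc n) powr s - 2 * (if 2 dvd Suc n then 1 / of_nat (Suc n) powr s else 0))"
      by (auto simp: e_def simp del: of_nat_Suc)
    also have "\<dots> sums (y - 2 * (1 / of_nat 2 powr s * y))"
      using Dirichlet_series_multiples_sums[of 2 "\<lambda>_. 1" s y] y
      by (intro sums_diff sums_mult y) (auto simp del: of_nat_Suc)
    finally show "(\<lambda>n. e (int (Suc n)) / of_nat (Suc n) powr s) sums ((1 - 2 / of_nat 2 powr s) * y)"
      by (simp add: algebra_simps del: of_nat_Suc)
  qed (use \<sigma> in \<open>auto simp: e_def\<close>)
  hence "Dirichlet_L e (of_real \<sigma>) = 0" using zero by simp
  moreover have "(\<lambda>j. \<Sum>n\<in>{j*2..<j*2+2}. e (int (Suc n)) / of_nat (Suc n) powr of_real \<sigma>) sums Dirichlet_L e (of_real \<sigma>)"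
    by (rule Dirichlet_L_eq_block_series) (use \<sigma> in \<open>auto simp: e_def numeral_2_eq_2\<close>)
  moreover have "(\<Sum>n\<in>{j*2..<j*2+2}. e (int (Suc n)) / of_nat (Suc n) powr of_real \<sigma>) =
      of_real (1 / real (2*j+1) powr \<sigma> - 1 / real (2*j+2) powr \<sigma>)" for j
  proof -
    have "{j*2..<j*2+2} = {2*j, Suc (2*j)}" by auto
    moreover have "complex_of_nat k powr of_real \<sigma> = of_real (real k powr \<sigma>)" for k
      using powr_of_real[of "real k" \<sigma>] by simp
    ultimately show ?thesis by (simp add: e_def del: of_nat_Suc of_nat_add of_nat_mult)
  qed
  ultimately have "(\<lambda>j. complex_of_real (1 / real (2*j+1) powr \<sigma> - 1 / real (2*j+2) powr \<sigma>)) sums of_real 0"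
    by simp
  hence sm: "(\<lambda>j. 1 / real (2*j+1) powr \<sigma> - 1 / real (2*j+2) powr \<sigma>) sums 0"
    unfolding sums_of_real_iff .
  have pos: "1 / real (2*j+1) powr \<sigma> - 1 / real (2*j+2) powr \<sigma> > 0" for j
  proof -
    have "real (2*j+1) powr \<sigma> < real (2*j+2) powr \<sigma>" using \<sigma> by (intro powr_less_mono2) auto
    thus ?thesis by (simp add: frac_less2)
  qed
  have "0 < (\<Sum>j. 1 / real (2*j+1) powr \<sigma> - 1 / real (2*j+2) powr \<sigma>)"
    using sm pos by (intro suminf_pos) (auto simp: sums_iff)
  thus False using sm by (simp add: sums_iff)
qed

section \<open>Reduction to a character modulo the conductor\<close>

lemma dirichlet_character_one:
  assumes "dirichlet_character m chi"
  shows "chi 1 = 1"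
proof -
  have "chi 1 \<noteq> 0" "chi (1 * 1) = chi 1 * chi 1"
    using assms unfolding dirichlet_character_def by (blast intro: coprime_1_left)+
  thus ?thesis by simp
qed

lemma dirichlet_character_cong:
  assumes chi: "dirichlet_character m chi" and ab: "[a = b] (mod int m)"
  shows "chi a = chi b"
proof -
  have per: "\<And>a. chi (a + int m) = chi a" using chi by (auto simp: dirichlet_character_def)
  have shift: "chi (a + int j * int m) = chi a" for a j using periodic_int_mult[of chi m, OF per] .
  from ab obtain k where k: "b = a + int m * k" by (metis cong_iff_lin)
  show ?thesis
  proof (cases "k \<ge> 0")
    case True
    thus ?thesis using shift[of a "nat k"] k by (simp add: mult.commute)
  next
    case False
    thus ?thesis using shift[of b "nat (-k)"] k by (simp add: mult.commute)
  qed
qed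

lemma dirichlet_character_pow_totient:
  assumes chi: "dirichlet_character m chi" and a: "coprime a (int m)"
  shows "chi a ^ totient m = 1"
proof -
  have pow: "chi (a ^ k) = chi a ^ k" for k
    using dirichlet_character_one[OF chi] chi by (induction k) (auto simp: dirichlet_character_def)
  have m: "m > 0" using chi by (simp add: dirichlet_character_def)
  define b where "b = nat (a mod int m)"
  have b: "int b = a mod int m" using m by (simp add: b_def)
  have "coprime (int b) (int m)" using a b m by simp
  hence "coprime b m" by simp
  hence "[b ^ totient m = 1] (mod m)" by (rule euler_theorem)
  hence "[int b ^ totient m = 1] (mod int m)" by (metis cong_int_iff of_nat_1 of_nat_power)
  moreover have "[a ^ totient m = int b ^ totient m] (mod int m)" unfolding b by (intro cong_pow) (simp add: cong_def)
  ultimately have "[a ^ totient m = 1] (mod int m)" using cong_trans by blast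
  from dirichlet_character_cong[OF chi this] pow show ?thesis using dirichlet_character_one[OF chi] by simp
qed

lemma real_root_of_unity:
  fixes x :: real
  assumes "x ^ n = 1" "n > 0"
  shows "x = 1 \<or> x = -1"
proof -
  have "\<bar>x\<bar> ^ n = 1" using assms by (simp flip: power_abs)
  hence "\<bar>x\<bar> = 1" using power_eq_1_iff[of "\<bar>x\<bar>" n] assms(2) by auto
  thus ?thesis by linarith
qed

lemma real_character_values:
  assumes chi: "dirichlet_character m chi" and re: "real_character chi"
  shows "chi a \<in> {-1, 0, 1}"
proof (cases "coprime a (int m)")
  case True
  have m: "m > 0" using chi by (simp add: dirichlet_character_def)
  have "chi a = of_real (Re (chi a))" using re by (simp add: real_character_def)
  hence "complex_of_real (Re (chi a) ^ totient m) = 1"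
    using dirichlet_character_pow_totient[OF chi True] by (metis of_real_power)
  hence "Re (chi a) ^ totient m = 1" by (simp only: of_real_eq_1_iff)
  hence "Re (chi a) = 1 \<or> Re (chi a) = -1" using m by (intro real_root_of_unity[of _ "totient m"]) auto
  thus ?thesis using \<open>chi a = of_real (Re (chi a))\<close> by (metis insert_iff of_real_1 of_real_minus)
next
  case False
  thus ?thesis using chi by (auto simp: dirichlet_character_def)
qed

lemma conductor_props:
  assumes chi: "dirichlet_character m chi"
  defines "q \<equiv> conductor m chi"
  shows "q > 0" "q dvd m" "\<And>a. coprime a (int m) \<Longrightarrow> [a = 1] (mod int q) \<Longrightarrow> chi a = 1"
    and "\<And>d. d > 0 \<Longrightarrow> d dvd m \<Longrightarrow> (\<And>a. coprime a (int m) \<Longrightarrow> [a = 1] (mod int d) \<Longrightarrow> chi a = 1) \<Longrightarrow> q \<le> d"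
proof -
  let ?P = "\<lambda>d. d > 0 \<and> d dvd m \<and>
        (\<forall>a. coprime a (int m) \<and> [a = 1] (mod int d) \<longrightarrow> chi a = 1)"
  have "?P m" using chi dirichlet_character_cong[OF chi] dirichlet_character_one[OF chi]
    by (auto simp: dirichlet_character_def)
  hence P: "?P q" unfolding q_def conductor_def by (rule LeastI)
  show "q > 0" "q dvd m" "\<And>a. coprime a (int m) \<Longrightarrow> [a = 1] (mod int q) \<Longrightarrow> chi a = 1"
    using P by auto
  show "q \<le> d" if "d > 0" "d dvd m" "\<And>a. coprime a (int m) \<Longrightarrow> [a = 1] (mod int d) \<Longrightarrow> chi a = 1" for d
    unfolding q_def conductor_def by (rule Least_le) (use that in auto)
qed

text \<open>With \<open>k\<close> the product of the primes dividing \<open>m\<close> but not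
  \<open>a\<close>, every prime divisor of \<open>m\<close> divides exactly one of \<open>a\<close>
  and \<open>k * q\<close>, hence not their sum.\<close>

lemma exists_coprime_lift:
  fixes a :: int
  assumes m: "m > 0" and qm: "q dvd m" and a: "coprime a (int q)"
  obtains b where "[b = a] (mod int q)" "coprime b (int m)"
proof -
  define Q where "Q = {p \<in> prime_factors m. \<not> int p dvd a}"
  define k where "k = \<Prod>Q"
  have finQ: "finite Q" by (simp add: Q_def)
  have "coprime (a + int k * int q) (int m)"
  proof (rule ccontr)
    assume "\<not> coprime (a + int k * int q) (int m)"
    then obtain d where d: "d dvd a + int k * int q" "d dvd int m" "\<not> is_unit d"
      by (auto simp: coprime_def)
    have "d \<noteq> 0" using d(2) m by auto
    then obtain p' where "prime p'" "p' dvd d" using d(3) prime_divisor_exists by blast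
    moreover from this have "p' = int (nat p')" using prime_ge_0_int by simp
    ultimately obtain p where p: "prime p" "int p dvd d" by (metis prime_int_nat_transfer prime_nat_int_transfer)
    have dv: "int p dvd a + int k * int q" "p dvd m"
      using p d dvd_trans by (blast, metis dvd_trans int_dvd_int_iff)
    show False
    proof (cases "int p dvd a")
      case True
      hence "int p dvd int k * int q" using dv(1) dvd_add_right_iff by blast
      hence "p dvd k * q" by (metis int_dvd_int_iff of_nat_mult)
      hence "p dvd k \<or> p dvd q" using p by (simp add: prime_dvd_mult_iff)
      moreover have "\<not> p dvd q"
      proof
        assume "p dvd q"
        hence "int p dvd 1" using True a by (metis coprime_common_divisor int_dvd_int_iff)
        thus False using p by (simp add: not_prime_1) 
      qed
      moreover have "\<not> p dvd k"
      proof
        assume "p dvd k"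
        then obtain r where r: "r \<in> Q" "p dvd r" using p finQ unfolding k_def by (auto simp: prime_dvd_prod_iff)
        hence "p = r" using p primes_dvd_imp_eq by (auto simp: Q_def prime_factors_dvd)
        thus False using r True by (simp add: Q_def)
      qed
      ultimately show False by blast
    next
      case False
      hence "p \<in> Q" using p dv m by (auto simp: Q_def prime_factors_dvd)
      hence "p dvd k" unfolding k_def using finQ dvd_prodI[of Q p "\<lambda>x. x"] by simp
      hence "int p dvd int k * int q" by (simp add: dvd_mult2)
      thus False using False dv(1) dvd_add_left_iff by blast
    qed
  qed
  moreover have "[a + int k * int q = a] (mod int q)" by (simp add: cong_def)
  ultimately show ?thesis using that by blast
qed

text \<open>\<open>psi a\<close> is \<open>chi\<close> at a representative of \<open>a\<close> mod
  \<open>q\<close> that is coprime to \<open>m\<close>. The choice does not matter: if b and b'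
  agree mod \<open>q\<close> and c inverts b' mod \<open>m\<close>, then b c is 1 mod
  \<open>q\<close>, so the defining property of the conductor gives
  \<open>chi (b * c) = 1 = chi (b' * c)\<close>. The last conclusion carries restrictions on the
  values of \<open>chi\<close> over to \<open>psi\<close>.\<close>

lemma inducing_character:
  assumes chi: "dirichlet_character m chi"
  defines "q \<equiv> conductor m chi"
  obtains psi where "dirichlet_character q psi"
    "\<And>a. coprime a (int m) \<Longrightarrow> psi a = chi a" "\<And>a. psi a \<in> insert 0 (range chi)"
proof -
  note q = conductor_props[OF chi, folded q_def]
  have m: "m > 0" and mult: "\<And>a b. chi (a * b) = chi a * chi b" and nz: "\<And>a. chi a \<noteq> 0 \<longleftrightarrow> coprime a (int m)"
    using chi by (auto simp: dirichlet_character_def)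
  have wd: "chi b = chi b'" if "[b = b'] (mod int q)" "coprime b (int m)" and b': "coprime b' (int m)" for b b'
  proof -
    obtain c where c: "[b' * c = 1] (mod int m)" using b' cong_solve_coprime_int by blast
    hence cm: "coprime c (int m)" using coprime_iff_invertible_int m by (metis mult.commute)
    have "[b' * c = 1] (mod int q)" using c q(2) cong_dvd_modulus by (metis int_dvd_int_iff)
    moreover have "[b * c = b' * c] (mod int q)" using that(1) by (rule cong_scalar_right)
    ultimately have "[b * c = 1] (mod int q)" using cong_trans by blast
    hence "chi (b * c) = 1" using that(2) cm by (intro q(3)) simp
    moreover have "chi (b' * c) = 1" using dirichlet_character_cong[OF chi c] dirichlet_character_one[OF chi] by simp
    moreover have "chi c \<noteq> 0" using cm nz by simp
    ultimately show ?thesis using mult by (metis mult_right_cancel)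
  qed
  have "\<exists>l. \<forall>a. coprime a (int q) \<longrightarrow> [l a = a] (mod int q) \<and> coprime (l a) (int m)"
    by (rule choice) (use exists_coprime_lift[OF m q(2)] in metis)
  then obtain l where l: "\<And>a. coprime a (int q) \<Longrightarrow> [l a = a] (mod int q)"
     "\<And>a. coprime a (int q) \<Longrightarrow> coprime (l a) (int m)" by blast
  define psi where "psi = (\<lambda>a. if coprime a (int q) then chi (l a) else 0)"
  have psi_eq: "psi a = chi b" if "[b = a] (mod int q)" "coprime b (int m)" for a b
  proof -
    have "coprime b (int q)" using that(2) q(2) by (meson coprime_divisors dvd_refl int_dvd_int_iff)
    hence "coprime a (int q)" using that(1) cong_imp_coprime by blast
    moreover from this have "chi (l a) = chi b" using l that by (intro wd) (auto intro: cong_trans[OF _ cong_sym])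
    ultimately show ?thesis by (simp add: psi_def)
  qed
  show ?thesis
  proof (rule that[of psi])
    show "dirichlet_character q psi" unfolding dirichlet_character_def
    proof (intro conjI allI)
      show "q > 0" by (rule q)
      show "psi (a + int q) = psi a" for a
      proof (cases "coprime a (int q)")
        case True
        have "[l a = a + int q] (mod int q)" using l(1)[OF True] by (simp add: cong_def)
        thus ?thesis using psi_eq[of "l a" "a + int q"] psi_eq[of "l a" a] l True by simp
      next
        case False
        hence "\<not> coprime (a + int q) (int q)" by (simp add: coprime_iff_gcd_eq_1)
        thus ?thesis using False by (simp add: psi_def)
      qed
      show "psi (a * b) = psi a * psi b" for a b
      proof (cases "coprime a (int q) \<and> coprime b (int q)")
        case True
        hence "[l a * l b = a * b] (mod int q)" "coprime (l a * l b) (int m)" using l by (auto intro: cong_mult)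
        from psi_eq[OF this] True show ?thesis using mult by (simp add: psi_def)
      next
        case False
        thus ?thesis by (auto simp: psi_def)
      qed
      show "(psi a \<noteq> 0) = coprime a (int q)" for a using l nz by (auto simp: psi_def)
    qed
    show "psi a = chi a" if "coprime a (int m)" for a using psi_eq[of a a] that by simp
    show "psi a \<in> insert 0 (range chi)" for a by (auto simp: psi_def)
  qed
qed

lemma sum_nonprincipal_character:
  assumes psi: "dirichlet_character q psi" and a: "coprime a (int q)" "psi a \<noteq> 1"
  shows "(\<Sum>b<q. psi (int (Suc b))) = 0"
proof -
  have q: "q > 0" and mult: "\<And>a b. psi (a * b) = psi a * psi b" using psi by (auto simp: dirichlet_character_def)
  have per: "\<And>a. psi (a + int q) = psi a" using psi by (auto simp: dirichlet_character_def)
  have eq1: "(\<Sum>b<q. psi (int (Suc b))) = (\<Sum>b\<in>{0..<int q}. psi b)"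
  proof -
    have "(\<Sum>b<q. psi (int (Suc b))) = (\<Sum>b<Suc q. psi (int b)) - psi 0"
      by (subst sum.lessThan_Suc_shift) simp
    also have "\<dots> = (\<Sum>b<q. psi (int b))" using per[of 0] by simp
    also have "\<dots> = (\<Sum>b\<in>{0..<int q}. psi b)"
      by (rule sum.reindex_bij_witness[of _ nat int]) auto
    finally show ?thesis .
  qed
  moreover have "(\<Sum>b\<in>{0..<int q}. psi b) = (\<Sum>b\<in>{0..<int q}. psi ((a * b) mod int q))"
  proof (rule sum.reindex_bij_betw[symmetric])
    have inj: "inj_on (\<lambda>b. (a * b) mod int q) {0..<int q}"
    proof (rule inj_onI)
      fix x y assume xy: "x \<in> {0..<int q}" "y \<in> {0..<int q}" "(a * x) mod int q = (a * y) mod int q"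
      hence "[a * x = a * y] (mod int q)" by (simp add: cong_def)
      hence "[x = y] (mod int q)" using a(1) cong_mult_lcancel by blast
      thus "x = y" using xy by (simp add: cong_def)
    qed
    moreover have "(\<lambda>b. (a * b) mod int q) ` {0..<int q} \<subseteq> {0..<int q}" using q by auto
    ultimately show "bij_betw (\<lambda>b. (a * b) mod int q) {0..<int q} {0..<int q}"
      unfolding bij_betw_def by (metis endo_inj_surj finite_atLeastLessThan_int)
  qed
  moreover have "psi ((a * b) mod int q) = psi a * psi b" for b
    using dirichlet_character_cong[OF psi, of "(a * b) mod int q" "a * b"] mult by (simp add: cong_def)
  ultimately have "(\<Sum>b<q. psi (int (Suc b))) = (\<Sum>b\<in>{0..<int q}. psi a * psi b)" by simp
  also have "\<dots> = psi a * (\<Sum>b\<in>{0..<int q}. psi b)" by (simp add: sum_distrib_left)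
  finally have "(\<Sum>b<q. psi (int (Suc b))) = psi a * (\<Sum>b<q. psi (int (Suc b)))" using eq1 by simp
  hence "(1 - psi a) * (\<Sum>b<q. psi (int (Suc b))) = 0" by (simp add: left_diff_distrib)
  thus ?thesis using a(2) by simp
qed

text \<open>The bridge from complex analysis to elementary estimates: the last conclusion is the
  vanishing of the L-function at \<sigma>, with every trace of continuation removed.\<close>

lemma exceptional_character:
  assumes chi: "dirichlet_character m chi" and re: "real_character chi"
    and q: "conductor m chi = q" and \<sigma>: "0 < \<sigma>" "\<sigma> < 1"
    and zero: "Dirichlet_L chi (complex_of_real \<sigma>) = 0"
  obtains X :: "int \<Rightarrow> real" where "q \<ge> 2"
    "\<And>a b. X (a * b) = X a * X b" "\<And>a. X (a + int q) = X a"
    "\<And>a. X a \<in> {-1, 0, 1}" "\<And>a. X a \<noteq> 0 \<longleftrightarrow> coprime a (int q)"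
    "(\<Sum>b<q. X (int (Suc b))) = 0"
    "(\<lambda>j. \<Sum>n\<in>{j*q..<j*q+q}. X (int (Suc n)) / real (Suc n) powr \<sigma>) sums 0"
proof -
  obtain psi where psi: "dirichlet_character q psi"
    "\<And>a. coprime a (int m) \<Longrightarrow> psi a = chi a" "\<And>a. psi a \<in> insert 0 (range chi)"
    using inducing_character[OF chi] q by blast
  have m: "m > 0" using chi by (simp add: dirichlet_character_def)
  have psi': "q > 0" "\<And>a b. psi (a * b) = psi a * psi b" "\<And>a. psi (a + int q) = psi a" "\<And>a. psi a \<noteq> 0 \<longleftrightarrow> coprime a (int q)"
    using psi by (auto simp: dirichlet_character_def)
  have vals: "psi a \<in> {-1, 0, 1}" for a
    using psi(3)[of a] real_character_values[OF chi re] by (metis image_iff insertE insertI1 insertI2)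
  define P where "P = {p \<in> prime_factors m. \<not> p dvd q}"
  have zero': "Dirichlet_L psi (of_real \<sigma>) = 0"
  proof (rule Dirichlet_L_zero_remove_primes[of P q])
    \<comment> \<open>\<open>chi\<close> differs from \<open>psi\<close> only by being 0 at the
      multiples of primes that divide \<open>m\<close> but not \<open>q\<close>.\<close>
    have "chi = (\<lambda>a. if \<exists>p\<in>P. int p dvd a then 0 else psi a)"
    proof
      fix a
      show "chi a = (if \<exists>p\<in>P. int p dvd a then 0 else psi a)"
      proof (cases "coprime a (int m)")
        case True
        have "\<not> int p dvd a" if "p \<in> P" for p
        proof
          assume "int p dvd a"
          moreover have "int p dvd int m" using that by (auto simp: P_def prime_factors_dvd)
          ultimately have "int p dvd 1" using True coprime_common_divisor by blast
          thus False using that by (auto simp: P_def prime_factors_dvd)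
        qed
        thus ?thesis using psi(2)[OF True] by auto
      next
        case False
        then obtain d where d: "d dvd a" "d dvd int m" "\<not> is_unit d"
          by (auto simp: coprime_def)
        have "d \<noteq> 0" using d(2) m by auto
        then obtain p' where "prime p'" "p' dvd d" using d(3) prime_divisor_exists by blast
        moreover from this have "p' = int (nat p')" using prime_ge_0_int by simp
        ultimately obtain p where p: "prime p" "int p dvd d" by (metis prime_int_nat_transfer prime_nat_int_transfer)
        have dv: "int p dvd a" "p dvd m"
          using p d dvd_trans by (blast, metis dvd_trans int_dvd_int_iff)
        have "chi a = 0" using False chi by (auto simp: dirichlet_character_def)
        moreover have "(\<exists>p\<in>P. int p dvd a) \<or> psi a = 0"
        proof (cases "p dvd q")
          case True
          hence "int p dvd int q" by simp
          hence "\<not> coprime a (int q)"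
            using p dv coprime_common_divisor[of a "int q" "int p"] by auto
          thus ?thesis using psi' by auto
        next
          case False
          thus ?thesis using p dv m by (auto simp: P_def prime_factors_dvd)
        qed
        ultimately show ?thesis by auto
      qed
    qed
    thus "Dirichlet_L (\<lambda>a. if \<exists>p\<in>P. int p dvd a then 0 else psi a) (complex_of_real \<sigma>) = 0"
      using zero by simp
    show "norm (psi a) \<le> 1" for a using vals[of a] by auto
    show "p \<ge> 2" if "p \<in> P" for p using that by (intro prime_ge_2_nat) (auto simp: P_def)
  qed (use psi' \<sigma> in \<open>auto simp: P_def\<close>)
  \<comment> \<open>For q = 1 the inducing character is constantly 1, and the zero would be one of
    zeta in (0, 1).\<close>
  have q2: "q \<ge> 2"
  proof (rule ccontr)
    assume "\<not> q \<ge> 2"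
    hence q1: "q = 1" using psi'(1) by simp
    hence "psi a = psi 1" for a using dirichlet_character_cong[OF psi(1)] by simp
    hence "psi = (\<lambda>_. 1)" using dirichlet_character_one[OF psi(1)] by auto
    thus False using zero' Dirichlet_L_one_nonzero[of \<sigma>] \<sigma> by simp
  qed
  \<comment> \<open>Otherwise \<open>chi\<close> would be principal, and minimality of the conductor
    would force q \<le> 1.\<close>
  obtain a where a: "coprime a (int q)" "psi a \<noteq> 1"
  proof (rule ccontr)
    assume "\<not> thesis"
    hence all: "\<And>a. coprime a (int q) \<Longrightarrow> psi a = 1" using that by blast
    have "q dvd m" using conductor_props(2)[OF chi] q by simp
    have "chi a = 1" if "coprime a (int m)" for a
    proof -
      have "coprime a (int q)" using that \<open>q dvd m\<close> by (meson coprime_divisors dvd_refl int_dvd_int_iff)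
      thus ?thesis using all psi(2)[OF that] by simp
    qed
    hence "q \<le> 1" using conductor_props(4)[OF chi, of 1] q by simp
    thus False using q2 by simp
  qed
  have psum: "(\<Sum>b<q. psi (int (Suc b))) = 0" using sum_nonprincipal_character[OF psi(1) a] .
  define X where "X = (\<lambda>a. Re (psi a))"
  have X: "psi a = of_real (X a)" for a using vals[of a] by (auto simp: X_def complex_eq_iff)
  show ?thesis
  proof (rule that[of X])
    show "X (a * b) = X a * X b" for a b using psi'(2)[of a b] unfolding X by (metis of_real_eq_iff of_real_mult)
    show "X (a + int q) = X a" for a using psi'(3)[of a] by (simp add: X_def)
    show "X a \<in> {-1, 0, 1}" for a using vals[of a] by (auto simp: X_def)
    show "X a \<noteq> 0 \<longleftrightarrow> coprime a (int q)" for a using psi'(4)[of a] unfolding X by simp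
    show "(\<Sum>b<q. X (int (Suc b))) = 0"
    proof -
      have "complex_of_real (\<Sum>b<q. X (int (Suc b))) = 0" using psum unfolding X by simp
      thus ?thesis by (simp only: of_real_eq_0_iff)
    qed
    have "(\<lambda>j. \<Sum>n\<in>{j*q..<j*q+q}. psi (int (Suc n)) / of_nat (Suc n) powr of_real \<sigma>) sums Dirichlet_L psi (of_real \<sigma>)"
      by (rule Dirichlet_L_eq_block_series) (use psi' psum \<sigma> in auto)
    also have "(\<lambda>j. \<Sum>n\<in>{j*q..<j*q+q}. psi (int (Suc n)) / of_nat (Suc n) powr of_real \<sigma>) =
       (\<lambda>j. of_real (\<Sum>n\<in>{j*q..<j*q+q}. X (int (Suc n)) / real (Suc n) powr \<sigma>))"
    proof -
      have "complex_of_nat k powr of_real \<sigma> = of_real (real k powr \<sigma>)" for k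
        using powr_of_real[of "real k" \<sigma>] by simp
      thus ?thesis by (simp add: X del: of_nat_Suc)
    qed
    also have "Dirichlet_L psi (of_real \<sigma>) = of_real 0" using zero' by simp
    finally show "(\<lambda>j. \<Sum>n\<in>{j*q..<j*q+q}. X (int (Suc n)) / real (Suc n) powr \<sigma>) sums 0"
      unfolding sums_of_real_iff .
  qed (use q2 in auto)
qed

section \<open>Real characters and the convolution of one with the character\<close>

lemma sum_divisors_swap:
  fixes g :: "nat \<Rightarrow> nat \<Rightarrow> 'a :: comm_monoid_add"
  shows "(\<Sum>n=1..N. \<Sum>d | d dvd n. g d n) = (\<Sum>d=1..N. \<Sum>m=1..N div d. g d (d * m))"
proof -
  have "(\<Sum>n=1..N. \<Sum>d | d dvd n. g d n) = (\<Sum>(n,d)\<in>(SIGMA n:{1..N}. {d. d dvd n}). g d n)"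
    by (subst sum.Sigma) auto
  also have "\<dots> = (\<Sum>(d,m)\<in>(SIGMA d:{1..N}. {1..N div d}). g d (d * m))"
  proof (rule sum.reindex_bij_witness[of _ "\<lambda>(d,m). (d * m, d)" "\<lambda>(n,d). (d, n div d)"])
    fix a assume a: "a \<in> (SIGMA n:{1..N}. {d. d dvd n})"
    obtain n d where nd: "a = (n,d)" "1 \<le> n" "n \<le> N" "d dvd n" using a by auto
    then obtain m where m: "n = d * m" by (auto elim: dvdE)
    hence "d > 0" "m > 0" using nd by (auto intro: Nat.gr0I)
    moreover have "d \<le> N" using nd \<open>n = d * m\<close> \<open>m > 0\<close> by (meson dvd_imp_le le_trans less_le_trans zero_less_one)
    moreover have "m \<le> N div d" using nd m \<open>d > 0\<close> by (simp add: less_eq_div_iff_mult_less_eq mult.commute)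
    ultimately show "(case a of (n,d) \<Rightarrow> (d, n div d)) \<in> (SIGMA d:{1..N}. {1..N div d})"
      using nd m by auto
  next
    fix b assume b: "b \<in> (SIGMA d:{1..N}. {1..N div d})"
    obtain d m where dm: "b = (d,m)" "1 \<le> d" "d \<le> N" "1 \<le> m" "m \<le> N div d" using b by auto
    hence "d * m \<le> N" by (simp add: less_eq_div_iff_mult_less_eq mult.commute)
    thus "(case b of (d,m) \<Rightarrow> (d * m, d)) \<in> (SIGMA n:{1..N}. {d. d dvd n})"
      using dm by auto
  qed auto
  also have "\<dots> = (\<Sum>d=1..N. \<Sum>m=1..N div d. g d (d * m))"
    by (subst sum.Sigma) auto
  finally show ?thesis .
qed

lemma Abel_summation_bound:
  fixes c a :: "nat \<Rightarrow> real"
  assumes S: "\<And>k. \<bar>\<Sum>n\<in>{A<..k}. c n\<bar> \<le> K"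
    and dec: "\<And>n. n > A \<Longrightarrow> a (Suc n) \<le> a n" and nn: "\<And>n. n > A \<Longrightarrow> a n \<ge> 0"
  shows "\<bar>\<Sum>n\<in>{A<..B}. c n * a n\<bar> \<le> K * a (Suc A)"
proof (cases "A \<le> B")
  case True
  define S where "S = (\<lambda>k. \<Sum>n\<in>{A<..k}. c n)"
  have Ssuc: "S (Suc k) = S k + c (Suc k)" if "k \<ge> A" for k
  proof -
    have "{A<..Suc k} = insert (Suc k) {A<..k}" using that by auto
    thus ?thesis by (simp add: S_def)
  qed
  have K: "K \<ge> 0" using S[of A] by simp
  have "(\<Sum>n\<in>{A<..B}. c n * a n) = (\<Sum>n\<in>{A<..B}. S n * (a n - a (Suc n))) + S B * a (Suc B)"
    using True
  proof (induction B rule: dec_induct)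
    case base
    thus ?case by (simp add: S_def)
  next
    case (step B)
    have "{A<..Suc B} = insert (Suc B) {A<..B}" using step by auto
    thus ?case using step Ssuc[of B] by (simp add: algebra_simps)
  qed
  also have "\<bar>\<dots>\<bar> \<le> (\<Sum>n\<in>{A<..B}. K * (a n - a (Suc n))) + K * a (Suc B)"
  proof -
    have "\<bar>\<Sum>n\<in>{A<..B}. S n * (a n - a (Suc n))\<bar> \<le> (\<Sum>n\<in>{A<..B}. K * (a n - a (Suc n)))"
      using dec S K unfolding S_def
      by (intro order.trans[OF sum_abs] sum_mono) (auto simp: abs_mult intro!: mult_mono)
    moreover have "\<bar>S B * a (Suc B)\<bar> \<le> K * a (Suc B)"
      using S nn[of "Suc B"] True K unfolding S_def by (auto simp: abs_mult intro!: mult_right_mono)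
    ultimately show ?thesis by linarith
  qed
  also have "(\<Sum>n\<in>{A<..B}. K * (a n - a (Suc n))) = K * (a (Suc A) - a (Suc B))"
    using True
  proof (induction B rule: dec_induct)
    case (step B)
    have "{A<..Suc B} = insert (Suc B) {A<..B}" using step by auto
    thus ?case using step by (simp add: algebra_simps)
  qed simp
  finally show ?thesis by (simp add: algebra_simps)
next
  case False
  thus ?thesis using S[of A] nn[of "Suc A"] by simp
qed

text \<open>\<open>zero\<close> is nonprincipality in the form that the estimates use: together with
  periodicity it bounds all partial sums by \<open>q\<close>.\<close>

locale real_nonprincipal_character =
  fixes q :: nat and X :: "nat \<Rightarrow> real"
  assumes q: "q \<ge> 2" and mult: "\<And>a b. X (a * b) = X a * X b"
    and per: "\<And>a. X (a + q) = X a" and vals: "\<And>a. X a \<in> {-1, 0, 1}"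
    and nz: "\<And>a. X a \<noteq> 0 \<longleftrightarrow> coprime a q" and zero: "(\<Sum>b<q. X (Suc b)) = 0"
begin

lemma abs_le: "\<bar>X a\<bar> \<le> 1"
  using vals[of a] by auto

lemma X_0 [simp]: "X 0 = 0" using nz[of 0] q by auto

lemma X_1 [simp]: "X (Suc 0) = 1"
  using nz[of 1] mult[of 1 1] by simp

lemma X_power: "X (a ^ k) = X a ^ k"
  by (induction k) (auto simp: mult)

lemma period_sum: "(\<Sum>n\<in>{A<..A+q}. X n) = 0"
proof (induction A)
  case 0
  have "{0<..0+q} = Suc ` {..<q}" by (auto simp: image_iff intro: gr0_implies_Suc Suc_le_D) (metis Suc_le_D lessThan_iff Suc_le_lessD less_Suc_eq_le gr0_implies_Suc)
  thus ?case using zero by (simp add: sum.reindex)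
next
  case (Suc A)
  have "{A<..A+q} = insert (Suc A) {Suc A<..A+q}" using q by auto
  moreover have "{Suc A<..Suc A+q} = insert (Suc A + q) {Suc A<..A+q}" using q by auto
  ultimately show ?case using Suc per[of "Suc A"] by simp
qed

lemma partial_sum_bound: "\<bar>\<Sum>n\<in>{A<..B}. X n\<bar> \<le> real q"
proof (induction "B - A" arbitrary: A rule: less_induct)
  case less
  show ?case
  proof (cases "B - A \<ge> q")
    case True
    have "{A<..B} = {A<..A+q} \<union> {A+q<..B}" "{A<..A+q} \<inter> {A+q<..B} = {}" using True q by auto
    hence "(\<Sum>n\<in>{A<..B}. X n) = (\<Sum>n\<in>{A+q<..B}. X n)"
      using period_sum[of A] by (simp add: sum.union_disjoint)
    thus ?thesis using less[of "A + q"] True q by simp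
  next
    case False
    have "\<bar>\<Sum>n\<in>{A<..B}. X n\<bar> \<le> (\<Sum>n\<in>{A<..B}. 1)"
      using abs_le by (intro order.trans[OF sum_abs] sum_mono) 
    thus ?thesis using False by simp
  qed
qed

lemma twisted_sum_bound:
  assumes "\<And>n. n > A \<Longrightarrow> a (Suc n) \<le> a n" "\<And>n. n > A \<Longrightarrow> a n \<ge> (0::real)"
  shows "\<bar>\<Sum>n\<in>{A<..B}. X n * a n\<bar> \<le> real q * a (Suc A)"
  by (rule Abel_summation_bound) (use assms partial_sum_bound in auto)

text \<open>This is L(1, X) as a conditionally convergent real series; its term at n = 0 is
  0.\<close>

definition L1 :: real where "L1 = (\<Sum>n. X n / real n)"

lemma L1_summable: "summable (\<lambda>n. X n / real n)"
  unfolding summable_Cauchy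
proof (intro allI impI)
  fix e :: real assume e: "e > 0"
  define N where "N = Suc (nat \<lceil>real q / e\<rceil>)"
  show "\<exists>N. \<forall>m\<ge>N. \<forall>n. norm (\<Sum>k=m..<n. X k / real k) < e"
  proof (intro exI[of _ "Suc N"] allI impI)
    fix m n assume m: "m \<ge> Suc N"
    then obtain A where A: "m = Suc A" "A \<ge> N" by (cases m) auto
    show "norm (\<Sum>k=m..<n. X k / real k) < e"
    proof (cases n)
      case (Suc B)
      have "{m..<n} = {A<..B}" using A Suc by auto
      hence "norm (\<Sum>k=m..<n. X k / real k) = \<bar>\<Sum>k\<in>{A<..B}. X k * (1 / real k)\<bar>" by simp
      also have "\<dots> \<le> real q * (1 / real (Suc A))"
        by (rule twisted_sum_bound) (auto simp: frac_le)
      also have "\<dots> < e"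
      proof -
        have "real q / e < real (Suc A)" using A unfolding N_def by linarith
        thus ?thesis using e by (simp add: field_simps)
      qed
      finally show ?thesis .
    qed (use e in simp)
  qed
qed

lemma L1_partial: "\<bar>L1 - (\<Sum>n=1..D. X n / real n)\<bar> \<le> real q / real (Suc D)"
proof -
  have "(\<lambda>N. \<Sum>n<N. X n / real n) \<longlonglongrightarrow> L1"
    unfolding L1_def using L1_summable by (rule summable_LIMSEQ)
  hence "(\<lambda>N. \<Sum>n<Suc (N + D). X n / real n) \<longlonglongrightarrow> L1"
    using LIMSEQ_ignore_initial_segment[of _ L1 "Suc D"] by fastforce
  hence "(\<lambda>N. \<bar>(\<Sum>n<Suc (N + D). X n / real n) - (\<Sum>n=1..D. X n / real n)\<bar>) \<longlonglongrightarrow> \<bar>L1 - (\<Sum>n=1..D. X n / real n)\<bar>"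
    by (intro tendsto_intros)
  moreover have "\<bar>(\<Sum>n<Suc (N + D). X n / real n) - (\<Sum>n=1..D. X n / real n)\<bar> \<le> real q / real (Suc D)" for N
  proof -
    have "{..<Suc (N + D)} = insert 0 ({1..D} \<union> {D<..N+D})" by auto
    moreover have "{1..D} \<inter> {D<..N+D} = {}" by auto
    ultimately have "(\<Sum>n<Suc (N + D). X n / real n) - (\<Sum>n=1..D. X n / real n) = (\<Sum>n\<in>{D<..N+D}. X n * (1 / real n))"
      by (simp add: sum.union_disjoint)
    also have "\<bar>\<dots>\<bar> \<le> real q * (1 / real (Suc D))"
      by (rule twisted_sum_bound) (auto simp: frac_le)
    finally show ?thesis by simp
  qed
  ultimately show ?thesis by (intro LIMSEQ_le_const2) auto
qed

lemma L1_limit: "(\<lambda>N. \<Sum>n=1..N. X n / real n) \<longlonglongrightarrow> L1"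
proof (rule LIM_zero_cancel, rule Lim_null_comparison)
  show "\<forall>\<^sub>F N in sequentially. norm ((\<Sum>n=1..N. X n / real n) - L1) \<le> real q / real (Suc N)"
    using L1_partial by (auto simp: abs_minus_commute)
  show "(\<lambda>N. real q / real (Suc N)) \<longlonglongrightarrow> 0"
    using tendsto_mult_right_zero[OF LIMSEQ_inverse_real_of_nat, of "real q"] by (simp add: divide_inverse)
qed

definition r :: "nat \<Rightarrow> real" where "r n = (\<Sum>d | d dvd n. X d)"

lemma r_1 [simp]: "r (Suc 0) = 1"
  by (simp add: r_def)

text \<open>A divisor of p^(k+1) m either divides p^k m or is p^(k+1) times a divisor of m.
  Iterated, this yields the local factor of \<open>r\<close> at \<open>p\<close>.\<close>

lemma r_prime_power_Suc:
  assumes p: "prime p" and pm: "\<not> p dvd m" 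
  shows "r (p ^ Suc k * m) = r (p ^ k * m) + X p ^ Suc k * r m"
proof -
  have p0: "p > 0" and m0: "m > 0" using p pm by (auto intro!: Nat.gr0I)
  have cop: "coprime (p ^ j) m" for j using p pm by (simp add: prime_imp_coprime)
  let ?A = "{d. d dvd p ^ k * m}" and ?B = "(\<lambda>d. p ^ Suc k * d) ` {d. d dvd m}"
  have "{d. d dvd p ^ Suc k * m} = ?A \<union> ?B"
  proof (intro equalityI subsetI)
    fix d assume "d \<in> {d. d dvd p ^ Suc k * m}"
    hence d: "d dvd p ^ Suc k * m" by simp
    have "d \<noteq> 0" using d p0 m0 by (auto intro: ccontr)
    then obtain e where e: "d = p ^ multiplicity p d * e" "\<not> p dvd e"
      using multiplicity_decompose'[of d p] p by (metis not_prime_unit)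
    define j where "j = multiplicity p d"
    have "e dvd p ^ Suc k * m" using e(1) d by (metis dvd_mult_right)
    moreover have "coprime e (p ^ Suc k)" using e(2) p by (metis coprime_commute coprime_power_right_iff prime_imp_coprime)
    ultimately have em: "e dvd m" by (simp only: coprime_dvd_mult_right_iff)
    have "p ^ j dvd p ^ Suc k * m" using e(1) d unfolding j_def by (metis dvd_mult_left)
    hence "p ^ j dvd p ^ Suc k" using cop[of j] by (simp only: coprime_dvd_mult_left_iff)
    hence jk: "j \<le> Suc k" using p by (metis power_dvd_imp_le prime_gt_1_nat)
    show "d \<in> ?A \<union> ?B"
    proof (cases "j = Suc k")
      case True
      thus ?thesis using e em unfolding j_def by auto
    next
      case False
      hence "p ^ j * e dvd p ^ k * m" using jk em by (intro mult_dvd_mono le_imp_power_dvd) auto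
      thus ?thesis using e unfolding j_def by simp
    qed
  next
    fix d assume "d \<in> ?A \<union> ?B"
    thus "d \<in> {d. d dvd p ^ Suc k * m}"
      by (auto intro: mult_dvd_mono) (metis dvd_mult mult.assoc)
  qed
  moreover have "?A \<inter> ?B = {}"
  proof (rule ccontr)
    assume "?A \<inter> ?B \<noteq> {}"
    then obtain d where "p ^ Suc k * d dvd p ^ k * m" by blast
    hence "p ^ k * p dvd p ^ k * m" by (metis dvd_mult_left power_Suc2)
    hence "p dvd m" using p0 by simp
    thus False using pm by simp
  qed
  moreover have "finite ?A" "finite ?B" using p0 m0 by (auto intro!: finite_divisors_nat)
  ultimately have "r (p ^ Suc k * m) = r (p ^ k * m) + (\<Sum>d\<in>?B. X d)"
    unfolding r_def by (simp add: sum.union_disjoint)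
  also have "(\<Sum>d\<in>?B. X d) = (\<Sum>d | d dvd m. X (p ^ Suc k * d))"
    using p0 by (subst sum.reindex) (auto simp: inj_on_def)
  also have "\<dots> = X p ^ Suc k * r m"
    unfolding r_def sum_distrib_left by (simp add: mult X_power)
  finally show ?thesis .
qed

lemma r_prime_power:
  assumes p: "prime p" and pm: "\<not> p dvd m" 
  shows "r (p ^ k * m) = (\<Sum>j\<le>k. X p ^ j) * r m"
proof (induction k)
  case (Suc k)
  thus ?case using r_prime_power_Suc[OF p pm, of k] by (simp add: algebra_simps)
qed simp

lemma r_prime_times:
  assumes "prime p" "\<not> p dvd m" "X p = 1"
  shows "r (p * m) = 2 * r m"
  using r_prime_power[OF assms(1,2), of 1] assms(3) by simp

lemma geometric_signs:
  assumes "x \<in> {-1, 0, 1 :: real}"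
  shows "(\<Sum>j\<le>k. x ^ j) \<ge> 0" "even k \<Longrightarrow> (\<Sum>j\<le>k. x ^ j) \<ge> 1"
proof -
  have "(\<Sum>j\<le>k. (-1::real) ^ j) = (if even k then 1 else 0)" by (induction k) auto
  moreover have "(\<Sum>j\<le>k. (0::real) ^ j) = 1" by (induction k) auto
  moreover have "(\<Sum>j\<le>k. (1::real) ^ j) = real k + 1" by simp
  ultimately show "(\<Sum>j\<le>k. x ^ j) \<ge> 0" "even k \<Longrightarrow> (\<Sum>j\<le>k. x ^ j) \<ge> 1"
    using assms by auto
qed

lemma prime_power_split:
  fixes n :: nat
  assumes "n > 1"
  obtains p k m where "prime p" "k > 0" "\<not> p dvd m" "n = p ^ k * m" "m < n" "m > 0"
proof -
  obtain p where p: "prime p" "p dvd n" using assms prime_factor_nat[of n] by auto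
  have "n \<noteq> 0" using assms by simp
  then obtain m where m: "n = p ^ multiplicity p n * m" "\<not> p dvd m"
    using multiplicity_decompose'[of n p] p by (metis not_prime_unit)
  have k: "multiplicity p n > 0" using p \<open>n \<noteq> 0\<close> by (simp add: prime_multiplicity_gt_zero_iff)
  have m0: "m > 0" using m by (auto intro: Nat.gr0I)
  have "1 < p ^ multiplicity p n" using p(1) k by (intro one_less_power prime_gt_1_nat)
  hence "1 * m < p ^ multiplicity p n * m" using m0 by (intro mult_strict_right_mono) auto
  thus ?thesis using that[of p "multiplicity p n" m] p m k m0 by auto
qed

lemma r_nonneg: "r n \<ge> 0"
proof (induction n rule: less_induct)
  case (less n)
  consider "n = 0" | "n = 1" | "n > 1" by linarith
  thus ?case
  proof cases
    case 1
    \<comment> \<open>Every number divides 0, and a sum over an infinite set is 0 by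
      default.\<close>
    have "infinite {d::nat. d dvd 0}" by simp
    thus ?thesis using 1 by (simp add: r_def)
  next
    case 2
    thus ?thesis by simp
  next
    case 3
    then obtain p k m where p: "prime p" "\<not> p dvd m" "n = p ^ k * m" "m < n" by (elim prime_power_split)
    thus ?thesis using less[of m] r_prime_power[OF p(1,2)] geometric_signs(1)[OF vals] by simp
  qed
qed

text \<open>Every prime occurs to an even exponent, so its local factor 1 + x + ... + x^(2k) with x
  in {-1, 0, 1} is at least 1. The squares supply the mass behind the lower bound for
  \<open>L1\<close>.\<close>

lemma r_square: "n > 0 \<Longrightarrow> r (n ^ 2) \<ge> 1"
proof (induction n rule: less_induct)
  case (less n)
  show ?case
  proof (cases "n = 1")
    case False
    hence "n > 1" using less by simp
    then obtain p k m where p: "prime p" "\<not> p dvd m" "n = p ^ k * m" "m < n" "m > 0" by (elim prime_power_split)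
    have "\<not> p dvd m ^ 2" using p prime_dvd_power by blast
    from r_prime_power[OF p(1) this, of "2 * k"]
    have "r (n ^ 2) = (\<Sum>j\<le>2*k. X p ^ j) * r (m ^ 2)"
      using p by (simp add: power_mult_distrib power_mult[symmetric] mult.commute)
    moreover have "(\<Sum>j\<le>2*k. X p ^ j) \<ge> 1" by (rule geometric_signs(2)[OF vals]) simp
    moreover have "r (m ^ 2) \<ge> 1" using less p by blast
    ultimately show ?thesis using mult_mono[of 1 "(\<Sum>j\<le>2*k. X p ^ j)" 1 "r (m ^ 2)"] by simp
  qed simp
qed

lemma r_le: "n > 0 \<Longrightarrow> r n \<le> real n"
proof -
  assume n: "n > 0"
  have "r n \<le> (\<Sum>d | d dvd n. 1)" unfolding r_def using abs_le by (intro sum_mono) (simp add: abs_le_iff)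
  also have "\<dots> = real (card {d. d dvd n})" by simp
  also have "card {d. d dvd n} \<le> card {1..n}" using n by (intro card_mono) (auto intro: dvd_imp_le Nat.gr0I)
  finally show ?thesis by simp
qed

end

section \<open>Lambert series and the summatory function of r\<close>

text \<open>AM-GM on the pairs \<open>z\<^sup>i, z\<^sup>n\<^sup>-\<^sup>1\<^sup>-\<^sup>i\<close>, with \<open>z = w\<^sup>2\<close>.\<close>
lemma geometric_sum_lower:
  fixes w :: real
  assumes w: "w \<ge> 0"
  shows "real n * w ^ (n - 1) \<le> (\<Sum>i<n. (w\<^sup>2) ^ i)"
proof -
  have "(\<Sum>i<n. (w\<^sup>2) ^ i) = (\<Sum>i<n. (w\<^sup>2) ^ (n - Suc i))"
    by (rule sum.nat_diff_reindex[symmetric])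
  hence "2 * (\<Sum>i<n. (w\<^sup>2) ^ i) = (\<Sum>i<n. (w\<^sup>2) ^ i + (w\<^sup>2) ^ (n - Suc i))"
    by (simp add: sum.distrib)
  also have "\<dots> \<ge> (\<Sum>i<n. 2 * w ^ (n - 1))"
  proof (rule sum_mono)
    fix i assume "i \<in> {..<n}"
    hence "w ^ (n - 1) = w ^ i * w ^ (n - Suc i)" by (simp flip: power_add)
    moreover have "2 * (w ^ i * w ^ (n - Suc i)) \<le> (w ^ i)\<^sup>2 + (w ^ (n - Suc i))\<^sup>2"
      using sum_squares_bound[of "w ^ i" "w ^ (n - Suc i)"] by simp
    ultimately show "2 * w ^ (n - 1) \<le> (w\<^sup>2) ^ i + (w\<^sup>2) ^ (n - Suc i)"
      by (simp add: power_mult[symmetric] mult.commute)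
  qed
  finally show ?thesis by simp
qed

text \<open>In the Lambert series of \<open>X\<close> the weight of \<open>X n\<close> is z^n/(1 -
  z^n), close to 1/(n (1 - z)) for z near 1. Their difference is isolated because it is nonnegative
  and decreasing in \<open>n\<close>, so that partial summation bounds its sum twisted by
  \<open>X\<close>.\<close>

definition lambert_defect :: "real \<Rightarrow> nat \<Rightarrow> real" where
  "lambert_defect z n = 1 / (real n * (1 - z)) - z ^ n / (1 - z ^ n)"

lemma lambert_defect_eq:
  assumes z: "0 < z" "z < 1" and n: "n > 0"
  shows "lambert_defect z n * (1 - z) = 1 / real n - z ^ n / (\<Sum>i<n. z ^ i)"
proof -
  have "z ^ n / (1 - z ^ n) * (1 - z) = z ^ n / (\<Sum>i<n. z ^ i)"
  proof -
    have "1 - z ^ n = (1 - z) * (\<Sum>i<n. z ^ i)" by (rule one_diff_power_eq)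
    thus ?thesis using z by simp
  qed
  moreover have "1 / (real n * (1 - z)) * (1 - z) = 1 / real n" using z n by simp
  ultimately show ?thesis unfolding lambert_defect_def by (simp only: left_diff_distrib)
qed

text \<open>With \<open>A n\<close> the geometric sum, the decrease amounts to n (n + 1) z^n \<le> A
  n * A (n + 1). The AM-GM bound for each of the two sums, with \<open>w\<close> the square root of
  \<open>z\<close>, supplies powers of \<open>w\<close> whose product is z^n.\<close>

lemma lambert_defect_antimono:
  assumes z: "0 < z" "z < 1" and n: "n > 0"
  shows "lambert_defect z (Suc n) \<le> lambert_defect z n"
proof -
  define w where "w = sqrt z"
  have w: "w > 0" "w \<le> 1" "z = w\<^sup>2" using z by (auto simp: w_def)
  define A where "A = (\<lambda>n. \<Sum>i<n. z ^ i)"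
  have A: "real n * w ^ (n - 1) \<le> A n" for n unfolding A_def w(3) using w(1) by (intro geometric_sum_lower) auto
  have Apos: "A n > 0" if "n > 0" for n using A[of n] w that by (smt (verit) mult_pos_pos of_nat_0_less_iff zero_less_power)
  have "real n * w ^ n * (real (Suc n) * w ^ n) \<le> A n * A (Suc n)"
  proof (intro mult_mono)
    have "real n * w ^ n \<le> real n * w ^ (n - 1)" using w by (intro mult_left_mono power_decreasing) auto
    thus "real n * w ^ n \<le> A n" using A[of n] by linarith
    show "real (Suc n) * w ^ n \<le> A (Suc n)" using A[of "Suc n"] by simp
  qed (use Apos[OF n] w in auto)
  moreover have "w ^ n * w ^ n = z ^ n" unfolding w(3) by (simp add: power_mult[symmetric] power_add[symmetric] mult_2)
  ultimately have AA: "real n * real (Suc n) * z ^ n \<le> A n * A (Suc n)" by (metis mult.assoc mult.left_commute)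
  have A_Suc: "A (Suc n) = 1 + z * A n"
    unfolding A_def by (subst sum.lessThan_Suc_shift) (simp add: sum_distrib_left)
  have "z ^ n / A n - z ^ Suc n / A (Suc n) = z ^ n / (A n * A (Suc n))"
    using Apos[of n] Apos[of "Suc n"] n A_Suc by (simp add: field_simps)
  also have "\<dots> \<le> 1 / (real n * real (Suc n))"
    using AA Apos[of n] Apos[of "Suc n"] n by (simp add: divide_le_eq le_divide_eq mult_ac pos_divide_le_eq field_simps del: of_nat_Suc)
  also have "1 / (real n * real (Suc n)) = 1 / real n - 1 / real (Suc n)" using n by (simp add: field_simps)
  finally have "lambert_defect z (Suc n) * (1 - z) \<le> lambert_defect z n * (1 - z)"
    using lambert_defect_eq[OF z n] lambert_defect_eq[OF z, of "Suc n"] by (simp add: A_def)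
  thus ?thesis using z by simp
qed

lemma lambert_defect_nonneg:
  assumes z: "0 < z" "z < 1" and n: "n > 0"
  shows "lambert_defect z n \<ge> 0"
proof -
  have "real n * z ^ n = (\<Sum>i<n. z ^ n)" by simp
  also have "\<dots> \<le> (\<Sum>i<n. z ^ i)" using z by (intro sum_mono power_decreasing) auto
  finally have *: "real n * z ^ n \<le> (\<Sum>i<n. z ^ i)" .
  have "0 < real n * z ^ n" using z n by simp
  hence "0 < (\<Sum>i<n. z ^ i)" using * by linarith
  hence "z ^ n / (\<Sum>i<n. z ^ i) \<le> 1 / real n" using * n by (simp add: field_simps)
  hence "lambert_defect z n * (1 - z) \<ge> 0" using lambert_defect_eq[OF z n] by simp
  thus ?thesis using z by (simp add: zero_le_mult_iff)
qed

context real_nonprincipal_character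
begin

text \<open>Exchanging the summations gives \<open>X d\<close> its Lambert weight. The approximation
  1/(d (1 - z)) produces L1/(1 - z); the defect contributes at most \<open>q\<close> times its value
  at 1, which is 1. Truncating at N leaves an error N z^N/(1 - z) that vanishes in the
  limit.\<close>

lemma r_sum_power_bound:
  fixes z :: real
  assumes z: "0 < z" "z < 1"
  shows "(\<Sum>n=1..N0. r n * z ^ n) \<le> L1 / (1 - z) + real q"
proof -
  have step: "(\<Sum>n=1..N. r n * z ^ n) \<le> (\<Sum>d=1..N. X d / real d) / (1 - z) + real q + real N * z ^ N / (1 - z)" for N
  proof -
    have "(\<Sum>n=1..N. r n * z ^ n) = (\<Sum>n=1..N. \<Sum>d | d dvd n. X d * z ^ n)"
      by (simp add: r_def sum_distrib_right)
    also have "\<dots> = (\<Sum>d=1..N. \<Sum>m=1..N div d. X d * z ^ (d * m))"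
      by (rule sum_divisors_swap)
    also have "\<dots> = (\<Sum>d=1..N. X d * (z ^ d / (1 - z ^ d)) - X d * (z ^ (d * Suc (N div d)) / (1 - z ^ d)))"
    proof (rule sum.cong[OF refl])
      fix d assume d: "d \<in> {1..N}"
      have zd: "z ^ d < 1" "z ^ d \<noteq> 1" using z d power_Suc_less_one[of z "d-1"] by auto
      have "(\<Sum>m=1..N div d. (z ^ d) ^ m) = (z ^ d - (z ^ d) ^ Suc (N div d)) / (1 - z ^ d)"
      proof (cases "N div d = 0")
        case False
        thus ?thesis using zd by (subst sum_gp) auto
      qed simp
      thus "(\<Sum>m=1..N div d. X d * z ^ (d * m)) = X d * (z ^ d / (1 - z ^ d)) - X d * (z ^ (d * Suc (N div d)) / (1 - z ^ d))"
        unfolding power_mult sum_distrib_left[symmetric] by (simp only: diff_divide_distrib right_diff_distrib)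
    qed
    also have "\<dots> = (\<Sum>d=1..N. X d / real d) / (1 - z) - (\<Sum>d\<in>{0<..N}. X d * lambert_defect z d)
        - (\<Sum>d=1..N. X d * (z ^ (d * Suc (N div d)) / (1 - z ^ d)))"
    proof -
      have e: "{0<..N} = {1..N}" by auto
      show ?thesis unfolding sum_subtractf e sum_divide_distrib
        by (simp add: lambert_defect_def right_diff_distrib sum_subtractf)
    qed
    also have "\<dots> \<le> (\<Sum>d=1..N. X d / real d) / (1 - z) + real q + real N * z ^ N / (1 - z)"
    proof -
      have "\<bar>\<Sum>d\<in>{0<..N}. X d * lambert_defect z d\<bar> \<le> real q * lambert_defect z (Suc 0)"
        using z by (intro twisted_sum_bound lambert_defect_antimono lambert_defect_nonneg) auto
      also have "lambert_defect z (Suc 0) = 1"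
        using z by (simp add: lambert_defect_def divide_simps)
      finally have 1: "\<bar>\<Sum>d\<in>{0<..N}. X d * lambert_defect z d\<bar> \<le> real q" by simp
      have "\<bar>\<Sum>d=1..N. X d * (z ^ (d * Suc (N div d)) / (1 - z ^ d))\<bar> \<le> (\<Sum>d=1..N. z ^ N / (1 - z))"
      proof (intro order.trans[OF sum_abs] sum_mono)
        fix d assume d: "d \<in> {1..N}"
        have zd: "z ^ d \<le> z" using z d power_decreasing[of 1 d z] by auto
        have "N \<le> d * Suc (N div d)" using d
          by (metis dividend_less_times_div Suc_le_D add.commute atLeastAtMost_iff less_imp_le mult_Suc_right not_one_le_zero zero_less_iff_neq_zero)
        define t where "t = z ^ (d * Suc (N div d)) / (1 - z ^ d)"
        have "t \<le> z ^ N / (1 - z)" unfolding t_def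
          using z zd \<open>N \<le> d * Suc (N div d)\<close> by (intro frac_le power_decreasing) auto
        moreover have "0 \<le> t" unfolding t_def using z zd by (intro divide_nonneg_nonneg) auto
        ultimately have "\<bar>X d\<bar> * \<bar>t\<bar> \<le> 1 * (z ^ N / (1 - z))"
          by (intro mult_mono abs_le) auto
        thus "\<bar>X d * (z ^ (d * Suc (N div d)) / (1 - z ^ d))\<bar> \<le> z ^ N / (1 - z)"
          unfolding t_def by (simp only: abs_mult mult_1_left)
      qed
      hence "\<bar>\<Sum>d=1..N. X d * (z ^ (d * Suc (N div d)) / (1 - z ^ d))\<bar> \<le> real N * z ^ N / (1 - z)" by simp
      with 1 show ?thesis by linarith
    qed
    finally show ?thesis .
  qed
  have "(\<lambda>N. (\<Sum>d=1..N. X d / real d) / (1 - z) + real q + real N * z ^ N / (1 - z)) \<longlonglongrightarrow> L1 / (1 - z) + real q + 0 / (1 - z)"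
    using z by (intro tendsto_intros L1_limit powser_times_n_limit_0) auto
  moreover have "\<forall>N\<ge>N0. (\<Sum>n=1..N0. r n * z ^ n) \<le> (\<Sum>d=1..N. X d / real d) / (1 - z) + real q + real N * z ^ N / (1 - z)"
  proof (intro allI impI)
    fix N assume "N \<ge> N0"
    hence "(\<Sum>n=1..N0. r n * z ^ n) \<le> (\<Sum>n=1..N. r n * z ^ n)"
      using z r_nonneg by (intro sum_mono2) auto
    thus "(\<Sum>n=1..N0. r n * z ^ n) \<le> (\<Sum>d=1..N. X d / real d) / (1 - z) + real q + real N * z ^ N / (1 - z)"
      using step[of N] by linarith
  qed
  ultimately show ?thesis by (intro LIMSEQ_le_const[of _ "L1 / (1 - z) + real q" "\<Sum>n=1..N0. r n * z ^ n"]) auto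
qed

lemma r_sum_bound:
  assumes N: "N \<ge> 2"
  shows "(\<Sum>n=1..N. r n) \<le> 4 * (real N * L1 + real q)"
proof -
  \<comment> \<open>Now 1/(1 - z) = N, while the weights z^n with n \<le> N are at least z^N \<ge>
    1/4; hence the factor 4.\<close>
  define z where "z = 1 - 1 / real N"
  have z: "0 < z" "z < 1" using N by (auto simp: z_def)
  have z4: "z ^ N \<ge> 1 / 4"
  proof -
    \<comment> \<open>Bernoulli's inequality with the full exponent N would give only 0; used with
      about N/2 and then squared, it yields 1/4.\<close>
    have half: "y ^ k \<ge> 1 - real k * (1 - y)" if "0 \<le> y" "y \<le> 1" for y :: real and k
      using Bernoulli_inequality[of "y - 1" k] that by (simp add: algebra_simps)
    show ?thesis
    proof (cases "even N")
      case True
      then obtain k where k: "N = 2 * k" by blast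
      have "z ^ k \<ge> 1 - real k * (1 - z)" using z by (intro half) auto
      also have "1 - real k * (1 - z) = 1 / 2" using N k by (simp add: z_def)
      finally have "(z ^ k)\<^sup>2 \<ge> (1 / 2)\<^sup>2" by (intro power_mono) auto
      thus ?thesis by (simp add: k power_even_eq power2_eq_square)
    next
      case False
      then obtain k where k: "N = 2 * k + 1" using oddE by blast
      hence k1: "k \<ge> 1" using N by simp
      have "z ^ k \<ge> 1 - real k * (1 - z)" using z by (intro half) auto
      also have "1 - real k * (1 - z) = real (k + 1) / real N" using N k by (simp add: z_def field_simps)
      finally have "(z ^ k)\<^sup>2 \<ge> (real (k + 1) / real N)\<^sup>2" by (intro power_mono) auto
      hence "(real (k + 1) / real N)\<^sup>2 * z \<le> (z ^ k)\<^sup>2 * z"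
        using z by (intro mult_right_mono) auto
      moreover have "(z ^ k)\<^sup>2 * z = z ^ N" by (simp add: k power_even_eq)
      moreover have "z = real (2 * k) / real N" using N k by (simp add: z_def field_simps)
      ultimately have "z ^ N \<ge> (real (k + 1) / real N)\<^sup>2 * (real (2 * k) / real N)" by simp
      moreover have "(real (k + 1) / real N)\<^sup>2 * (real (2 * k) / real N) \<ge> 1 / 4"
      proof -
        have "(real N)^3 \<le> 4 * ((real (k + 1))\<^sup>2 * real (2 * k))"
        proof -
          obtain j where j: "k = Suc j" using k1 by (cases k) auto
          show ?thesis unfolding k j by (simp add: power2_eq_square power3_eq_cube algebra_simps)
        qed
        thus ?thesis using N by (simp add: power_divide field_simps power3_eq_cube power2_eq_square)
      qed
      ultimately show ?thesis by linarith
    qed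
  qed
  have "(\<Sum>n=1..N. r n) * (1 / 4) \<le> (\<Sum>n=1..N. r n * z ^ n)"
    unfolding sum_distrib_right
  proof (rule sum_mono)
    fix n assume "n \<in> {1..N}"
    hence "z ^ N \<le> z ^ n" using z by (intro power_decreasing) auto
    thus "r n * (1 / 4) \<le> r n * z ^ n" using z4 r_nonneg by (intro mult_left_mono) auto
  qed
  also have "\<dots> \<le> L1 / (1 - z) + real q" using z by (rule r_sum_power_bound)
  also have "L1 / (1 - z) = real N * L1" using N by (simp add: z_def)
  finally show ?thesis by simp
qed

text \<open>The squares up to K^2 alone contribute K to the sum of \<open>r\<close>. For K = 8 q
  this beats the error 4 q in \<open>r_sum_bound\<close>, and the excess must come from
  \<open>L1\<close>.\<close>

lemma L1_lower: "L1 \<ge> 1 / (64 * real q)"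
proof -
  define K where "K = 8 * q"
  have "real K = (\<Sum>n\<in>(\<lambda>k. k^2) ` {1..K}. 1)"
    by (subst sum.reindex) (auto simp: inj_on_def)
  also have "\<dots> \<le> (\<Sum>n\<in>(\<lambda>k. k^2) ` {1..K}. r n)"
    using r_square by (intro sum_mono) auto
  also have "\<dots> \<le> (\<Sum>n=1..K^2. r n)"
    using r_nonneg by (intro sum_mono2) (auto simp: power_mono)
  also have "\<dots> \<le> 4 * (real (K^2) * L1 + real q)"
    using q by (intro r_sum_bound) (auto simp: K_def power2_eq_square)
  finally have "4 * real q \<le> 4 * (64 * real q ^ 2 * L1)" by (simp add: K_def power_mult_distrib)
  hence "real q * 1 \<le> real q * (64 * real q * L1)" by (simp add: power2_eq_square)
  hence "1 \<le> 64 * real q * L1" using q by (subst (asm) mult_le_cancel_left_pos) auto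
  thus ?thesis using q by (simp add: field_simps)
qed

text \<open>From 64 q^2 on, the lower bound for \<open>L1\<close> gives N L1 \<ge> q, so the error
  term is absorbed.\<close>

lemma r_sum_bound':
  assumes N: "N \<ge> 64 * q\<^sup>2"
  shows "(\<Sum>n=1..N. r n) \<le> 8 * real N * L1"
proof -
  have "q\<^sup>2 \<ge> 4" using q power_mono[of 2 q 2] by simp
  hence N2: "N \<ge> 2" using N by linarith
  have "real q \<le> 64 * real q ^ 2 * L1" using L1_lower q by (simp add: field_simps power2_eq_square)
  also have "\<dots> \<le> real N * L1"
  proof (rule mult_right_mono)
    have "real (64 * q\<^sup>2) \<le> real N" using N by (simp only: of_nat_le_iff)
    thus "64 * real q ^ 2 \<le> real N" by simp
    have "0 \<le> 1 / (64 * real q)" by simp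
    thus "L1 \<ge> 0" using L1_lower by linarith
  qed
  finally show ?thesis using r_sum_bound[OF N2] by simp
qed

end

section \<open>The effect of a real zero\<close>

lemma powr_increment_bounds:
  fixes \<delta> t y :: real
  assumes \<delta>: "0 < \<delta>" "\<delta> < 1" and t: "0 < t" "t \<le> y"
  shows "(y powr \<delta> - t powr \<delta>) / \<delta> \<le> (y - t) * t powr (\<delta> - 1)"
    and "(y - t) * y powr (\<delta> - 1) \<le> (y powr \<delta> - t powr \<delta>) / \<delta>"
proof -
  have "(y powr \<delta> - t powr \<delta>) / \<delta> \<le> (y - t) * t powr (\<delta> - 1) \<and>
    (y - t) * y powr (\<delta> - 1) \<le> (y powr \<delta> - t powr \<delta>) / \<delta>"
  proof (cases "t = y")
    case False
    hence "t < y" using t by simp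
    have "\<exists>x. t < x \<and> x < y \<and> y powr \<delta> - t powr \<delta> = (y - t) * (\<delta> * x powr (\<delta> - 1))"
    proof (rule MVT2[OF \<open>t < y\<close>])
      fix x assume "t \<le> x" "x \<le> y"
      thus "((\<lambda>x. x powr \<delta>) has_real_derivative \<delta> * x powr (\<delta> - 1)) (at x)"
        using t by (auto intro!: derivative_eq_intros)
    qed
    then obtain x where x: "t < x" "x < y" "y powr \<delta> - t powr \<delta> = (y - t) * (\<delta> * x powr (\<delta> - 1))" by blast
    have "(y powr \<delta> - t powr \<delta>) / \<delta> = (y - t) * x powr (\<delta> - 1)" using x \<delta> by simp
    moreover have "x powr (\<delta> - 1) \<le> t powr (\<delta> - 1)" "y powr (\<delta> - 1) \<le> x powr (\<delta> - 1)"
      using x t \<delta> by (auto intro!: powr_mono2')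
    ultimately show ?thesis using \<open>t < y\<close> by (auto intro!: mult_left_mono)
  qed simp
  thus "(y powr \<delta> - t powr \<delta>) / \<delta> \<le> (y - t) * t powr (\<delta> - 1)"
    and "(y - t) * y powr (\<delta> - 1) \<le> (y powr \<delta> - t powr \<delta>) / \<delta>" by blast+
qed

text \<open>The constant \<open>z\<close> is \<open>\<zeta>(1 - \<delta>)\<close>; only its size matters.\<close>
lemma powr_sum_asymptotics:
  fixes \<delta> :: real
  assumes \<delta>: "0 < \<delta>" "\<delta> < 1"
  obtains z where "\<bar>z\<bar> \<le> 1 / \<delta>"
    "\<And>T. T \<ge> 1 \<Longrightarrow> \<bar>(\<Sum>m=1..T. real m powr (\<delta> - 1)) - real T powr \<delta> / \<delta> - z\<bar> \<le> real T powr (\<delta> - 1)"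
    "\<And>T. T \<ge> 1 \<Longrightarrow> (\<Sum>m=1..T. real m powr (\<delta> - 1)) \<le> real T powr \<delta> / \<delta>"
proof -
  define A where "A = (\<lambda>T. \<Sum>m=1..T. real m powr (\<delta> - 1))"
  \<comment> \<open>\<open>u\<close> decreases, \<open>v\<close> increases, and they differ by (n +
    1)^(\<delta> - 1); the limit \<open>z\<close> of \<open>u\<close> lies between them, which gives
    the error term.\<close>
  define u where "u = (\<lambda>n. A (Suc n) - real (Suc n) powr \<delta> / \<delta>)"
  define v where "v = (\<lambda>n. u n - real (Suc n) powr (\<delta> - 1))"
  have A_Suc: "A (Suc (Suc n)) = A (Suc n) + real (Suc (Suc n)) powr (\<delta> - 1)" for n
    by (simp add: A_def)
  have u_dec: "u (Suc n) \<le> u n" for n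
    using powr_increment_bounds(2)[OF \<delta>, of "real (Suc n)" "real (Suc (Suc n))"]
    unfolding u_def A_Suc by (simp add: diff_divide_distrib)
  have v_inc: "v n \<le> v (Suc n)" for n
    using powr_increment_bounds(1)[OF \<delta>, of "real (Suc n)" "real (Suc (Suc n))"]
    unfolding v_def u_def A_Suc by (simp add: diff_divide_distrib)
  have "decseq u" "incseq v" using u_dec v_inc by (auto intro: decseq_SucI incseq_SucI)
  have vu: "v n \<le> u n" for n by (simp add: v_def)
  have "v 0 \<le> u n" for n using vu[of n] \<open>incseq v\<close> by (meson incseqD le0 order_trans)
  then obtain z where z: "u \<longlonglongrightarrow> z" "\<And>n. z \<le> u n"
    using decseq_convergent[OF \<open>decseq u\<close>] by blast
  have vz: "v n \<le> z" for n
  proof (rule LIMSEQ_le_const[OF z(1)], intro exI[of _ n] allI impI)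
    fix k assume "n \<le> k"
    thus "v n \<le> u k" using vu[of k] \<open>incseq v\<close> by (meson incseqD order_trans)
  qed
  have u0: "u 0 = 1 - 1 / \<delta>" by (simp add: u_def A_def)
  have inv: "1 / \<delta> \<ge> 1" using \<delta> by simp
  show ?thesis
  proof (rule that[of z])
    show "\<bar>z\<bar> \<le> 1 / \<delta>" using vz[of 0] z(2)[of 0] u0 inv by (simp add: v_def)
    fix T :: nat assume "T \<ge> 1"
    then obtain n where n: "T = Suc n" by (cases T) auto
    show "\<bar>(\<Sum>m=1..T. real m powr (\<delta> - 1)) - real T powr \<delta> / \<delta> - z\<bar> \<le> real T powr (\<delta> - 1)"
      using vz[of n] z(2)[of n] unfolding v_def u_def A_def n by linarith
    have "u n \<le> u 0" using \<open>decseq u\<close> by (simp add: decseqD)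
    thus "(\<Sum>m=1..T. real m powr (\<delta> - 1)) \<le> real T powr \<delta> / \<delta>"
      using u0 inv unfolding u_def A_def n by linarith
  qed
qed

text \<open>The hyperbola is cut at the square D^2: d > D together with d m \<le> D^2 forces m \<le>
  D.\<close>

lemma sum_hyperbola_swap:
  fixes f :: "nat \<Rightarrow> nat \<Rightarrow> 'a :: comm_monoid_add"
  shows "(\<Sum>d\<in>{D<..D\<^sup>2}. \<Sum>m=1..D\<^sup>2 div d. f d m) = (\<Sum>m=1..D. \<Sum>d\<in>{D<..D\<^sup>2 div m}. f d m)"
proof -
  have "(\<Sum>d\<in>{D<..D\<^sup>2}. \<Sum>m=1..D\<^sup>2 div d. f d m) = (\<Sum>(d,m)\<in>(SIGMA d:{D<..D\<^sup>2}. {1..D\<^sup>2 div d}). f d m)"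
    by (subst sum.Sigma) auto
  also have "\<dots> = (\<Sum>(m,d)\<in>(SIGMA m:{1..D}. {D<..D\<^sup>2 div m}). f d m)"
  proof (rule sum.reindex_bij_witness[of _ "\<lambda>(m,d). (d,m)" "\<lambda>(d,m). (m,d)"])
    fix a assume "a \<in> (SIGMA d:{D<..D\<^sup>2}. {1..D\<^sup>2 div d})"
    then obtain d m where a: "a = (d,m)" "D < d" "d \<le> D\<^sup>2" "1 \<le> m" "m \<le> D\<^sup>2 div d" by auto
    hence dm: "d * m \<le> D\<^sup>2" by (simp add: less_eq_div_iff_mult_less_eq mult.commute)
    have "m \<le> D"
    proof (rule ccontr)
      assume "\<not> m \<le> D"
      hence "D * D < d * m" using a by (intro mult_strict_mono) auto
      thus False using dm by (simp add: power2_eq_square)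
    qed
    thus "(case a of (d,m) \<Rightarrow> (m,d)) \<in> (SIGMA m:{1..D}. {D<..D\<^sup>2 div m})"
      using a dm by (auto simp: less_eq_div_iff_mult_less_eq)
  next
    fix b assume "b \<in> (SIGMA m:{1..D}. {D<..D\<^sup>2 div m})"
    then obtain d m where b: "b = (m,d)" "D < d" "1 \<le> m" "m \<le> D" "d \<le> D\<^sup>2 div m" by auto
    hence dm: "d * m \<le> D\<^sup>2" by (simp add: less_eq_div_iff_mult_less_eq mult.commute)
    have "d * 1 \<le> d * m" using b by (intro mult_left_mono) auto
    hence "d \<le> D\<^sup>2" using dm by (metis mult_1_right order_trans)
    thus "(case b of (m,d) \<Rightarrow> (d,m)) \<in> (SIGMA d:{D<..D\<^sup>2}. {1..D\<^sup>2 div d})"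
      using b dm by (auto simp: less_eq_div_iff_mult_less_eq mult.commute)
  qed auto
  also have "\<dots> = (\<Sum>m=1..D. \<Sum>d\<in>{D<..D\<^sup>2 div m}. f d m)"
    by (subst sum.Sigma) auto
  finally show ?thesis .
qed

locale exceptional_zero = real_nonprincipal_character +
  fixes \<delta> :: real
  assumes \<delta>: "0 < \<delta>" "\<delta> < 1"
    and Lzero: "(\<lambda>j. \<Sum>n\<in>{j*q..<j*q+q}. X (Suc n) / real (Suc n) powr (1 - \<delta>)) sums 0"
begin

text \<open>The one place where the zero is used: the whole series sums to 0, so a partial sum is
  minus a tail, and partial summation bounds the tail.\<close>

lemma Lzero_partial: "\<bar>\<Sum>n=1..D. X n * real n powr (\<delta> - 1)\<bar> \<le> real q * real (Suc D) powr (\<delta> - 1)"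
proof -
  define P where "P = (\<lambda>N. \<Sum>n=1..N. X n * real n powr (\<delta> - 1))"
  have "(\<lambda>J. \<Sum>j<J. \<Sum>n\<in>{j*q..<j*q+q}. X (Suc n) / real (Suc n) powr (1 - \<delta>)) \<longlonglongrightarrow> 0"
    using Lzero by (simp add: sums_def)
  moreover have "(\<Sum>j<J. \<Sum>n\<in>{j*q..<j*q+q}. X (Suc n) / real (Suc n) powr (1 - \<delta>)) = P (J * q)" for J
  proof -
    have "(\<Sum>j<J. \<Sum>n\<in>{j*q..<j*q+q}. X (Suc n) / real (Suc n) powr (1 - \<delta>)) = (\<Sum>n<J*q. X (Suc n) / real (Suc n) powr (1 - \<delta>))"
      by (rule sum.nat_group)
    also have "\<dots> = (\<Sum>n<J*q. X (Suc n) * real (Suc n) powr (\<delta> - 1))"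
      by (intro sum.cong refl) (metis divide_inverse minus_diff_eq powr_minus)
    also have "\<dots> = P (J * q)"
      unfolding P_def by (rule sum.reindex_bij_witness[of _ "\<lambda>n. n - 1" Suc]) auto
    finally show ?thesis .
  qed
  ultimately have "(\<lambda>J. P (J * q)) \<longlonglongrightarrow> 0" by simp
  hence lim: "(\<lambda>J. \<bar>P (J * q) - P D\<bar>) \<longlonglongrightarrow> \<bar>0 - P D\<bar>" by (intro tendsto_intros)
  have "\<bar>0 - P D\<bar> \<le> real q * real (Suc D) powr (\<delta> - 1)"
  proof (rule LIMSEQ_le_const2[OF lim], intro exI[of _ D] allI impI)
    fix J assume "D \<le> J"
    hence "D * 1 \<le> J * q" using q by (intro mult_mono) auto
    hence "{1..J*q} = {1..D} \<union> {D<..J*q}" "{1..D} \<inter> {D<..J*q} = {}" by auto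
    hence "P (J * q) - P D = (\<Sum>n\<in>{D<..J*q}. X n * real n powr (\<delta> - 1))"
      unfolding P_def by (simp add: sum.union_disjoint)
    also have "\<bar>\<dots>\<bar> \<le> real q * real (Suc D) powr (\<delta> - 1)"
      using \<delta> by (intro twisted_sum_bound powr_mono2') auto
    finally show "\<bar>P (J * q) - P D\<bar> \<le> real q * real (Suc D) powr (\<delta> - 1)" .
  qed
  thus ?thesis by (simp add: P_def)
qed

text \<open>For d \<le> D the inner sum is (N/d)^\<delta>/\<delta> + z + error, with N = D^2. The
  first term yields the main term with \<open>L1\<close>; the constant z multiplies a partial sum of
  L(1 - \<delta>), small by \<open>Lzero_partial\<close>. For d > D the order of summation is
  exchanged, so that the inner sum is the one over d, which has cancellation.\<close>

lemma twisted_r_sum: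
  assumes D: "D \<ge> 1"
  shows "real (D\<^sup>2) powr \<delta> * L1 / \<delta> \<le> (\<Sum>n=1..D\<^sup>2. r n * real n powr (\<delta> - 1)) + real (D\<^sup>2) powr \<delta> * (7 * real q / (\<delta> * real D))"
proof -
  define N where "N = D\<^sup>2"
  define M where "M = real N powr \<delta>"
  obtain z where z: "\<bar>z\<bar> \<le> 1 / \<delta>"
    "\<And>T. T \<ge> 1 \<Longrightarrow> \<bar>(\<Sum>m=1..T. real m powr (\<delta> - 1)) - real T powr \<delta> / \<delta> - z\<bar> \<le> real T powr (\<delta> - 1)"
    "\<And>T. T \<ge> 1 \<Longrightarrow> (\<Sum>m=1..T. real m powr (\<delta> - 1)) \<le> real T powr \<delta> / \<delta>"
    using powr_sum_asymptotics[OF \<delta>] by blast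
  have N: "N \<ge> D" "N \<ge> 1" "real N = real D * real D" using D by (auto simp: N_def power2_eq_square)
  have M: "M = real D powr \<delta> * real D powr \<delta>" "M > 0" "real D powr \<delta> \<ge> 1" using D \<delta> N
    by (auto simp: M_def N(3) powr_mult ge_one_powr_ge_zero)
  have MD: "real D powr (\<delta> - 1) = real D powr \<delta> / real D" using D by (simp add: powr_diff)
  have DM: "real D powr \<delta> \<le> M" using M mult_left_mono[of 1 "real D powr \<delta>" "real D powr \<delta>"] by simp
  have "(\<Sum>n=1..N. r n * real n powr (\<delta> - 1)) = (\<Sum>n=1..N. \<Sum>d | d dvd n. X d * real n powr (\<delta> - 1))"
    by (simp add: r_def sum_distrib_right)
  also have "\<dots> = (\<Sum>d=1..N. \<Sum>m=1..N div d. X d * real (d * m) powr (\<delta> - 1))"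
    by (rule sum_divisors_swap)
  also have "\<dots> = (\<Sum>d=1..D. \<Sum>m=1..N div d. X d * real (d * m) powr (\<delta> - 1))
     + (\<Sum>d\<in>{D<..N}. \<Sum>m=1..N div d. X d * real (d * m) powr (\<delta> - 1))"
  proof -
    have "{1..N} = {1..D} \<union> {D<..N}" "{1..D} \<inter> {D<..N} = {}" using N by auto
    thus ?thesis by (simp add: sum.union_disjoint)
  qed
  also have "(\<Sum>d\<in>{D<..N}. \<Sum>m=1..N div d. X d * real (d * m) powr (\<delta> - 1)) =
     (\<Sum>m=1..D. \<Sum>d\<in>{D<..N div m}. X d * real (d * m) powr (\<delta> - 1))"
    unfolding N_def by (rule sum_hyperbola_swap)
  finally have split: "(\<Sum>n=1..N. r n * real n powr (\<delta> - 1)) = 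
     (\<Sum>d=1..D. \<Sum>m=1..N div d. X d * real (d * m) powr (\<delta> - 1))
     + (\<Sum>m=1..D. \<Sum>d\<in>{D<..N div m}. X d * real (d * m) powr (\<delta> - 1))" .
  have second: "\<bar>\<Sum>m=1..D. \<Sum>d\<in>{D<..N div m}. X d * real (d * m) powr (\<delta> - 1)\<bar> \<le> M * (real q / (\<delta> * real D))"
  proof -
    have "\<bar>\<Sum>m=1..D. \<Sum>d\<in>{D<..N div m}. X d * real (d * m) powr (\<delta> - 1)\<bar>
      \<le> (\<Sum>m=1..D. real q * real D powr (\<delta> - 1) * real m powr (\<delta> - 1))"
    proof (rule order.trans[OF sum_abs sum_mono])
      fix m assume m: "m \<in> {1..D}"
      have "\<bar>\<Sum>d\<in>{D<..N div m}. X d * real (d * m) powr (\<delta> - 1)\<bar> \<le> real q * real (Suc D * m) powr (\<delta> - 1)"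
        using m \<delta> by (intro twisted_sum_bound powr_mono2') (auto simp del: of_nat_mult of_nat_Suc)
      also have "\<dots> \<le> real q * real (D * m) powr (\<delta> - 1)"
        using m \<delta> D by (intro mult_left_mono powr_mono2') (auto simp del: of_nat_mult of_nat_Suc)
      also have "\<dots> = real q * real D powr (\<delta> - 1) * real m powr (\<delta> - 1)"
        by (simp add: powr_mult)
      finally show "\<bar>\<Sum>d\<in>{D<..N div m}. X d * real (d * m) powr (\<delta> - 1)\<bar> \<le> real q * real D powr (\<delta> - 1) * real m powr (\<delta> - 1)" .
    qed
    also have "\<dots> = real q * real D powr (\<delta> - 1) * (\<Sum>m=1..D. real m powr (\<delta> - 1))" by (simp add: sum_distrib_left)
    also have "\<dots> \<le> real q * real D powr (\<delta> - 1) * (real D powr \<delta> / \<delta>)"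
      using z(3)[OF D] by (intro mult_left_mono) auto
    also have "\<dots> = M * (real q / (\<delta> * real D))" unfolding MD M(1) by (simp add: mult_ac)
    finally show ?thesis .
  qed
  define e where "e = (\<lambda>d. (\<Sum>m=1..N div d. real m powr (\<delta> - 1)) - (real N / real d) powr \<delta> / \<delta> - z)"
  \<comment> \<open>Passing from t = N/d to its integer part T costs a second T^(\<delta> - 1), and
    T \<ge> t/2 costs a factor of at most 2; together these give 4.\<close>
  have e: "\<bar>e d\<bar> \<le> 4 * (real N / real d) powr (\<delta> - 1)" if d: "d \<in> {1..D}" for d
  proof -
    define T where "T = N div d"
    define t where "t = real N / real d"
    have T: "T \<ge> 1" using d N unfolding T_def by (metis atLeastAtMost_iff div_greater_zero_iff less_eq_Suc_le One_nat_def order_trans zero_less_one)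
    have d0: "d > 0" using d by simp
    have "T * d \<le> N" "N < Suc T * d" using d0 dividend_less_div_times[of d N] unfolding T_def by simp_all
    hence "real T * real d \<le> real N" "real N < (real T + 1) * real d"
      by (metis of_nat_le_iff of_nat_mult, metis of_nat_less_iff of_nat_mult of_nat_Suc add.commute)
    hence "real T \<le> t" "t < real T + 1" unfolding t_def using d0 by (simp_all add: field_simps)
    have "0 \<le> (t powr \<delta> - real T powr \<delta>) / \<delta>" using \<delta> T \<open>real T \<le> t\<close> by (intro divide_nonneg_pos) (auto intro!: powr_mono2)
    moreover have "(t powr \<delta> - real T powr \<delta>) / \<delta> \<le> (t - real T) * real T powr (\<delta> - 1)"
      using powr_increment_bounds(1)[OF \<delta>, of "real T" t] T \<open>real T \<le> t\<close> by simp
    moreover have "(t - real T) * real T powr (\<delta> - 1) \<le> 1 * real T powr (\<delta> - 1)"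
      using \<open>t < real T + 1\<close> by (intro mult_right_mono) auto
    moreover have "\<bar>(\<Sum>m=1..T. real m powr (\<delta> - 1)) - real T powr \<delta> / \<delta> - z\<bar> \<le> real T powr (\<delta> - 1)"
      by (rule z(2)[OF T])
    ultimately have "\<bar>e d\<bar> \<le> 2 * real T powr (\<delta> - 1)"
      unfolding e_def T_def[symmetric] t_def[symmetric] diff_divide_distrib by linarith
    also have "real T powr (\<delta> - 1) \<le> (t / 2) powr (\<delta> - 1)"
      using T \<open>t < real T + 1\<close> \<open>real T \<le> t\<close> \<delta> by (intro powr_mono2') auto
    also have "(t / 2) powr (\<delta> - 1) = t powr (\<delta> - 1) * 2 powr (1 - \<delta>)"
    proof -
      have "2 powr (1 - \<delta>) = inverse (2 powr (\<delta> - 1))" by (metis minus_diff_eq powr_minus)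
      moreover have "(t / 2) powr (\<delta> - 1) = t powr (\<delta> - 1) / 2 powr (\<delta> - 1)"
        by (rule powr_divide)
      ultimately show ?thesis by (simp only: divide_inverse)
    qed
    also have "\<dots> \<le> t powr (\<delta> - 1) * 2 powr 1" using \<delta> by (intro mult_left_mono powr_mono) auto
    finally show ?thesis by (simp add: t_def)
  qed
  have expand: "x * a * (m / b + w + y) = m * (x * (a / b)) + w * (x * a) + x * a * y" for x a m b w y :: real
    by (simp add: algebra_simps)
  have first: "(\<Sum>d=1..D. \<Sum>m=1..N div d. X d * real (d * m) powr (\<delta> - 1)) =
     M / \<delta> * (\<Sum>d=1..D. X d / real d) + z * (\<Sum>d=1..D. X d * real d powr (\<delta> - 1)) + (\<Sum>d=1..D. X d * real d powr (\<delta> - 1) * e d)"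
  proof -
    have "(\<Sum>m=1..N div d. X d * real (d * m) powr (\<delta> - 1)) =
        M / \<delta> * (X d / real d) + z * (X d * real d powr (\<delta> - 1)) + X d * real d powr (\<delta> - 1) * e d" if d: "d \<in> {1..D}" for d
    proof -
      have "(\<Sum>m=1..N div d. X d * real (d * m) powr (\<delta> - 1)) = X d * real d powr (\<delta> - 1) * (\<Sum>m=1..N div d. real m powr (\<delta> - 1))"
        by (simp add: powr_mult sum_distrib_left mult.assoc)
      also have "(\<Sum>m=1..N div d. real m powr (\<delta> - 1)) = (real N / real d) powr \<delta> / \<delta> + z + e d" by (simp add: e_def)
      also have "(real N / real d) powr \<delta> / \<delta> = M / \<delta> / real d powr \<delta>" by (simp add: M_def powr_divide)
      also have "X d * real d powr (\<delta> - 1) * (M / \<delta> / real d powr \<delta> + z + e d) =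
         M / \<delta> * (X d * (real d powr (\<delta> - 1) / real d powr \<delta>)) + z * (X d * real d powr (\<delta> - 1)) + X d * real d powr (\<delta> - 1) * e d"
        by (rule expand)
      also have "real d powr (\<delta> - 1) / real d powr \<delta> = 1 / real d"
        using d by (simp add: powr_diff)
      finally show ?thesis by simp
    qed
    thus ?thesis by (simp add: sum.distrib sum_distrib_left)
  qed
  have t1: "M / \<delta> * (\<Sum>d=1..D. X d / real d) \<ge> M / \<delta> * L1 - M * (real q / (\<delta> * real D))"
  proof -
    have "real q / real (Suc D) \<le> real q / real D" using D by (intro divide_left_mono) auto
    hence "(\<Sum>d=1..D. X d / real d) \<ge> L1 - real q / real D" using L1_partial[of D] by linarith
    hence "M / \<delta> * (\<Sum>d=1..D. X d / real d) \<ge> M / \<delta> * (L1 - real q / real D)"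
      using M \<delta> by (intro mult_left_mono) auto
    thus ?thesis by (simp add: algebra_simps)
  qed
  have t2: "\<bar>z * (\<Sum>d=1..D. X d * real d powr (\<delta> - 1))\<bar> \<le> M * (real q / (\<delta> * real D))"
  proof -
    have "\<bar>z * (\<Sum>d=1..D. X d * real d powr (\<delta> - 1))\<bar> \<le> 1 / \<delta> * (real q * real (Suc D) powr (\<delta> - 1))"
      unfolding abs_mult using \<delta> z(1) Lzero_partial[of D] by (intro mult_mono) auto
    also have "\<dots> \<le> 1 / \<delta> * (real q * real D powr (\<delta> - 1))"
      using \<delta> D by (intro mult_left_mono powr_mono2') auto
    also have "\<dots> \<le> 1 / \<delta> * (real q * (M / real D))"
      unfolding MD using \<delta> DM by (intro mult_left_mono divide_right_mono) auto
    finally show ?thesis by (simp add: mult.commute)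
  qed
  have t3: "\<bar>\<Sum>d=1..D. X d * real d powr (\<delta> - 1) * e d\<bar> \<le> M * (4 / real D)"
  proof -
    have "\<bar>\<Sum>d=1..D. X d * real d powr (\<delta> - 1) * e d\<bar> \<le> (\<Sum>d=1..D. 4 * real N powr (\<delta> - 1))"
    proof (intro order.trans[OF sum_abs] sum_mono)
      fix d assume d: "d \<in> {1..D}"
      have "\<bar>X d * real d powr (\<delta> - 1) * e d\<bar> \<le> 1 * real d powr (\<delta> - 1) * (4 * (real N / real d) powr (\<delta> - 1))"
        unfolding abs_mult using abs_le e[OF d] by (intro mult_mono) auto
      also have "\<dots> = 4 * real N powr (\<delta> - 1)" using d by (simp add: powr_divide)
      finally show "\<bar>X d * real d powr (\<delta> - 1) * e d\<bar> \<le> 4 * real N powr (\<delta> - 1)" .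
    qed
    also have "\<dots> = 4 * real D * (M / real N)" using N by (simp add: M_def powr_diff)
    also have "\<dots> = M * (4 / real D)" using D by (simp add: N(3))
    finally show ?thesis .
  qed
  have t4: "M * (4 / real D) \<le> M * (4 * (real q / (\<delta> * real D)))"
  proof -
    have "1 \<le> real q / \<delta>" using q \<delta> by simp
    hence "4 / real D * 1 \<le> 4 / real D * (real q / \<delta>)" by (intro mult_left_mono) auto
    thus ?thesis using M by (intro mult_left_mono) (auto simp: mult.commute)
  qed
  \<comment> \<open>The constant 7 is 1 + 1 + 4 + 1, from \<open>t1\<close>, \<open>t2\<close>,
    \<open>t3\<close> with \<open>t4\<close>, and \<open>second\<close>.\<close>
  have "M * (7 * real q / (\<delta> * real D)) = 7 * (M * (real q / (\<delta> * real D)))" "M * L1 / \<delta> = M / \<delta> * L1" by simp_all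
  thus ?thesis using split first second t1 t2 t3 t4 unfolding M_def N_def by linarith
qed

text \<open>On n \<le> D^2 the factor n^\<delta> is at most the power of D^2 that appears on both
  sides, so it can be divided out.\<close>

lemma L1_le_r_sum:
  assumes D: "D \<ge> 1"
  shows "L1 / \<delta> \<le> (\<Sum>n=1..D\<^sup>2. r n / real n) + 7 * real q / (\<delta> * real D)"
proof -
  define M where "M = real (D\<^sup>2) powr \<delta>"
  have M: "M > 0" using D by (simp add: M_def)
  have "(\<Sum>n=1..D\<^sup>2. r n * real n powr (\<delta> - 1)) \<le> (\<Sum>n=1..D\<^sup>2. M * (r n / real n))"
  proof (rule sum_mono)
    fix n assume n: "n \<in> {1..D\<^sup>2}"
    have "real n powr (\<delta> - 1) = real n powr \<delta> / real n" using n by (simp add: powr_diff)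
    also have "\<dots> \<le> M / real n" unfolding M_def using n \<delta> by (intro divide_right_mono powr_mono2) auto
    finally have "r n * real n powr (\<delta> - 1) \<le> r n * (M / real n)" using r_nonneg by (intro mult_left_mono) auto
    thus "r n * real n powr (\<delta> - 1) \<le> M * (r n / real n)" by (simp add: mult_ac)
  qed
  also have "\<dots> = M * (\<Sum>n=1..D\<^sup>2. r n / real n)" by (simp add: sum_distrib_left)
  finally have "M * (L1 / \<delta>) \<le> M * ((\<Sum>n=1..D\<^sup>2. r n / real n) + 7 * real q / (\<delta> * real D))"
    using twisted_r_sum[OF D] by (simp add: M_def algebra_simps)
  thus ?thesis using M mult_le_cancel_left_pos by blast
qed

text \<open>A crude consequence of r(n) \<le> n. It keeps q/\<delta>, and with it the scale of the
  construction, below a fixed power of \<open>q\<close>.\<close>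

lemma delta_lower: "\<delta> \<ge> 1 / (102760448 * real q ^ 5)"
proof -
  \<comment> \<open>Chosen so that 7 q/D is half of the lower bound 1/(64 q) for \<open>L1\<close>;
    then 102760448 = 128 * 896^2.\<close>
  define D where "D = 896 * q\<^sup>2"
  have D: "D \<ge> 1" "real D = 896 * real q ^ 2" using q by (auto simp: D_def)
  have "(\<Sum>n=1..D\<^sup>2. r n / real n) \<le> (\<Sum>n=1..D\<^sup>2. 1)"
    using r_le by (intro sum_mono) (simp add: divide_le_eq)
  hence "L1 / \<delta> \<le> real D ^ 2 + 7 * real q / (\<delta> * real D)" using L1_le_r_sum[OF D(1)] by simp
  hence "L1 \<le> \<delta> * real D ^ 2 + 7 * real q / real D" using \<delta> by (simp add: field_simps)
  moreover have "7 * real q / real D = 1 / (128 * real q)" using q by (simp add: D(2) power2_eq_square field_simps)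
  moreover have "1 / (64 * real q) = 1 / (128 * real q) + 1 / (128 * real q)" by simp
  ultimately have "1 / (128 * real q) \<le> \<delta> * real D ^ 2" using L1_lower by linarith
  moreover have "real D ^ 2 = 802816 * real q ^ 4" by (simp add: D(2) power_mult_distrib)
  ultimately have "1 \<le> \<delta> * (802816 * real q ^ 4) * (128 * real q)" using q by (simp add: divide_le_eq)
  hence "1 \<le> \<delta> * (102760448 * real q ^ 5)" by (simp add: power_numeral_reduce algebra_simps)
  thus ?thesis using q by (simp add: divide_le_eq)
qed

text \<open>For D \<ge> 7 q/\<delta> the error is at most 1, which the term n = 1 already covers;
  hence the factor 2.\<close>

lemma L1_le:
  assumes D: "real D \<ge> 7 * real q / \<delta>"
  shows "L1 \<le> 2 * \<delta> * (\<Sum>n=1..D\<^sup>2. r n / real n)"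
proof -
  have "7 * real q / \<delta> > 0" using q \<delta> by simp
  hence D0: "D > 0" using D by (metis gr0I of_nat_0 not_less)
  have "7 * real q / (\<delta> * real D) \<le> 1" using D D0 \<delta> by (simp add: field_simps)
  moreover have "1 \<le> (\<Sum>n=1..D\<^sup>2. r n / real n)"
  proof -
    have "(\<Sum>n\<in>{1}. r n / real n) \<le> (\<Sum>n=1..D\<^sup>2. r n / real n)"
      using D0 r_nonneg by (intro sum_mono2) (auto simp: Suc_le_eq)
    thus ?thesis by simp
  qed
  moreover have "L1 / \<delta> \<le> (\<Sum>n=1..D\<^sup>2. r n / real n) + 7 * real q / (\<delta> * real D)"
    using D0 by (intro L1_le_r_sum) auto
  ultimately have "L1 / \<delta> \<le> 2 * (\<Sum>n=1..D\<^sup>2. r n / real n)" by linarith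
  thus ?thesis using \<delta> by (simp add: field_simps)
qed

end

section \<open>Scarcity of the primes at which the character is 1\<close>

lemma prod_primes_dvd:
  fixes Q :: "nat set"
  assumes "finite Q" "\<And>p. p \<in> Q \<Longrightarrow> prime p" "\<And>p. p \<in> Q \<Longrightarrow> p dvd N"
  shows "\<Prod>Q dvd N"
  using assms
proof (induction Q rule: finite_induct)
  case (insert p Q)
  have "coprime p (\<Prod>Q)" using insert by (intro prod_coprime_right primes_coprime) auto
  thus ?case using insert by (simp add: divides_mult)
qed simp

context real_nonprincipal_character
begin

lemma L1_pos: "L1 > 0"
proof -
  have "0 < 1 / (64 * real q)" using q by simp
  thus ?thesis using L1_lower by linarith
qed

text \<open>Each of the \<open>i\<close> dyadic blocks (Z, 2Z] costs at most 16 L1: the bound 8 * 2Z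
  * L1 for the sum of \<open>r\<close>, divided by Z.\<close>

lemma r_dyadic_sum:
  assumes k: "64 * q\<^sup>2 \<le> 2 ^ k"
  shows "(\<Sum>n\<in>{2^k<..2^(k+i)}. r n / real n) \<le> 16 * real i * L1"
proof (induction i)
  case (Suc i)
  define Z where "Z = (2::nat) ^ (k + i)"
  have ZZ: "2 ^ (k + Suc i) = 2 * Z" by (simp add: Z_def)
  have "2 ^ k \<le> Z" unfolding Z_def by (intro power_increasing) auto
  hence Z: "64 * q\<^sup>2 \<le> 2 * Z" "2 ^ k \<le> Z" "Z > 0" using k by (linarith, auto simp: Z_def)
  have "{2^k<..2 * Z} = {2^k<..Z} \<union> {Z<..2*Z}" "{2^k<..Z} \<inter> {Z<..2*Z} = {}" using Z by auto
  hence "(\<Sum>n\<in>{2^k<..2^(k+Suc i)}. r n / real n) = (\<Sum>n\<in>{2^k<..Z}. r n / real n) + (\<Sum>n\<in>{Z<..2*Z}. r n / real n)"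
    unfolding ZZ by (simp add: sum.union_disjoint)
  also have "(\<Sum>n\<in>{Z<..2*Z}. r n / real n) \<le> (\<Sum>n\<in>{Z<..2*Z}. r n * (1 / real Z))"
    using r_nonneg Z by (intro sum_mono) (auto simp: frac_le divide_left_mono mult_left_mono)
  also have "\<dots> = (\<Sum>n\<in>{Z<..2*Z}. r n) / real Z" by (simp add: sum_divide_distrib)
  also have "(\<Sum>n\<in>{Z<..2*Z}. r n) \<le> (\<Sum>n=1..2*Z. r n)"
    using r_nonneg by (intro sum_mono2) auto
  also have "\<dots> \<le> 8 * real (2 * Z) * L1" by (rule r_sum_bound'[OF Z(1)])
  finally have "(\<Sum>n\<in>{2^k<..2^(k+Suc i)}. r n / real n) \<le> (\<Sum>n\<in>{2^k<..Z}. r n / real n) + 16 * L1"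
    using Z by (simp add: divide_right_mono field_simps)
  thus ?case using Suc by (simp add: Z_def algebra_simps)
qed simp

lemma card_large_prime_divisors:
  fixes P :: "nat set"
  assumes P: "\<And>p. p \<in> P \<Longrightarrow> prime p \<and> Y < p" and N: "0 < N" "N \<le> Y ^ 3" and Y: "Y > 1"
  shows "card {p \<in> P. p dvd N} \<le> 3"
proof -
  let ?Q = "{p \<in> P. p dvd N}"
  have fin: "finite ?Q" using N by (intro finite_subset[OF _ finite_divisors_nat[of N]]) auto
  have "\<Prod>?Q dvd N"
    using fin P by (intro prod_primes_dvd) auto
  hence "\<Prod>?Q \<le> N" using N dvd_imp_le by blast
  moreover have "(\<Prod>p\<in>?Q. Y) \<le> (\<Prod>p\<in>?Q. p)" using P by (intro prod_mono) (auto intro: less_imp_le)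
  ultimately have "Y ^ card ?Q \<le> Y ^ 3" using N by simp
  thus ?thesis using Y by (simp add: power_increasing_iff)
qed

text \<open>A prime p > Y \<ge> n does not divide n, so r(p n) = 2 r(n) when X p = 1. The products
  land in (Y, Y^3], where a number has at most 3 prime factors beyond Y and so is hit at most 3
  times; this accounts for 3/2.\<close>

lemma r_sum_times_prime_sum:
  fixes Y :: nat
  assumes Y: "Y > 1"
  defines "P \<equiv> {p. prime p \<and> Y < p \<and> p \<le> Y ^ 2 \<and> X p = 1}"
  shows "(\<Sum>n=1..Y. r n / real n) * (\<Sum>p\<in>P. 1 / real p) \<le> 3 / 2 * (\<Sum>n\<in>{Y<..Y^3}. r n / real n)"
proof -
  have finP: "finite P" unfolding P_def by (rule finite_subset[of _ "{..Y^2}"]) auto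
  let ?g = "\<lambda>n. r n / real n" and ?B = "{Y<..Y^3}"
  have "2 * ((\<Sum>n=1..Y. ?g n) * (\<Sum>p\<in>P. 1 / real p)) = (\<Sum>p\<in>P. \<Sum>n=1..Y. ?g (p * n))"
  proof -
    have *: "2 * (?g n * (1 / real p)) = ?g (p * n)" if "p \<in> P" "n \<in> {1..Y}" for p n
    proof -
      have "\<not> p dvd n" using that by (auto simp: P_def dest!: dvd_imp_le)
      hence "r (p * n) = 2 * r n" using that by (intro r_prime_times) (auto simp: P_def)
      thus ?thesis by (simp add: mult.commute)
    qed
    have "2 * ((\<Sum>n=1..Y. ?g n) * (\<Sum>p\<in>P. 1 / real p)) = (\<Sum>p\<in>P. \<Sum>n=1..Y. 2 * (?g n * (1 / real p)))"
      unfolding sum_product by (subst sum.swap) (simp add: sum_distrib_left)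
    also have "\<dots> = (\<Sum>p\<in>P. \<Sum>n=1..Y. ?g (p * n))"
      using * by (intro sum.cong refl) auto
    finally show ?thesis .
  qed
  also have "\<dots> \<le> (\<Sum>p\<in>P. \<Sum>N\<in>?B. if p dvd N then ?g N else 0)"
  proof (rule sum_mono)
    fix p assume p: "p \<in> P"
    hence p0: "p > 0" by (auto simp: P_def)
    have "(\<Sum>n=1..Y. ?g (p * n)) = (\<Sum>N\<in>(\<lambda>n. p * n) ` {1..Y}. ?g N)"
      using p0 by (subst sum.reindex) (auto simp: inj_on_def)
    also have "\<dots> \<le> (\<Sum>N\<in>{N\<in>?B. p dvd N}. ?g N)"
    proof (rule sum_mono2)
      show "(\<lambda>n. p * n) ` {1..Y} \<subseteq> {N \<in> ?B. p dvd N}"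
      proof safe
        fix n assume n: "n \<in> {1..Y}"
        have "p * 1 \<le> p * n" using n by (intro mult_left_mono) auto
        hence "p \<le> p * n" by simp
        hence "Y < p * n" using p unfolding P_def by (auto intro: less_le_trans)
        moreover have "p * n \<le> Y ^ 2 * Y" using n p by (intro mult_mono) (auto simp: P_def)
        ultimately show "p * n \<in> ?B" by (simp add: power_numeral_reduce)
      qed auto
    qed (use r_nonneg in auto)
    also have "\<dots> = (\<Sum>N\<in>?B. if p dvd N then ?g N else 0)" by (rule sum.inter_filter) auto
    finally show "(\<Sum>n=1..Y. ?g (p * n)) \<le> (\<Sum>N\<in>?B. if p dvd N then ?g N else 0)" .
  qed
  also have "\<dots> = (\<Sum>N\<in>?B. \<Sum>p\<in>P. if p dvd N then ?g N else 0)" by (rule sum.swap)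
  also have "\<dots> = (\<Sum>N\<in>?B. real (card {p\<in>P. p dvd N}) * ?g N)"
    using finP by (simp add: sum.inter_filter[symmetric])
  also have "\<dots> \<le> (\<Sum>N\<in>?B. 3 * ?g N)"
  proof (rule sum_mono)
    fix N assume N: "N \<in> ?B"
    have "card {p \<in> P. p dvd N} \<le> 3"
      using N Y by (intro card_large_prime_divisors[of P Y]) (auto simp: P_def)
    thus "real (card {p\<in>P. p dvd N}) * ?g N \<le> 3 * ?g N"
      using r_nonneg by (intro mult_right_mono) auto
  qed
  also have "\<dots> = 3 * (\<Sum>N\<in>?B. ?g N)" by (simp only: sum_distrib_left)
  finally show ?thesis by simp
qed

text \<open>The vanishing sum over a period says that the values 1 and -1 are taken equally
  often.\<close>

lemma card_positive_residues: "2 * card {a \<in> {0<..q}. X a = 1} = totient q"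
proof -
  let ?A = "{a \<in> {0<..q}. X a = 1}" and ?B = "{a \<in> {0<..q}. X a = -1}"
  have "(\<Sum>a\<in>{0<..q}. X a) = (\<Sum>a\<in>?A \<union> ?B. X a)"
    using vals by (intro sum.mono_neutral_right) auto
  also have "\<dots> = (\<Sum>a\<in>?A. X a) + (\<Sum>a\<in>?B. X a)"
    by (rule sum.union_disjoint) auto
  also have "\<dots> = real (card ?A) - real (card ?B)" by simp
  finally have "card ?A = card ?B" using period_sum[of 0] by simp
  moreover have "totatives q = ?A \<union> ?B"
  proof (intro equalityI subsetI)
    fix a assume "a \<in> totatives q"
    thus "a \<in> ?A \<union> ?B" using vals[of a] nz[of a] by (auto simp: totatives_def)
  next
    fix a assume "a \<in> ?A \<union> ?B"
    moreover from this have "X a \<noteq> 0" by auto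
    ultimately show "a \<in> totatives q" using nz[of a] by (auto simp: totatives_def)
  qed
  moreover have "card (?A \<union> ?B) = card ?A + card ?B" by (rule card_Un_disjoint) auto
  ultimately show ?thesis unfolding totient_def by simp
qed

lemma X_mod: "X (n mod q) = X n"
proof -
  have "X (m + j * q) = X m" for m j
  proof (induction j)
    case (Suc j)
    have "X (m + Suc j * q) = X ((m + j * q) + q)" by (simp add: algebra_simps)
    thus ?case using per Suc by simp
  qed simp
  from this[of "n mod q" "n div q"] show ?thesis by (simp add: mult.commute)
qed

text \<open>Pigeonhole over the phi(q)/2 classes on which \<open>X\<close> is 1; the half is the
  origin of the factor 2.\<close>

lemma exists_sparse_residue:
  assumes fin: "finite P" and P: "\<And>p. p \<in> P \<Longrightarrow> X p = 1"
  obtains a where "0 < a" "a < q" "coprime a q" "X a = 1" "card {p \<in> P. p mod q = a} * totient q \<le> 2 * card P"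
proof -
  let ?A = "{a \<in> {0<..q}. X a = 1}"
  have tot: "2 * card ?A = totient q" by (rule card_positive_residues)
  have "\<exists>a\<in>?A. card {p \<in> P. p mod q = a} * totient q \<le> 2 * card P"
  proof (rule ccontr)
    assume "\<not> ?thesis"
    hence *: "\<And>a. a \<in> ?A \<Longrightarrow> 2 * card P < card {p \<in> P. p mod q = a} * totient q" by force
    have "totient q > 0" using q by simp
    hence ne: "?A \<noteq> {}" using tot by (intro notI) (simp only: card.empty mult_0_right)
    have "2 * card P * card ?A = (\<Sum>a\<in>?A. 2 * card P)" by simp
    also have "\<dots> < (\<Sum>a\<in>?A. card {p \<in> P. p mod q = a} * totient q)"
      using ne * by (intro sum_strict_mono) auto
    also have "\<dots> = (\<Sum>a\<in>?A. card {p \<in> P. p mod q = a}) * totient q" by (simp add: sum_distrib_right)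
    also have "(\<Sum>a\<in>?A. card {p \<in> P. p mod q = a}) = card (\<Union>a\<in>?A. {p \<in> P. p mod q = a})"
      using fin by (intro card_UN_disjoint[symmetric]) auto
    also have "\<dots> \<le> card P" using fin by (intro card_mono) auto
    finally have "2 * card ?A * card P < card P * totient q" by (simp add: mult_ac)
    thus False using tot by simp
  qed
  then obtain a where a: "a \<in> ?A" "card {p \<in> P. p mod q = a} * totient q \<le> 2 * card P" by blast
  have "a \<noteq> q" using a per[of 0] by auto
  moreover have "coprime a q" using a nz[of a] by auto
  ultimately show ?thesis using a that[of a] by auto
qed

end

context exceptional_zero
begin

lemma prime_reciprocal_sum:
  assumes l: "2 ^ l \<ge> 8 * real q / \<delta>"
  shows "(\<Sum>p | prime p \<and> 2^(2*l) < p \<and> p \<le> 2^(4*l) \<and> X p = 1. 1 / real p) \<le> 192 * real l * \<delta>"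
proof -
  \<comment> \<open>\<open>Y\<close> is the square of D = 2^l, and the hypothesis on
    \<open>l\<close> gives what \<open>L1_le\<close> asks of D. It also makes Y \<ge> 64 q^2, as the
    dyadic bound requires.\<close>
  define Y where "Y = (2::nat) ^ (2 * l)"
  define S where "S = (\<Sum>n=1..Y. r n / real n)"
  define T where "T = (\<Sum>p | prime p \<and> 2^(2*l) < p \<and> p \<le> 2^(4*l) \<and> X p = 1. 1 / real p)"
  have "8 * real q * \<delta> \<le> 8 * real q * 1" using \<delta> by (intro mult_left_mono) auto
  hence "8 * real q \<le> 8 * real q / \<delta>" using \<delta> by (simp add: le_divide_eq)
  hence "8 * real q \<le> 2 ^ l" using l by linarith
  hence "real (8 * q) \<le> real (2 ^ l)" by simp
  hence l8: "8 * q \<le> 2 ^ l" by (simp only: of_nat_le_iff)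
  have Yl: "Y = (2 ^ l)\<^sup>2" by (simp add: Y_def power_even_eq)
  have Y64: "64 * q\<^sup>2 \<le> Y" using power_mono[OF l8, of 2] unfolding Yl by (simp add: power_mult_distrib)
  have "q\<^sup>2 > 0" using q by simp
  hence Y1: "Y > 1" using Y64 by linarith
  have "7 * real q / \<delta> \<le> 8 * real q / \<delta>" using \<delta> by (intro divide_right_mono) auto
  hence L1: "L1 \<le> 2 * \<delta> * S" using L1_le[of "2 ^ l"] l unfolding S_def Yl by simp
  have S: "S > 0"
  proof (rule ccontr)
    assume "\<not> S > 0"
    hence "2 * \<delta> * S \<le> 0" using \<delta> by (intro mult_nonneg_nonpos) auto
    thus False using L1 L1_pos by linarith
  qed
  have "S * T \<le> 3 / 2 * (\<Sum>n\<in>{Y<..Y^3}. r n / real n)"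
  proof -
    have "Y ^ 2 = 2 ^ (4 * l)" by (simp add: Y_def power_mult[symmetric])
    thus ?thesis using r_sum_times_prime_sum[OF Y1] unfolding S_def T_def Y_def[symmetric] by simp
  qed
  also have "(\<Sum>n\<in>{Y<..Y^3}. r n / real n) \<le> 16 * real (4 * l) * L1"
  proof -
    have "Y ^ 3 = 2 ^ (2 * l + 4 * l)" by (simp add: Y_def power_mult[symmetric])
    moreover have "64 * q\<^sup>2 \<le> 2 ^ (2 * l)" using Y64 by (simp add: Y_def)
    ultimately show ?thesis using r_dyadic_sum[of "2 * l" "4 * l"] unfolding Y_def[symmetric] by simp
  qed
  hence "3 / 2 * (\<Sum>n\<in>{Y<..Y^3}. r n / real n) \<le> 3 / 2 * (16 * real (4 * l) * L1)"
    by (intro mult_left_mono) auto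
  also have "3 / 2 * (16 * real (4 * l) * L1) \<le> 3 / 2 * (16 * real (4 * l) * (2 * \<delta> * S))"
    using L1 by (intro mult_left_mono) auto
  \<comment> \<open>The unknown mass \<open>S\<close> is about to cancel; 192 = (3/2) * 16 * 4 *
    2.\<close>
  finally have "S * T \<le> S * (192 * real l * \<delta>)" by (simp add: algebra_simps)
  thus ?thesis using S unfolding T_def by simp
qed

text \<open>If each of the 2 l blocks held more than 200 \<delta> 2^j such primes, each would
  contribute at least 100 \<delta> to the sum of 1/p, and the total 200 l \<delta> would exceed the
  bound 192 l \<delta>.\<close>

lemma exists_sparse_dyadic_block:
  assumes l: "2 ^ l \<ge> 8 * real q / \<delta>"
  obtains j where "2 * l \<le> j" "j < 4 * l"
    "real (card {p. prime p \<and> 2^j < p \<and> p \<le> 2^(Suc j) \<and> X p = 1}) \<le> 200 * \<delta> * 2 ^ j"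
proof -
  define W where "W = (\<lambda>j. {p::nat. prime p \<and> 2^j < p \<and> p \<le> 2^(Suc j) \<and> X p = 1})"
  define V where "V = (\<lambda>i. {p::nat. prime p \<and> 2^(2*l) < p \<and> p \<le> 2^(2*l+i) \<and> X p = 1})"
  have finW: "finite (W j)" for j unfolding W_def by (rule finite_subset[of _ "{..2^(Suc j)}"]) auto
  have finV: "finite (V i)" for i unfolding V_def by (rule finite_subset[of _ "{..2^(2*l+i)}"]) auto
  have "8 * real q / \<delta> > 8 * real q" using q \<delta> by (simp add: less_divide_eq)
  hence "2 ^ l > (1::real)" using l q by linarith
  hence l0: "l > 0" by (intro Nat.gr0I) auto
  have "\<exists>j. 2 * l \<le> j \<and> j < 4 * l \<and> real (card (W j)) \<le> 200 * \<delta> * 2 ^ j"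
  proof (rule ccontr)
    assume "\<not> ?thesis"
    hence big: "real (card (W j)) > 200 * \<delta> * 2 ^ j" if "2 * l \<le> j" "j < 4 * l" for j using that by force
    have "100 * \<delta> * real i \<le> (\<Sum>p\<in>V i. 1 / real p)" if "i \<le> 2 * l" for i
      using that
    proof (induction i)
      case (Suc i)
      define A B C where "A = (2::nat) ^ (2 * l)" and "B = (2::nat) ^ (2 * l + i)" and "C = (2::nat) ^ Suc (2 * l + i)"
      have le: "A \<le> B" "B \<le> C"
        unfolding A_def B_def C_def by (intro power_increasing; simp)+
      have VW: "V i = {p. prime p \<and> A < p \<and> p \<le> B \<and> X p = 1}" "W (2 * l + i) = {p. prime p \<and> B < p \<and> p \<le> C \<and> X p = 1}"
        "V (Suc i) = {p. prime p \<and> A < p \<and> p \<le> C \<and> X p = 1}"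
        unfolding V_def W_def A_def B_def C_def by simp_all
      have "V (Suc i) = V i \<union> W (2 * l + i)" "V i \<inter> W (2 * l + i) = {}"
        unfolding VW using le by auto
      hence "(\<Sum>p\<in>V (Suc i). 1 / real p) = (\<Sum>p\<in>V i. 1 / real p) + (\<Sum>p\<in>W (2 * l + i). 1 / real p)"
        using finV finW by (simp add: sum.union_disjoint)
      moreover have "(\<Sum>p\<in>W (2 * l + i). 1 / real p) \<ge> (\<Sum>p\<in>W (2 * l + i). 1 / (2 * 2 ^ (2 * l + i)))"
      proof (rule sum_mono)
        fix p assume p: "p \<in> W (2 * l + i)"
        hence "real p \<le> real (2 ^ Suc (2 * l + i))" unfolding W_def of_nat_le_iff by blast
        moreover have "p > 0" using p by (auto simp: W_def prime_gt_0_nat)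
        ultimately show "1 / (2 * 2 ^ (2 * l + i)) \<le> 1 / real p" by (intro divide_left_mono) auto
      qed
      moreover have "(\<Sum>p\<in>W (2 * l + i). 1 / (2 * 2 ^ (2 * l + i))) \<ge> 100 * \<delta>"
        using big[of "2 * l + i"] Suc.prems by (simp add: field_simps)
      ultimately show ?case using Suc by (simp add: algebra_simps)
    qed (simp add: sum_nonneg)
    hence "100 * \<delta> * real (2 * l) \<le> (\<Sum>p\<in>V (2 * l). 1 / real p)" by blast
    also have "V (2 * l) = {p. prime p \<and> 2^(2*l) < p \<and> p \<le> 2^(4*l) \<and> X p = 1}" by (simp add: V_def)
    also note prime_reciprocal_sum[OF l]
    finally have "100 * \<delta> * real (2 * l) \<le> 192 * real l * \<delta>" .
    moreover have "\<delta> * real l > 0" using \<delta> l0 by simp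
    ultimately show False by (simp add: mult_ac)
  qed
  thus ?thesis using that unfolding W_def by blast
qed

lemma exists_sparse_progression:
  assumes l: "2 ^ l \<ge> 8 * real q / \<delta>"
  obtains j a where "2 * l \<le> j" "j < 4 * l" "0 < a" "a < q" "coprime a q"
    "real (card {p. prime p \<and> 2^j < p \<and> p \<le> 2^(Suc j) \<and> p mod q = a}) * real (totient q) \<le> 400 * \<delta> * 2 ^ j"
proof -
  obtain j where j: "2 * l \<le> j" "j < 4 * l"
    "real (card {p. prime p \<and> 2^j < p \<and> p \<le> 2^(Suc j) \<and> X p = 1}) \<le> 200 * \<delta> * 2 ^ j"
    using exists_sparse_dyadic_block[OF l] by blast
  define P where "P = {p::nat. prime p \<and> 2^j < p \<and> p \<le> 2^(Suc j) \<and> X p = 1}"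
  have fin: "finite P" unfolding P_def by (rule finite_subset[of _ "{..2^(Suc j)}"]) auto
  have PX: "X p = 1" if "p \<in> P" for p using that by (simp add: P_def)
  obtain a where a: "0 < a" "a < q" "coprime a q" "X a = 1" "card {p \<in> P. p mod q = a} * totient q \<le> 2 * card P"
    by (rule exists_sparse_residue[OF fin PX])
  have "X p = 1" if "p mod q = a" for p
    using X_mod[of p] a(4) that by simp
  hence eq: "{p. prime p \<and> 2^j < p \<and> p \<le> 2^(Suc j) \<and> p mod q = a} = {p \<in> P. p mod q = a}"
    unfolding P_def by blast
  have "real (card {p \<in> P. p mod q = a}) * real (totient q) \<le> 2 * real (card P)"
  proof -
    have "real (card {p \<in> P. p mod q = a} * totient q) \<le> real (2 * card P)"
      using a(5) by (simp only: of_nat_le_iff)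
    thus ?thesis by simp
  qed
  hence "real (card {p. prime p \<and> 2^j < p \<and> p \<le> 2^(Suc j) \<and> p mod q = a}) * real (totient q) \<le> 400 * \<delta> * 2 ^ j"
    unfolding eq using j(3)[folded P_def] by linarith
  thus ?thesis using that[OF j(1,2) a(1-3)] by blast
qed

end

section \<open>Chebyshev bounds and gaps from coverings\<close>

text \<open>This is Leibniz' harmonic triangle: the reciprocal of (m + 1) C(k + 1, m + 1) is the
  difference of the reciprocals of m C(k, m) and m C(k + 1, m), so the cofactors \<open>A\<close>
  and \<open>B\<close> of the common multiple are subtracted. The computation runs in the reals, and
  positivity brings the difference back to the naturals.\<close>

lemma binomial_times_dvd_Lcm:
  assumes "1 \<le> m" "m \<le> n" "n \<le> N"
  shows "m * (n choose m) dvd Lcm {1..N}"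
  using assms
proof (induction m arbitrary: n rule: nat_induct_at_least)
  case base
  thus ?case by (auto intro: dvd_Lcm)
next
  case (Suc m)
  then obtain k where n: "n = Suc k" "m \<le> k" by (cases n) auto
  define d where "d = Lcm {1..N}"
  have d0: "d > 0" unfolding d_def by (intro Nat.gr0I) (auto simp: Lcm_0_iff)
  obtain A where A: "d = m * (k choose m) * A"
    using Suc.IH[of k] n Suc.prems unfolding d_def by (auto elim: dvdE)
  obtain B where B: "d = m * (Suc k choose m) * B"
    using Suc.IH[of "Suc k"] n Suc.prems unfolding d_def by (auto elim: dvdE)
  define c where "c = real (k choose m)"
  have c: "c > 0" using n by (simp add: c_def)
  have m: "real m > 0" using Suc.hyps by simp
  have rec: "real (Suc k choose m) * (real (Suc k) - real m) = real (Suc k) * c"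
  proof -
    have "(Suc k - m) * (Suc k choose m) = Suc k * (k choose m)"
      using binomial_absorb_comp[of "Suc k" m] by simp
    hence "real ((Suc k - m) * (Suc k choose m)) = real (Suc k * (k choose m))" by (simp only:)
    hence "real (Suc k - m) * real (Suc k choose m) = real (Suc k) * real (k choose m)" by (simp only: of_nat_mult)
    moreover have "real (Suc k - m) = real (Suc k) - real m" using n by (intro of_nat_diff) simp
    ultimately show ?thesis unfolding c_def by (simp only: mult.commute)
  qed
  have A': "real d = real m * c * real A" using A by (simp add: c_def)
  have B': "real d * (real (Suc k) - real m) = real m * (real (Suc k) * c) * real B"
  proof -
    have "real d = real (m * (Suc k choose m) * B)" using B by (rule arg_cong)
    hence "real d = real m * real (Suc k choose m) * real B" by (simp only: of_nat_mult)
    hence "real d * (real (Suc k) - real m) = real m * (real (Suc k choose m) * (real (Suc k) - real m)) * real B"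
      by (simp only: mult_ac)
    thus ?thesis unfolding rec .
  qed
  have "real d * real m = real m * (real (Suc k) * c) * (real A - real B)"
  proof -
    have "real d * real m = real d * real (Suc k) - real d * (real (Suc k) - real m)" by (simp add: algebra_simps)
    also have "\<dots> = real d * real (Suc k) - real m * (real (Suc k) * c) * real B" by (simp only: B')
    also have "\<dots> = real m * c * real A * real (Suc k) - real m * (real (Suc k) * c) * real B" by (simp only: A')
    also have "\<dots> = real m * (real (Suc k) * c) * (real A - real B)" by (simp add: algebra_simps)
    finally show ?thesis .
  qed
  hence dd: "real d = real (Suc k) * c * (real A - real B)" using m by simp
  have "real (Suc k) * c * (real A - real B) > 0" unfolding dd[symmetric] using d0 by simp
  moreover have "real (Suc k) * c > 0" using c by simp
  ultimately have "real A - real B > 0" using zero_less_mult_pos by blast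
  hence "real A - real B = real (A - B)" by simp
  with dd have "real d = real (Suc k * (k choose m) * (A - B))" unfolding c_def by (simp only: of_nat_mult)
  hence "d = Suc k * (k choose m) * (A - B)" by (simp only: of_nat_eq_iff)
  moreover have "Suc m * (n choose Suc m) = Suc k * (k choose m)" unfolding n by (rule Suc_times_binomial)
  ultimately show ?case unfolding d_def by (metis dvd_triv_left)
qed

lemma prime_power_multiplicity_Lcm_le:
  fixes p n :: nat
  assumes p: "prime p" and n: "n \<ge> 1"
  shows "p ^ multiplicity p (Lcm {1..n}) \<le> n"
  using n
proof (induction n rule: dec_induct)
  case (step n)
  have "{1..Suc n} = insert (Suc n) {1..n}" by auto
  hence e: "Lcm {1..Suc n} = lcm (Suc n) (Lcm {1..n})" by simp
  have "Lcm {1..n} \<noteq> 0" by (auto simp: Lcm_0_iff)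
  hence "multiplicity p (Lcm {1..Suc n}) = max (multiplicity p (Suc n)) (multiplicity p (Lcm {1..n}))"
    unfolding e using p by (intro multiplicity_lcm) auto
  moreover have "p ^ multiplicity p (Suc n) \<le> Suc n" by (intro dvd_imp_le multiplicity_dvd) auto
  ultimately show ?case using step.IH by (simp add: max_def)
qed simp

lemma Lcm_le_power_primes:
  fixes n :: nat
  assumes n: "n \<ge> 1"
  shows "Lcm {1..n} \<le> n ^ card {p. prime p \<and> p \<le> n}"
proof -
  define d where "d = Lcm {1..n}"
  have d0: "d > 0" unfolding d_def by (intro Nat.gr0I) (auto simp: Lcm_0_iff)
  have fin: "finite {p. prime p \<and> p \<le> n}" by simp
  have "d = (\<Prod>p\<in>prime_factors d. p ^ multiplicity p d)" using d0 by (rule prime_factorization_nat)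
  also have "\<dots> \<le> (\<Prod>p\<in>prime_factors d. n)"
    using prime_power_multiplicity_Lcm_le[OF _ n] unfolding d_def by (intro prod_mono) auto
  also have "\<dots> = n ^ card (prime_factors d)" by simp
  also have "\<dots> \<le> n ^ card {p. prime p \<and> p \<le> n}"
  proof (intro power_increasing card_mono fin subsetI n)
    fix p assume p: "p \<in> prime_factors d"
    hence "prime p" "multiplicity p d > 0" using d0 by (auto simp: prime_factors_multiplicity)
    hence "p ^ 1 \<le> p ^ multiplicity p d" by (intro power_increasing) (auto simp: prime_gt_0_nat Suc_le_eq)
    also have "\<dots> \<le> n" unfolding d_def using \<open>prime p\<close> n by (rule prime_power_multiplicity_Lcm_le)
    finally show "p \<in> {p. prime p \<and> p \<le> n}" using \<open>prime p\<close> by simp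
  qed
  finally show ?thesis unfolding d_def .
qed

text \<open>With n = N div 2 the chain is 4^n \<le> 2 n C(2n, n) \<le> 2 lcm(1, ..., N) \<le> 2
  N^pi(N).\<close>

lemma prime_count_lower:
  assumes N: "N \<ge> 4"
  shows "real (card {p. prime p \<and> p \<le> N}) \<ge> real N / (3 * ln (real N))"
proof -
  define n where "n = N div 2"
  have n: "n \<ge> 1" "2 * n \<le> N" "N \<le> 2 * n + 1" using N unfolding n_def by auto
  have "4 ^ n \<le> 2 * n * (2 * n choose n)" 
  proof -
    have "4 ^ n \<le> 2 * real n * real (2 * n choose n)"
      using central_binomial_lower_bound[of n] n by (simp add: divide_le_eq mult.commute)
    hence "real (4 ^ n) \<le> real (2 * n * (2 * n choose n))" by simp
    thus ?thesis by (simp only: of_nat_le_iff)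
  qed
  also have "\<dots> \<le> 2 * Lcm {1..N}"
  proof -
    have "n * (2 * n choose n) dvd Lcm {1..N}" using n by (intro binomial_times_dvd_Lcm) auto
    moreover have "Lcm {1..N} > 0" by (intro Nat.gr0I) (auto simp: Lcm_0_iff)
    ultimately have "n * (2 * n choose n) \<le> Lcm {1..N}" by (rule dvd_imp_le)
    thus ?thesis by simp
  qed
  also have "\<dots> \<le> 2 * N ^ card {p. prime p \<and> p \<le> N}" using Lcm_le_power_primes[of N] N by simp
  finally have "4 ^ n \<le> 2 * N ^ card {p. prime p \<and> p \<le> N}" .
  moreover have "(4::nat) ^ n = 2 * 2 ^ (2 * n - 1)"
  proof -
    have "(4::nat) ^ n = 2 ^ (2 * n)" by (simp add: power_mult)
    also have "2 * n = Suc (2 * n - 1)" using n by simp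
    finally show ?thesis by (simp only: power_Suc)
  qed
  ultimately have "2 ^ (2 * n - 1) \<le> N ^ card {p. prime p \<and> p \<le> N}" by linarith
  moreover have "(2::nat) ^ (N - 2) \<le> 2 ^ (2 * n - 1)" using n by (intro power_increasing) auto
  ultimately have "2 ^ (N - 2) \<le> N ^ card {p. prime p \<and> p \<le> N}" by linarith
  hence "real (2 ^ (N - 2)) \<le> real (N ^ card {p. prime p \<and> p \<le> N})" by (simp only: of_nat_le_iff)
  hence "ln (2 ^ (N - 2)) \<le> ln (real N ^ card {p. prime p \<and> p \<le> N})" using N by simp
  hence main: "real (N - 2) * ln 2 \<le> real (card {p. prime p \<and> p \<le> N}) * ln (real N)"
    using N by (simp add: ln_realpow)
  \<comment> \<open>For N \<ge> 4 one has N - 2 \<ge> N/2; with ln 2 \<ge> 2/3 this produces the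
    constant 1/3.\<close>
  have "real N / 2 * (2 / 3) \<le> real (N - 2) * ln 2"
    using N ln2_ge_two_thirds by (intro mult_mono) (auto simp: of_nat_diff)
  with main have "real N / 3 \<le> real (card {p. prime p \<and> p \<le> N}) * ln (real N)" by simp
  moreover have "ln (real N) > 0" using N by simp
  ultimately show ?thesis by (simp add: field_simps)
qed

section \<open>Primorials and room for a prime above a run of composites\<close>

lemma binomial_middle_le: "(2 * m + 1) choose m \<le> 4 ^ m"
proof -
  have "2 * ((2 * m + 1) choose m) = ((2 * m + 1) choose m) + ((2 * m + 1) choose (Suc m))"
    using binomial_symmetric[of m "2 * m + 1"] by simp
  also have "\<dots> = (\<Sum>k\<in>{m, Suc m}. (2 * m + 1) choose k)" by simp
  also have "\<dots> \<le> (\<Sum>k\<le>2 * m + 1. (2 * m + 1) choose k)" by (rule sum_mono2) auto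
  also have "\<dots> = 2 ^ (2 * m + 1)" by (rule choose_row_sum)
  also have "\<dots> = 2 * 4 ^ m" by (simp add: power_mult)
  finally show ?thesis by simp
qed

text \<open>Erdos' induction: the primes in (m + 1, 2m + 1] all divide C(2m + 1, m) \<le> 4^m, and
  an even n > 2 contributes no new prime.\<close>

lemma primorial_le: "\<Prod>{p. prime p \<and> p \<le> n} \<le> (4::nat) ^ n"
proof (induction n rule: less_induct)
  case (less n)
  let ?P = "\<lambda>n. {p::nat. prime p \<and> p \<le> n}"
  consider "n \<le> 1" | "n = 2" | "n > 2" "even n" | "n > 2" "odd n" by linarith
  thus ?case
  proof cases
    case 1
    hence "?P n = {}" by (auto dest: prime_gt_1_nat)
    hence "\<Prod>(?P n) = \<Prod>{}" by (rule arg_cong)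
    also have "\<dots> \<le> 4 ^ n" by simp
    finally show ?thesis .
  next
    case 2
    hence "?P n = {2}" by (auto dest: prime_gt_1_nat intro: antisym)
    hence "\<Prod>(?P n) = \<Prod>{2}" by (rule arg_cong)
    also have "\<dots> \<le> 4 ^ n" using 2 by simp
    finally show ?thesis .
  next
    case 3
    have "\<not> prime n" using 3 primes_dvd_imp_eq[of 2 n] by auto
    hence "p \<le> n \<longleftrightarrow> p \<le> n - 1" if "prime p" for p using 3 that by (cases "p = n") auto
    hence "?P n = ?P (n - 1)" by blast
    moreover have "\<Prod>(?P (n - 1)) \<le> 4 ^ (n - 1)" using 3 by (intro less) auto
    moreover have "(4::nat) ^ (n - 1) \<le> 4 ^ n" by (intro power_increasing) auto
    ultimately show ?thesis by (metis (no_types, lifting) le_trans)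
  next
    case 4
    then obtain m where m: "n = 2 * m + 1" by (auto elim: oddE)
    hence m1: "m \<ge> 1" using 4 by simp
    let ?Q = "{p. prime p \<and> m + 1 < p \<and> p \<le> n}"
    have fin: "finite (?P k)" "finite ?Q" for k by auto
    have "?P n = ?P (m + 1) \<union> ?Q" "?P (m + 1) \<inter> ?Q = {}" using m by auto
    hence "\<Prod>(?P n) = \<Prod>(?P (m + 1)) * \<Prod>?Q" using fin by (simp add: prod.union_disjoint)
    moreover have "\<Prod>(?P (m + 1)) \<le> 4 ^ (m + 1)" using m m1 by (intro less) auto
    moreover have "\<Prod>?Q \<le> (2 * m + 1) choose m"
    proof -
      have "p dvd (2 * m + 1) choose m" if "p \<in> ?Q" for p
      proof -
        have p: "prime p" "m + 1 < p" "p \<le> n" using that by auto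
        have "fact m * fact (2 * m + 1 - m) * ((2 * m + 1) choose m) = (fact (2 * m + 1) :: nat)"
          by (rule binomial_fact_lemma) simp
        moreover have "p dvd fact (2 * m + 1)" using p m prime_dvd_fact_iff[OF p(1)] by blast
        ultimately have "p dvd fact m * fact (2 * m + 1 - m) * ((2 * m + 1) choose m)" by simp
        moreover have "\<not> p \<le> m" "\<not> p \<le> 2 * m + 1 - m" using p by auto
        hence "\<not> p dvd fact m" "\<not> p dvd fact (2 * m + 1 - m)"
          using prime_dvd_fact_iff[OF p(1)] by blast+
        ultimately show ?thesis using p by (simp add: prime_dvd_mult_iff)
      qed
      hence "\<Prod>?Q dvd (2 * m + 1) choose m" using fin by (intro prod_primes_dvd) auto
      moreover have "(2 * m + 1) choose m > 0" by simp
      ultimately show ?thesis by (rule dvd_imp_le)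
    qed
    hence "\<Prod>?Q \<le> 4 ^ m" using binomial_middle_le le_trans by blast
    ultimately have "\<Prod>(?P n) \<le> 4 ^ (m + 1) * 4 ^ m" by (simp only: mult_le_mono)
    also have "\<dots> = 4 ^ n" by (simp add: m power_add mult_2)
    finally show ?thesis .
  qed
qed

text \<open>The base 6 is picked between 4, the growth rate of the primorial bound, and exp 2. The
  slack on the left absorbs polynomial factors, so a prime can be found above a run near x 4^x and
  yet below exp (2 x).\<close>

lemma exp_six: "6 ^ x \<le> exp (2 * real x)"
proof -
  have "(5/2 :: real) \<le> exp 1" using exp_lower_Taylor_quadratic[of 1] by simp
  hence "(5/2 :: real) ^ 2 \<le> exp 1 ^ 2" by (intro power_mono) auto
  hence "(6::real) \<le> exp 2" by (simp add: power2_eq_square exp_add[symmetric])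
  hence "(6::real) ^ x \<le> exp 2 ^ x" by (intro power_mono) auto
  thus ?thesis by (simp add: exp_of_nat_mult[symmetric] mult.commute)
qed

lemma growth_six: "x \<ge> 20 \<Longrightarrow> 6 * x * (x + 2) * 4 ^ x < (6::nat) ^ x"
proof (induction x rule: nat_induct_at_least)
  case base
  show ?case by simp
next
  case (Suc n)
  have "4 * ((n + 1) * (n + 3)) \<le> 6 * (n * (n + 2))"
  proof -
    have "20 * n \<le> n * n" using Suc.hyps by (rule mult_le_mono1)
    hence "12 + n * 4 \<le> n * (n * 2)" using Suc.hyps by linarith
    thus ?thesis by (simp add: algebra_simps)
  qed
  hence "4 * ((n + 1) * (n + 3)) * (6 * 4 ^ n) \<le> 6 * (n * (n + 2)) * (6 * 4 ^ n)" by (rule mult_le_mono1)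
  moreover have "6 * (6 * n * (n + 2) * 4 ^ n) < 6 * 6 ^ n" using Suc.IH by (intro mult_strict_left_mono) auto
  ultimately have *: "4 * ((n + 1) * (n + 3)) * (6 * 4 ^ n) < 6 * 6 ^ n" by (simp only: mult_ac)
  have "6 * Suc n * (Suc n + 2) * 4 ^ Suc n = 4 * ((n + 1) * (n + 3)) * (6 * 4 ^ n)" by (simp add: algebra_simps)
  also have "\<dots> < 6 ^ Suc n" using * by simp
  finally show ?case .
qed

text \<open>Otherwise all primes up to 6^x would be at most B, against the Chebyshev bound of at
  least 6^x/(6 x) of them. Such a prime is required because \<open>max_prime_gap\<close> admits a
  gap only if its upper end lies below the bound.\<close>

lemma exists_prime_between:
  assumes x: "x \<ge> 20" and B: "B \<le> (x + 2) * 4 ^ x"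
  obtains p where "prime p" "B < p" "p \<le> 6 ^ x"
proof -
  have "\<exists>p. prime p \<and> B < p \<and> p \<le> (6::nat) ^ x"
  proof (rule ccontr)
    assume no: "\<not> ?thesis"
    have x1: "(6::nat) ^ x \<ge> 6 ^ 1" using x by (intro power_increasing) auto
    have "{p::nat. prime p \<and> p \<le> 6 ^ x} \<subseteq> {1..B}"
    proof
      fix p :: nat assume "p \<in> {p. prime p \<and> p \<le> 6 ^ x}"
      hence p: "prime p" "p \<le> 6 ^ x" by blast+
      hence "p \<le> B" using no by (meson not_less)
      thus "p \<in> {1..B}" using prime_ge_1_nat[OF p(1)] by simp
    qed
    hence "card {p::nat. prime p \<and> p \<le> 6 ^ x} \<le> card {1..B}" by (intro card_mono) auto
    hence "real (card {p::nat. prime p \<and> p \<le> 6 ^ x}) \<le> real B" by simp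
    moreover have "real (card {p::nat. prime p \<and> p \<le> 6 ^ x}) \<ge> real (6 ^ x) / (3 * ln (real (6 ^ x)))"
      using x1 by (intro prime_count_lower) simp
    moreover have "real (6 ^ x) / (3 * ln (real (6 ^ x))) \<ge> 6 ^ x / (6 * real x)"
    proof -
      have "ln (6 ^ x) \<le> ln (exp (2 * real x))" using exp_six[of x] by (subst ln_le_cancel_iff) auto
      hence "ln (6 ^ x :: real) \<le> 2 * real x" by simp
      moreover have "ln (6 ^ x :: real) > 0" using x by (simp add: ln_realpow)
      ultimately show ?thesis using x by (intro frac_le) auto
    qed
    ultimately have "6 ^ x / (6 * real x) \<le> real B" by linarith
    hence "6 ^ x \<le> 6 * real x * real B" using x by (simp add: field_simps)
    also have "real B \<le> real ((x + 2) * 4 ^ x)" using B by (simp only: of_nat_le_iff)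
    finally have "6 ^ x \<le> 6 * real x * real ((x + 2) * 4 ^ x)" by (simp add: mult_left_mono)
    also have "\<dots> = real (6 * x * (x + 2) * 4 ^ x)" by (simp only: of_nat_mult of_nat_numeral mult.assoc)
    finally have "real (6 ^ x) \<le> real (6 * x * (x + 2) * 4 ^ x)" by simp
    hence "6 ^ x \<le> 6 * x * (x + 2) * 4 ^ x" by (simp only: of_nat_le_iff)
    thus False using growth_six[OF x] by linarith
  qed
  thus ?thesis using that by blast
qed

text \<open>The gap is the one between the last prime up to N and the first prime after it: N \<ge>
  2 provides the former, and \<open>p\<close> keeps the latter at most X.\<close>

lemma max_prime_gap_ge:
  assumes N: "N \<ge> 2" and comp: "\<And>n. N < n \<Longrightarrow> n \<le> N + y \<Longrightarrow> \<not> prime n"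
    and p: "prime p" "N + y < p" "real p \<le> X"
  shows "max_prime_gap X \<ge> y"
proof -
  define p0 where "p0 = Max {p. prime p \<and> p \<le> N}"
  define p1 where "p1 = (LEAST p. prime p \<and> N < p)"
  have fin: "finite {p. prime p \<and> p \<le> N}" by simp
  have "2 \<in> {p. prime p \<and> p \<le> N}" using N by simp
  hence p0: "prime p0" "p0 \<le> N" using Max_in[OF fin] unfolding p0_def by blast+
  have p0_max: "r \<le> p0" if "prime r" "r \<le> N" for r
    unfolding p0_def using that fin by (intro Max_ge) auto
  have "prime p \<and> N < p" using p by simp
  hence p1: "prime p1" "N < p1" "p1 \<le> p"
    unfolding p1_def using LeastI[of "\<lambda>p. prime p \<and> N < p" p] Least_le[of "\<lambda>p. prime p \<and> N < p" p] by blast+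
  have p1_min: "p1 \<le> r" if "prime r" "N < r" for r
    unfolding p1_def using that by (intro Least_le) auto
  have gap: "N + y < p1" using comp[of p1] p1 by force
  have cons: "consecutive_primes p0 p1"
    unfolding consecutive_primes_def using p0 p1 p0_max p1_min by (metis leD less_le_trans linorder_not_le)
  let ?S = "{p' - p | p p'. consecutive_primes p p' \<and> real p' \<le> X}"
  have "?S \<subseteq> {..nat \<lfloor>X\<rfloor>}"
  proof safe
    fix a b :: nat assume "real b \<le> X"
    thus "b - a \<le> nat \<lfloor>X\<rfloor>" by (simp add: le_nat_floor)
  qed
  hence "finite ?S" by (rule finite_subset) auto
  moreover have "p1 - p0 \<in> ?S"
  proof -
    have "real p1 \<le> X" using p1(3) p(3) by linarith
    thus ?thesis using cons by blast
  qed
  ultimately have "p1 - p0 \<le> max_prime_gap X" unfolding max_prime_gap_def by (rule Max_ge)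
  thus ?thesis using gap p0 by linarith
qed

text \<open>By the Chinese remainder theorem, the covering can be translated to one by the classes \<open>0 mod p\<close>.\<close>
lemma max_prime_gap_of_covering:
  assumes x: "x \<ge> 20" and bd: "n\<^sub>0 + y \<le> x ^ 2"
    and cover: "\<And>n. n \<in> {n\<^sub>0<..n\<^sub>0+y} \<Longrightarrow> \<exists>p. prime p \<and> p \<le> x \<and> [n = b p] (mod p)"
  shows "max_prime_gap (exp (2 * real x)) \<ge> y"
proof -
  let ?P = "{p. prime p \<and> p \<le> x}"
  define M where "M = \<Prod>?P"
  have M: "M > 0" unfolding M_def by (intro prod_pos) (auto simp: prime_gt_0_nat)
  have fin: "finite ?P" by simp
  \<comment> \<open>\<open>p - b p mod p\<close> is minus \<open>b p\<close> modulo p, kept within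
    the naturals: translation by \<open>t\<close> sends the class of \<open>b p\<close> to the class
    0.\<close>
  obtain t where t: "\<And>p. p \<in> ?P \<Longrightarrow> [t = p - b p mod p] (mod p)"
    using chinese_remainder_nat[of ?P "\<lambda>p. p" "\<lambda>p. p - b p mod p"] fin primes_coprime by auto
  \<comment> \<open>The summand \<open>M * x\<close> pushes the run beyond \<open>x\<close>, so that
    a member divisible by some p \<le> x cannot be p itself.\<close>
  define N where "N = t mod M + M * x + n\<^sub>0"
  have tM: "[t mod M + M * x = t] (mod p)" if "p \<in> ?P" for p
  proof -
    have "p dvd M" unfolding M_def using that fin dvd_prodI[of ?P p "\<lambda>x. x"] by simp
    moreover have "[t mod M + M * x = t] (mod M)" by (simp add: cong_def)
    ultimately show ?thesis using cong_dvd_modulus_nat by blast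
  qed
  have xN: "x \<le> t mod M + M * x" using M by (simp add: trans_le_add2)
  show ?thesis
  proof -
    have M4: "M \<le> 4 ^ x" unfolding M_def by (rule primorial_le)
    have "t mod M + M * x \<le> M * (x + 1)" using mod_less_divisor[OF M, of t] by simp
    also have "\<dots> \<le> 4 ^ x * (x + 1)" using M4 by (rule mult_le_mono1)
    finally have "t mod M + M * x \<le> 4 ^ x * (x + 1)" .
    moreover have "x ^ 2 \<le> 4 ^ x"
    proof -
      have "x \<le> 2 ^ x" using less_exp[of x] by simp
      hence "x ^ 2 \<le> (2 ^ x) ^ 2" by (intro power_mono) auto
      also have "\<dots> = (2 ^ 2) ^ x" by (simp only: power_mult[symmetric] mult.commute)
      also have "\<dots> = 4 ^ x" by simp
      finally show ?thesis .
    qed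
    ultimately have "N + y \<le> (x + 2) * 4 ^ x" using bd unfolding N_def by (simp add: algebra_simps)
    from exists_prime_between[OF x this] obtain p where p: "prime p" "N + y < p" "p \<le> 6 ^ x" by blast
    have "real p \<le> real (6 ^ x)" using p by (simp only: of_nat_le_iff)
    also have "\<dots> \<le> exp (2 * real x)" using exp_six[of x] by simp
    finally have "real p \<le> exp (2 * real x)" .
    moreover have "\<not> prime n" if n: "N < n" "n \<le> N + y" for n
    proof
      assume pr: "prime n"
      define k where "k = n - (t mod M + M * x)"
      have k: "k \<in> {n\<^sub>0<..n\<^sub>0+y}" "n = (t mod M + M * x) + k" using n unfolding k_def N_def by auto
      from cover[OF k(1)] obtain p where p: "prime p" "p \<le> x" "[k = b p] (mod p)" by blast
      hence pP: "p \<in> ?P" by simp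
      have "[n = (p - b p mod p) + b p] (mod p)"
        unfolding k(2) using cong_trans[OF tM[OF pP] t[OF pP]] p(3) by (rule cong_add)
      moreover have "[(p - b p mod p) + b p = (p - b p mod p) + b p mod p] (mod p)"
        by (simp add: cong_def mod_simps)
      moreover have "(p - b p mod p) + b p mod p = p" using p prime_gt_0_nat[of p] mod_less_divisor[of p "b p"] by simp
      ultimately have "[n = p] (mod p)" using cong_trans by metis
      hence "p dvd n" by (simp add: cong_def dvd_eq_mod_eq_0)
      hence "p = n" using pr p(1) by (simp add: primes_dvd_imp_eq)
      thus False using p(2) n xN unfolding N_def by simp
    qed
    moreover have "N \<ge> 2" using x xN unfolding N_def by simp
    ultimately show ?thesis using p(1,2) by (intro max_prime_gap_ge[of N y p]) auto
  qed
qed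

section \<open>Covering by a sparse progression\<close>

lemma greedy_residue:
  fixes p :: nat
  assumes A: "finite A" and p: "p > 0"
  obtains c where "real (card {n\<in>A. \<not> [n = c] (mod p)}) \<le> real (card A) * (1 - 1 / real p)"
proof -
  let ?C = "\<lambda>c. {n\<in>A. n mod p = c}"
  have "\<exists>c<p. card A \<le> card (?C c) * p"
  proof (rule ccontr)
    assume "\<not> ?thesis"
    hence small: "card (?C c) * p < card A" if "c < p" for c using that by force
    have "A = (\<Union>c<p. ?C c)" using p by auto
    hence "card A = card (\<Union>c<p. ?C c)" by (rule arg_cong)
    also have "\<dots> = (\<Sum>c<p. card (?C c))" using A by (intro card_UN_disjoint) auto
    finally have "card A * p = (\<Sum>c<p. card (?C c) * p)" by (simp add: sum_distrib_right)
    also have "\<dots> < (\<Sum>c<p. card A)" using p small by (intro sum_strict_mono) auto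
    finally show False by simp
  qed
  then obtain c where c: "c < p" "card A \<le> card (?C c) * p" by blast
  have "{n\<in>A. \<not> [n = c] (mod p)} = A - ?C c" using c by (auto simp: cong_def)
  hence "card {n\<in>A. \<not> [n = c] (mod p)} = card A - card (?C c)" using A by (simp add: card_Diff_subset)
  moreover have "card (?C c) \<le> card A" using A by (intro card_mono) auto
  ultimately have "real (card {n\<in>A. \<not> [n = c] (mod p)}) = real (card A) - real (card (?C c))"
    by (simp add: of_nat_diff)
  moreover have "real (card A) \<le> real (card (?C c)) * real p"
    using c(2) by (metis of_nat_le_iff of_nat_mult)
  hence "real (card A) / real p \<le> real (card (?C c))" using p by (simp add: divide_le_eq)
  ultimately have "real (card {n\<in>A. \<not> [n = c] (mod p)}) \<le> real (card A) * (1 - 1 / real p)"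
    by (simp add: algebra_simps)
  thus ?thesis by (rule that)
qed

text \<open>Each modulus in turn removes the most frequent class among what the others have left.
  For the prime divisors of \<open>q\<close> the product is phi(q)/q.\<close>

lemma greedy_sieve:
  fixes P :: "nat set"
  assumes P: "finite P" "\<And>p. p \<in> P \<Longrightarrow> p > 0" and A: "finite A"
  shows "\<exists>b. real (card {n\<in>A. \<forall>p\<in>P. \<not> [n = b p] (mod p)}) \<le> real (card A) * (\<Prod>p\<in>P. 1 - 1 / real p)"
  using P
proof (induction P rule: finite_induct)
  case empty
  thus ?case by simp
next
  case (insert p P)
  then obtain b where b: "real (card {n\<in>A. \<forall>p\<in>P. \<not> [n = b p] (mod p)}) \<le> real (card A) * (\<Prod>p\<in>P. 1 - 1 / real p)"
    by auto
  let ?R = "{n\<in>A. \<forall>p\<in>P. \<not> [n = b p] (mod p)}"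
  have p: "p > 0" using insert by simp
  have fin: "finite ?R" using A by simp
  obtain c where c: "real (card {n\<in>?R. \<not> [n = c] (mod p)}) \<le> real (card ?R) * (1 - 1 / real p)"
    using greedy_residue[OF fin p] by blast
  have "{n\<in>A. \<forall>r\<in>insert p P. \<not> [n = (b(p := c)) r] (mod r)} = {n\<in>?R. \<not> [n = c] (mod p)}"
    using insert.hyps by auto
  hence "real (card {n\<in>A. \<forall>r\<in>insert p P. \<not> [n = (b(p := c)) r] (mod r)}) \<le> real (card ?R) * (1 - 1 / real p)"
    using c by (simp only:)
  also have "\<dots> \<le> real (card A) * (\<Prod>p\<in>P. 1 - 1 / real p) * (1 - 1 / real p)"
    using p by (intro mult_right_mono b) simp
  also have "\<dots> = real (card A) * (\<Prod>r\<in>insert p P. 1 - 1 / real r)"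
    using insert.hyps by (simp add: mult_ac)
  finally show ?case by blast
qed

text \<open>With at least as many moduli as elements, each element gets a modulus of its
  own.\<close>

lemma one_class_each:
  fixes R P :: "nat set"
  assumes "finite R" "finite P" "card R \<le> card P"
  shows "\<exists>b. \<forall>n\<in>R. \<exists>p\<in>P. [n = b p] (mod p)"
proof -
  obtain f where f: "f ` R \<subseteq> P" "inj_on f R" using card_le_inj[OF assms] by blast
  have "[n = inv_into R f (f n)] (mod f n)" if "n \<in> R" for n
    using f that by (simp add: inv_into_f_f)
  thus ?thesis using f by blast
qed

text \<open>
  A progression \<open>q n + a\<close> with few primes is covered in three steps: the primes \<open>p \<le> w\<close> not
  dividing \<open>q\<close> remove the \<open>n\<close> with \<open>q n + a\<close> composite; the primes dividing \<open>q\<close>, used greedily,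
  save the factor \<open>\<phi>(q)/q\<close>; the primes in \<open>(w, x]\<close> remove one remaining \<open>n\<close> each.
\<close>
lemma covering_of_sparse_progression:
  fixes q a Z w x :: nat
  assumes q: "q \<ge> 2" and a: "0 < a" "a < q" "coprime a q"
    and w: "q \<le> w" "w \<le> x" "2 * Z \<le> w\<^sup>2"
    and few: "real (card {p. prime p \<and> Z < p \<and> p \<le> 2 * Z \<and> p mod q = a}) * real (totient q) / real q + real w
        \<le> real (card {p. prime p \<and> p \<le> x})"
  shows "\<exists>b. \<forall>n\<in>{Z div q<..Z div q + (Z div q - 1)}. \<exists>p. prime p \<and> p \<le> x \<and> [n = b p] (mod p)"
proof -
  \<comment> \<open>One term fewer than Z div q, so that n + 1 \<le> 2 (Z div q); with a < q this
    keeps q n + a \<le> 2 Z.\<close>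
  define I where "I = {Z div q<..Z div q + (Z div q - 1)}"
  define S where "S = {n\<in>I. prime (q * n + a)}"
  have finS: "finite S" by (simp add: S_def I_def)
  have range: "Z < q * n + a" "q * n + a \<le> 2 * Z" if "n \<in> I" for n
  proof -
    have Zq: "q * (Z div q) \<le> Z" "Z < q * (Z div q + 1)"
      using q by (simp, metis Suc_eq_plus1 dividend_less_times_div add.commute mult_Suc_right less_le_trans zero_less_numeral)
    have n: "Z div q + 1 \<le> n" "n + 1 \<le> 2 * (Z div q)" using that by (auto simp: I_def)
    have "q * (Z div q + 1) \<le> q * n" using n by (intro mult_left_mono) auto
    thus "Z < q * n + a" using Zq by linarith
    have "q * (n + 1) \<le> q * (2 * (Z div q))" using n by (intro mult_left_mono) auto
    moreover have "q * (n + 1) = q * n + q" by simp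
    ultimately show "q * n + a \<le> 2 * Z" using Zq a by linarith
  qed
  have cardS: "card S \<le> card {p. prime p \<and> Z < p \<and> p \<le> 2 * Z \<and> p mod q = a}"
  proof (rule card_inj_on_le[of "\<lambda>n. q * n + a"])
    show "inj_on (\<lambda>n. q * n + a) S" using q by (auto simp: inj_on_def)
    show "(\<lambda>n. q * n + a) ` S \<subseteq> {p. prime p \<and> Z < p \<and> p \<le> 2 * Z \<and> p mod q = a}"
      using range a by (auto simp: S_def)
  qed simp
  obtain b1 where b1: "real (card {n\<in>S. \<forall>p\<in>prime_factors q. \<not> [n = b1 p] (mod p)}) \<le> real (card S) * (\<Prod>p\<in>prime_factors q. 1 - 1 / real p)"
    using greedy_sieve[of "prime_factors q" S] finS by (auto simp: prime_factors_gt_0_nat)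
  define R where "R = {n\<in>S. \<forall>p\<in>prime_factors q. \<not> [n = b1 p] (mod p)}"
  have "real (totient q) / real q = (\<Prod>p\<in>prime_factors q. 1 - 1 / real p)"
    using totient_formula2[of q] q by simp
  hence "real (card R) \<le> real (card S) * (real (totient q) / real q)" using b1 unfolding R_def by simp
  also have "\<dots> \<le> real (card {p. prime p \<and> Z < p \<and> p \<le> 2 * Z \<and> p mod q = a}) * (real (totient q) / real q)"
    using cardS by (intro mult_right_mono) auto
  finally have "real (card R) + real w \<le> real (card {p. prime p \<and> p \<le> x})" using few by simp
  hence "card R + w \<le> card {p. prime p \<and> p \<le> x}" by linarith
  \<comment> \<open>The primes up to \<open>w\<close> are counted trivially by \<open>w\<close>,
    which is why \<open>few\<close> carries that summand.\<close>
  also have "\<dots> \<le> card ({p. prime p \<and> w < p \<and> p \<le> x} \<union> {1..w})"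
  proof (rule card_mono)
    show "{p. prime p \<and> p \<le> x} \<subseteq> {p. prime p \<and> w < p \<and> p \<le> x} \<union> {1..w}"
    proof
      fix p assume "p \<in> {p. prime p \<and> p \<le> x}"
      thus "p \<in> {p. prime p \<and> w < p \<and> p \<le> x} \<union> {1..w}"
        using prime_ge_1_nat[of p] by (cases "w < p") auto
    qed
  qed simp
  also have "\<dots> \<le> card {p. prime p \<and> w < p \<and> p \<le> x} + w"
    using card_Un_le[of "{p. prime p \<and> w < p \<and> p \<le> x}" "{1..w}"] by simp
  finally have "card R \<le> card {p. prime p \<and> w < p \<and> p \<le> x}" by (rule add_le_imp_le_right)
  moreover have "finite R" using finS by (simp add: R_def)
  moreover have "finite {p. prime p \<and> w < p \<and> p \<le> x}" by simp
  ultimately obtain b2 where b2: "\<And>n. n \<in> R \<Longrightarrow> \<exists>p\<in>{p. prime p \<and> w < p \<and> p \<le> x}. [n = b2 p] (mod p)"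
    using one_class_each[of R "{p. prime p \<and> w < p \<and> p \<le> x}"] by blast
  have "\<exists>c. \<forall>p. prime p \<and> \<not> p dvd q \<longrightarrow> p dvd q * c p + a"
  proof (intro choice allI)
    fix p
    show "\<exists>c. prime p \<and> \<not> p dvd q \<longrightarrow> p dvd q * c + a"
    proof (cases "prime p \<and> \<not> p dvd q")
      case True
      hence "coprime q p" by (metis coprime_commute prime_imp_coprime)
      then obtain i where "[q * i = Suc 0] (mod p)" using cong_solve_coprime_nat by blast
      hence i: "[q * i = 1] (mod p)" by simp
      \<comment> \<open>\<open>a * (p - 1)\<close> plays the part of -a modulo p.\<close>
      have "[q * i * (a * (p - 1)) + a = 1 * (a * (p - 1)) + a] (mod p)"
        by (intro cong_add cong_mult i cong_refl)
      moreover have "1 * (a * (p - 1)) + a = a * p" using True prime_gt_0_nat[of p] by (cases p) auto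
      ultimately have "[q * (i * (a * (p - 1))) + a = a * p] (mod p)" by (simp only: mult.assoc)
      hence "p dvd q * (i * (a * (p - 1))) + a" by (simp add: cong_def dvd_eq_mod_eq_0)
      thus ?thesis by blast
    qed blast
  qed
  then obtain c where c: "\<And>p. prime p \<Longrightarrow> \<not> p dvd q \<Longrightarrow> p dvd q * c p + a" by blast
  \<comment> \<open>The three kinds of primes do not interfere: since q \<le> w, a prime beyond
    \<open>w\<close> does not divide \<open>q\<close>.\<close>
  define b where "b = (\<lambda>p. if p dvd q then b1 p else if p \<le> w then c p else b2 p)"
  have "\<exists>p. prime p \<and> p \<le> x \<and> [n = b p] (mod p)" if n: "n \<in> I" for n
  proof (cases "prime (q * n + a)")
    case False
    define N where "N = q * n + a"
    have "\<not> prime N" using False by (simp add: N_def)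
    have N1: "N > 1"
    proof -
      have "n \<ge> 1" using n by (simp add: I_def)
      hence "q * 1 \<le> q * n" by (intro mult_left_mono) auto
      thus ?thesis using q unfolding N_def by linarith
    qed
    \<comment> \<open>A composite N \<le> 2 Z \<le> w^2 has a prime factor p \<le> w, and p does not
      divide \<open>q\<close> because \<open>a\<close> is coprime to \<open>q\<close>; so
      \<open>b p\<close> is \<open>c p\<close>.\<close>
    then obtain d where d: "d dvd N" "d\<^sup>2 \<le> N" "d \<noteq> 1" using \<open>\<not> prime N\<close> prime_divisor_sqrt[of N] by auto
    obtain p where p: "prime p" "p dvd d" using prime_factor_nat[OF d(3)] by blast
    have pN: "p dvd N" using p d dvd_trans by blast
    have "d > 0" using d N1 by (intro Nat.gr0I) auto
    hence "p \<le> d" using p dvd_imp_le by blast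
    hence "p\<^sup>2 \<le> d\<^sup>2" by (intro power_mono) auto
    hence "p\<^sup>2 \<le> w\<^sup>2" using d range(2)[OF n] w unfolding N_def by linarith
    hence pw: "p \<le> w" by (simp add: power2_nat_le_eq_le)
    have pq: "\<not> p dvd q"
    proof
      assume pq: "p dvd q"
      hence "p dvd a" using pN unfolding N_def by (metis dvd_add_right_iff dvd_mult2)
      thus False using pq a(3) p(1) by (metis coprime_common_divisor not_prime_unit)
    qed
    have "[q * n + a = q * c p + a] (mod p)"
      using pN c[OF p(1) pq] unfolding N_def by (simp add: cong_def dvd_eq_mod_eq_0)
    hence "[q * n = q * c p] (mod p)" by (simp add: cong_add_rcancel_nat)
    moreover have "coprime q p" using p pq by (metis coprime_commute prime_imp_coprime)
    ultimately have "[n = c p] (mod p)" using cong_mult_lcancel_nat by blast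
    thus ?thesis using p pw pq w unfolding b_def by (intro exI[of _ p]) auto
  next
    case True
    hence nS: "n \<in> S" using n by (simp add: S_def)
    show ?thesis
    proof (cases "n \<in> R")
      case True
      then obtain p where p: "prime p" "w < p" "p \<le> x" "[n = b2 p] (mod p)" using b2 by blast
      have "\<not> p dvd q" using p w q by (auto dest!: dvd_imp_le)
      thus ?thesis using p unfolding b_def by (intro exI[of _ p]) auto
    next
      case False
      then obtain p where p: "p \<in> prime_factors q" "[n = b1 p] (mod p)" using nS by (auto simp: R_def)
      hence "p dvd q" "prime p" by auto
      moreover from this have "p \<le> x" using q w dvd_imp_le[of p q] by simp
      ultimately show ?thesis using p unfolding b_def by (intro exI[of _ p]) auto
    qed
  qed
  thus ?thesis unfolding I_def by blast
qed

section \<open>Choice of the scale and of the constants\<close>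

context exceptional_zero
begin

lemma exists_scale:
  obtains l where "2 ^ l \<ge> 8 * real q / \<delta>" "2 ^ l \<le> real q ^ 37"
proof -
  define B where "B = 8 * real q / \<delta>"
  have "8 * real q * \<delta> \<le> 8 * real q * 1" using \<delta> by (intro mult_left_mono) auto
  hence B1: "B \<ge> 8 * real q" unfolding B_def using \<delta> by (simp add: le_divide_eq)
  hence Bq: "B > 1" using q by simp
  have "(1::real) < 2" by simp
  from real_arch_pow[OF this] obtain k where "B < 2 ^ k" by blast
  define l where "l = (LEAST k. B \<le> 2 ^ k)"
  have l: "B \<le> 2 ^ l" unfolding l_def using LeastI[of "\<lambda>k. B \<le> 2 ^ k" k] \<open>B < 2 ^ k\<close> by simp
  have "l \<noteq> 0" using l Bq by (intro notI) simp
  then obtain i where i: "l = Suc i" by (cases l) auto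
  have "\<not> B \<le> 2 ^ i" using not_less_Least[of i "\<lambda>k. B \<le> 2 ^ k"] i unfolding l_def by simp
  hence "2 ^ l \<le> 2 * B" using i by simp
  \<comment> \<open>Minimality of \<open>l\<close> gives 2^l \<le> 16 q/\<delta>, and 1644167168 =
    16 * 102760448 lies below 2^31 \<le> q^31; thus 37 = 31 + 6.\<close>
  also have "\<dots> \<le> 1644167168 * real q ^ 6"
  proof -
    have "1 \<le> \<delta> * (102760448 * real q ^ 5)" using delta_lower q by (simp add: divide_le_eq)
    hence "8 * real q * 1 \<le> 8 * real q * (\<delta> * (102760448 * real q ^ 5))" by (intro mult_left_mono) auto
    also have "\<dots> = 822083584 * real q ^ 6 * \<delta>" by (simp add: power_numeral_reduce)
    finally show ?thesis unfolding B_def using \<delta> by (simp add: divide_le_eq)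
  qed
  also have "\<dots> \<le> real q ^ 31 * real q ^ 6"
  proof (rule mult_right_mono)
    have "(2::real) ^ 31 \<le> real q ^ 31" using q by (intro power_mono) auto
    thus "1644167168 \<le> real q ^ 31" by simp
  qed simp
  also have "\<dots> = real q ^ 37" by (simp flip: power_add)
  finally show ?thesis using that[of l] l unfolding B_def by simp
qed

lemma large_prime_gap:
  obtains x :: nat where "x > 1" "q \<le> x" "real x \<le> real q ^ 628"
    "real (max_prime_gap (exp (2 * real x))) \<ge> 1 / 20000 * (real x / (\<delta> * ln (real x)))"
proof -
  obtain l where l: "2 ^ l \<ge> 8 * real q / \<delta>" "2 ^ l \<le> real q ^ 37" by (rule exists_scale)
  obtain j a where j: "2 * l \<le> j" "j < 4 * l" and a: "0 < a" "a < q" "coprime a q"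
    and few: "real (card {p. prime p \<and> 2^j < p \<and> p \<le> 2^(Suc j) \<and> p mod q = a}) * real (totient q) \<le> 400 * \<delta> * 2 ^ j"
    using exists_sparse_progression[OF l(1)] by blast
  define Z where "Z = (2::nat) ^ j"
  \<comment> \<open>An upper bound for the number of prime values left after the greedy stage: the
    sparse count times phi(q)/q.\<close>
  define R where "R = 400 * \<delta> * real Z / real q"
  define w where "w = (2::nat) ^ (j div 2 + 1)"
  \<comment> \<open>The factor 24 is 2 * 3 * 4: x \<le> R^4 gives ln x \<le> 4 ln R, so the bound
    x/(3 ln x) for the number of primes up to x is at least 2 R, one R for the survivors and one for
    \<open>w\<close>.\<close>
  define x where "x = nat \<lceil>24 * R * ln R\<rceil>"
  have q0: "real q \<ge> 2" using q by simp
  have sq: "Z \<le> w\<^sup>2" "2 * Z \<le> w\<^sup>2"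
  proof -
    have "j + 1 \<le> (j div 2 + 1) * 2" by presburger
    hence "(2::nat) ^ (j + 1) \<le> 2 ^ ((j div 2 + 1) * 2)" by (intro power_increasing) auto
    thus "2 * Z \<le> w\<^sup>2" by (simp add: Z_def w_def power_mult)
    thus "Z \<le> w\<^sup>2" by simp
  qed
  define s where "s = (2::real) ^ (j div 2)"
  have s1: "s \<ge> 8 * real q / \<delta>"
  proof -
    have "(2::real) ^ l \<le> s" unfolding s_def using j by (intro power_increasing) auto
    thus ?thesis using l by linarith
  qed
  have ws: "real w = 2 * s" by (simp add: w_def s_def)
  have sZ: "s * s \<le> real Z"
  proof -
    have "(2::real) ^ (j div 2 + j div 2) \<le> 2 ^ j" by (intro power_increasing) auto
    thus ?thesis by (simp add: s_def Z_def power_add)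
  qed
  have "8 * real q * \<delta> \<le> 8 * real q * 1" using \<delta> by (intro mult_left_mono) auto
  hence "8 * real q \<le> 8 * real q / \<delta>" using \<delta> by (simp add: le_divide_eq)
  hence s8: "s \<ge> 8 * real q" using s1 by linarith
  have s0: "s > 0" by (simp add: s_def)
  \<comment> \<open>This is why the scale was tied to 8 q/\<delta>: since s \<ge> 8 q/\<delta> and
    s^2 \<le> Z, the product \<delta> Z is at least 8 q s, and R outgrows w = 2 s.\<close>
  have wR: "real w \<le> R"
  proof -
    have "8 * real q \<le> s * \<delta>" using s1 \<delta> by (simp add: divide_le_eq)
    hence "8 * real q * s \<le> s * \<delta> * s" using s0 by (intro mult_right_mono) auto
    also have "\<dots> = \<delta> * (s * s)" by simp
    also have "\<dots> \<le> \<delta> * real Z" using sZ \<delta> by (intro mult_left_mono) auto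
    finally have "8 * real q * s * 400 \<le> 400 * \<delta> * real Z" by (simp add: mult_ac)
    hence "3200 * s \<le> R" unfolding R_def using q0 by (simp add: le_divide_eq mult_ac)
    thus ?thesis using ws s0 by linarith
  qed
  have w32: "real w \<ge> 32" using ws s8 q0 by linarith
  have wq: "q \<le> w"
  proof -
    have "real q \<le> real w" using ws s8 q0 by linarith
    thus ?thesis by (simp only: of_nat_le_iff)
  qed
  have R32: "R \<ge> 32" using wR w32 by linarith
  have lnR1: "ln R \<ge> 1"
  proof -
    have "exp 1 \<le> R" using exp_le R32 by linarith
    thus ?thesis using R32 by (simp add: ln_ge_iff)
  qed
  have lnRR: "ln R \<le> R" using ln_le_minus_one[of R] R32 by linarith
  have RlnR: "R \<le> R * ln R" using lnR1 R32 mult_left_mono[of 1 "ln R" R] by simp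
  have x_ge: "24 * R * ln R \<le> real x" unfolding x_def by linarith
  have x_le: "real x \<le> 25 * (R * ln R)"
  proof -
    have "24 * R * ln R \<ge> 0" using R32 lnR1 by simp
    hence "real x \<le> 24 * R * ln R + 1" unfolding x_def by linarith
    hence "real x \<le> 24 * (R * ln R) + 1" by (simp only: mult.assoc)
    thus ?thesis using RlnR R32 by linarith
  qed
  have "24 * (R * ln R) \<le> real x" using x_ge by (simp only: mult.assoc)
  hence xR: "real x \<ge> R" using RlnR R32 by linarith
  have x4: "real x \<le> R ^ 4"
  proof -
    have "R * ln R \<le> R * R" using lnRR R32 by (intro mult_left_mono) auto
    hence "real x \<le> 25 * (R * R)" using x_le by linarith
    also have "\<dots> \<le> (R * R) * (R * R)"
    proof (rule mult_right_mono)
      have "5 * 5 \<le> R * R" using R32 by (intro mult_mono) auto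
      thus "25 \<le> R * R" by simp
    qed simp
    also have "\<dots> = R ^ 4" by (simp add: power_numeral_reduce)
    finally show ?thesis .
  qed
  have lnx: "ln (real x) > 0" "ln R \<le> ln (real x)" "ln (real x) \<le> 4 * ln R"
  proof -
    show "ln R \<le> ln (real x)" using xR R32 by simp
    thus "ln (real x) > 0" using lnR1 by linarith
    have "ln (real x) \<le> ln (R ^ 4)" using x4 xR R32 by (subst ln_le_cancel_iff) auto
    thus "ln (real x) \<le> 4 * ln R" using R32 by (simp add: ln_realpow)
  qed
  have wx: "w \<le> x"
  proof -
    have "real w \<le> real x" using wR xR by linarith
    thus ?thesis by (simp only: of_nat_le_iff)
  qed
  have x32: "x \<ge> 32"
  proof -
    have "real 32 \<le> real x" using R32 xR by simp
    thus ?thesis by (simp only: of_nat_le_iff)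
  qed
  have pi: "real (card {p. prime p \<and> p \<le> x}) \<ge> 2 * R"
  proof -
    have "2 * R * (3 * ln (real x)) \<le> 2 * R * (3 * (4 * ln R))" using lnx R32 by (intro mult_left_mono) auto
    also have "\<dots> = 24 * R * ln R" by simp
    also have "\<dots> \<le> real x" by (rule x_ge)
    finally have "2 * R \<le> real x / (3 * ln (real x))" using lnx by (simp add: le_divide_eq)
    also have "\<dots> \<le> real (card {p. prime p \<and> p \<le> x})" using x32 by (intro prime_count_lower) auto
    finally show ?thesis .
  qed
  have "\<exists>b. \<forall>n\<in>{Z div q<..Z div q + (Z div q - 1)}. \<exists>p. prime p \<and> p \<le> x \<and> [n = b p] (mod p)"
  proof (rule covering_of_sparse_progression[OF q a wq wx sq(2)])
    have "real (card {p. prime p \<and> Z < p \<and> p \<le> 2 * Z \<and> p mod q = a}) * real (totient q) / real q \<le> R"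
      unfolding R_def using few by (intro divide_right_mono) (auto simp: Z_def)
    thus "real (card {p. prime p \<and> Z < p \<and> p \<le> 2 * Z \<and> p mod q = a}) * real (totient q) / real q + real w
        \<le> real (card {p. prime p \<and> p \<le> x})"
      using pi wR by linarith
  qed
  then obtain b where b: "\<And>n. n \<in> {Z div q<..Z div q + (Z div q - 1)} \<Longrightarrow> \<exists>p. prime p \<and> p \<le> x \<and> [n = b p] (mod p)"
    by blast
  have gap: "max_prime_gap (exp (2 * real x)) \<ge> Z div q - 1"
  proof (rule max_prime_gap_of_covering[OF _ _ b])
    show "x \<ge> 20" using x32 by simp
    have "Z div q \<le> Z" by (rule div_le_dividend)
    hence "Z div q + (Z div q - 1) \<le> 2 * Z" by linarith
    also have "\<dots> \<le> w\<^sup>2" by (rule sq)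
    also have "\<dots> \<le> x\<^sup>2" using wx by (intro power_mono) auto
    finally show "Z div q + (Z div q - 1) \<le> x\<^sup>2" .
  qed
  \<comment> \<open>As Z \<ge> 4 q, rounding and the dropped term together cost at most half of
    Z/q.\<close>
  have Zq: "real (Z div q - 1) \<ge> real Z / (2 * real q)"
  proof -
    have "8 * real q * (8 * real q) \<le> s * s" using s8 by (intro mult_mono) auto
    hence "64 * (real q * real q) \<le> real Z" using sZ by simp
    moreover have "real q * 1 \<le> real q * real q" using q0 by (intro mult_left_mono) auto
    ultimately have "4 * real q \<le> real Z" using q0 by linarith
    hence "real Z / real q \<ge> 4" using q0 by (simp add: le_divide_eq)
    moreover have "real (Z div q) > real Z / real q - 1"
    proof -
      have "Z < q * (Z div q + 1)" using q dividend_less_times_div[of q Z] by simp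
      hence "real Z < real (q * (Z div q + 1))" by (simp only: of_nat_less_iff)
      hence "real Z < real q * (real (Z div q) + 1)" by (simp add: distrib_left)
      thus ?thesis using q0 by (simp add: field_simps)
    qed
    moreover have "real (Z div q - 1) \<ge> real (Z div q) - 1" by linarith
    moreover have "real Z / (2 * real q) = real Z / real q / 2" by simp
    ultimately show ?thesis by linarith
  qed
  show ?thesis
  proof (rule that[of x])
    show "x > 1" "q \<le> x" using x32 wq wx by auto
    \<comment> \<open>Here 628 = 4 * 157 because x \<le> R^4, and 157 = 9 + 4 * 37 because 400 \<le>
      q^9 and Z \<le> 2^(4 l).\<close>
    show "real x \<le> real q ^ 628"
    proof -
      have "real Z \<le> (2 ^ l) ^ 4"
      proof -
        have "(2::real) ^ j \<le> 2 ^ (l * 4)" using j by (intro power_increasing) auto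
        thus ?thesis by (simp add: Z_def power_mult)
      qed
      also have "\<dots> \<le> (real q ^ 37) ^ 4" using l(2) by (intro power_mono) auto
      finally have Z148: "real Z \<le> real q ^ 148" by (simp flip: power_mult)
      have "(2::real) ^ 9 \<le> real q ^ 9" using q0 by (intro power_mono) auto
      hence q9: "400 \<le> real q ^ 9" by simp
      have "R \<le> 400 * real Z"
      proof -
        have "\<delta> * (400 * real Z) \<le> real q * (400 * real Z)" using \<delta> q0 by (intro mult_right_mono) auto
        thus ?thesis unfolding R_def using q0 by (simp add: divide_le_eq mult_ac)
      qed
      also have "\<dots> \<le> real q ^ 9 * real q ^ 148" using q9 Z148 by (intro mult_mono) auto
      also have "\<dots> = real q ^ 157" by (simp flip: power_add)
      finally have "R ^ 4 \<le> (real q ^ 157) ^ 4" using R32 by (intro power_mono) auto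
      hence "R ^ 4 \<le> real q ^ 628" by (simp flip: power_mult)
      with x4 show ?thesis by (rule order_trans)
    qed
    \<comment> \<open>The constant 20000 is 2 * 25 * 400, from \<open>Zq\<close>,
      \<open>x_le\<close> and the definition of \<open>R\<close>.\<close>
    show "real (max_prime_gap (exp (2 * real x))) \<ge> 1 / 20000 * (real x / (\<delta> * ln (real x)))"
    proof -
      have "real x \<le> 25 * (R * ln (real x))"
      proof -
        have "R * ln R \<le> R * ln (real x)" using lnx(2) R32 by (intro mult_left_mono) auto
        thus ?thesis using x_le by linarith
      qed
      hence "real x / ln (real x) \<le> 25 * R" using lnx(1) by (simp add: divide_le_eq mult_ac)
      hence "real x / ln (real x) / \<delta> \<le> 25 * R / \<delta>" using \<delta> by (intro divide_right_mono) auto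
      also have "25 * R / \<delta> = 10000 * (real Z / real q)" unfolding R_def using \<delta> by simp
      finally have "real x / (\<delta> * ln (real x)) \<le> 10000 * (real Z / real q)" by (simp add: mult.commute)
      hence "1 / 20000 * (real x / (\<delta> * ln (real x))) \<le> real Z / (2 * real q)" by simp
      also have "\<dots> \<le> real (Z div q - 1)" by (rule Zq)
      also have "\<dots> \<le> real (max_prime_gap (exp (2 * real x)))" using gap by (simp only: of_nat_le_iff)
      finally show ?thesis .
    qed
  qed
qed

end

theorem theorem2:
  shows "\<exists>c\<^sub>1 c\<^sub>2 c\<^sub>3 :: real. c\<^sub>1 > 0 \<and> c\<^sub>2 > 0 \<and> c\<^sub>3 > 0 \<and>
    (\<forall>(m::nat) (chi :: int \<Rightarrow> complex) (q::nat) (\<delta>::real).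
       dirichlet_character m chi \<and> real_character chi \<and> conductor m chi = q \<and>
       0 < \<delta> \<and> \<delta> < 1 \<and> Dirichlet_L chi (complex_of_real (1 - \<delta>)) = 0 \<longrightarrow>
       (\<exists>u::real. u > 1 \<and>
          c\<^sub>1 * ln (real q) \<le> ln u \<and> ln u \<le> c\<^sub>2 * ln (real q) \<and>
          real (max_prime_gap (exp (2 * u))) \<ge> c\<^sub>3 * (u / (\<delta> * ln u))))"
proof (rule exI[of _ 1], rule exI[of _ 628], rule exI[of _ "1 / 20000"], intro conjI allI impI)
  fix m :: nat and chi :: "int \<Rightarrow> complex" and q :: nat and \<delta> :: real
  assume H: "dirichlet_character m chi \<and> real_character chi \<and> conductor m chi = q \<and>
       0 < \<delta> \<and> \<delta> < 1 \<and> Dirichlet_L chi (complex_of_real (1 - \<delta>)) = 0"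
  hence "dirichlet_character m chi" "real_character chi" "conductor m chi = q" "0 < 1 - \<delta>" "1 - \<delta> < 1"
    "Dirichlet_L chi (complex_of_real (1 - \<delta>)) = 0" by auto
  then obtain X :: "int \<Rightarrow> real" where X: "q \<ge> 2"
    "\<And>a b. X (a * b) = X a * X b" "\<And>a. X (a + int q) = X a"
    "\<And>a. X a \<in> {-1, 0, 1}" "\<And>a. X a \<noteq> 0 \<longleftrightarrow> coprime a (int q)"
    "(\<Sum>b<q. X (int (Suc b))) = 0"
    "(\<lambda>j. \<Sum>n\<in>{j*q..<j*q+q}. X (int (Suc n)) / real (Suc n) powr (1 - \<delta>)) sums 0"
    using exceptional_character by blast
  interpret exceptional_zero q "\<lambda>n. X (int n)" \<delta>
  proof
    show "X (int (a * b)) = X (int a) * X (int b)" for a b using X(2) by simp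
    show "X (int (a + q)) = X (int a)" for a using X(3) by simp
    show "X (int a) \<noteq> 0 \<longleftrightarrow> coprime a q" for a using X(5) by simp
  qed (use X H in auto)
  obtain x :: nat where x: "x > 1" "q \<le> x" "real x \<le> real q ^ 628"
    "real (max_prime_gap (exp (2 * real x))) \<ge> 1 / 20000 * (real x / (\<delta> * ln (real x)))"
    by (rule large_prime_gap)
  \<comment> \<open>The exponent 628 becomes the upper constant; the lower constant 1 comes from q
    \<le> x.\<close>
  have "ln (real x) \<le> ln (real q ^ 628)" using x X(1) by (subst ln_le_cancel_iff) auto
  hence "ln (real x) \<le> 628 * ln (real q)" using X(1) by (simp add: ln_realpow)
  moreover have "1 * ln (real q) \<le> ln (real x)" using x X(1) by simp
  ultimately show "\<exists>u::real. u > 1 \<and> 1 * ln (real q) \<le> ln u \<and> ln u \<le> 628 * ln (real q) \<and>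
          real (max_prime_gap (exp (2 * u))) \<ge> 1 / 20000 * (u / (\<delta> * ln u))"
    using x by (intro exI[of _ "real x"]) auto
qed auto

end
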